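(* Let $\mathrm{L}$ be a relational first order signature and let $T$ be an $\mathrm{L}_{\infty\infty}$-theory such that at least one of its sentences is Boolean consistent. Then $T$ is finitely conservative if and only if $\bigwedge T$ is a conservative strengthening of $\bigwedge s$ for every non-empty finite subset $s$ of $T$.
   Context: **Infinitary logics.** A relational first order signature $\mathrm{L}$ consists of relation symbols of finite arity and constant symbols; $\mathcal{D}$ denotes its set of constants. Given cardinals $\kappa,\lambda$ and variables $\{v_\alpha:\alpha<\kappa\}$, the $\mathrm{L}_{\kappa\lambda}$-formulae are built from atomic formulae (including equalities) by: negation $\neg\phi$; $\bigwedge\Phi$ and $\bigvee\Phi$ for sets $\Phi$ of fewer than $\kappa$ formulae whose free variables all lie in a common set of fewer than $\lambda$ variables; $\forall V\phi$ and $\exists V\phi$ for sets $V$ of fewer than $\lambda$ variables. $\mathrm{L}_{\infty\lambda}=\bigcup_\kappa \mathrm{L}_{\kappa\lambda}$ and $\mathrm{L}_{\infty\infty}=\bigcup_{\kappa,\lambda}\mathrm{L}_{\kappa\lambda}$. A sentence is a formula without free variables; a theory is a set of sentences. **Provability.** $\Gamma\vdash\Delta$ (for sets of $\mathrm{L}_{\infty\infty}$-formulae) means that there is a well-founded labelled tree with root $\Gamma\vdash\Delta$, whose leaves are axioms and whose other nodes are obtained from their immediate successors by a rule. Axioms: $\Gamma,\phi\vdash\phi,\Delta$; $\vdash c=c$; $c=d\vdash d=c$; $c=d,d=e\vdash c=e$; $\{u_i=t_i:i\in I\},\phi(t_i:i\in I)\vdash\phi(u_i/t_i:i\in I)$.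 Rules: Cut (from $\Gamma,\phi\vdash\Delta$ and $\Gamma'\vdash\phi,\Delta'$ infer $\Gamma,\Gamma'\vdash\Delta,\Delta'$); Weakening; Substitution of free variables; from $\Gamma,\Gamma'\vdash\Delta$ infer $\Gamma,\bigwedge\Gamma'\vdash\Delta$; from $\Gamma\vdash\phi_i,\Delta$ for all $i\in I$ infer $\Gamma\vdash\bigwedge_{i\in I}\phi_i,\Delta$; from $\Gamma\vdash\Delta,\Delta'$ infer $\Gamma\vdash\Delta,\bigvee\Delta'$; from $\Gamma,\phi_i\vdash\Delta$ for all $i\in I$ infer $\Gamma,\bigvee_{i\in I}\phi_i\vdash\Delta$; from $\Gamma,\phi(\bar t/\bar v)\vdash\Delta$ infer $\Gamma,\forall\bar v\,\phi\vdash\Delta$; from $\Gamma\vdash\phi(\bar v),\Delta$ infer $\Gamma\vdash\forall\bar v\,\phi,\Delta$; from $\Gamma,\phi(\bar v)\vdash\Delta$ infer $\Gamma,\exists\bar v\,\phi\vdash\Delta$; from $\Gamma\vdash\phi(\bar t/\bar v),\Delta$ infer $\Gamma\vdash\exists\bar v\,\phi,\Delta$ (in the right-$\forall$ and left-$\exists$ rules no variable of $\bar v$ is free in $\Gamma\cup\Delta$); and the usual left and right rules for $\neg$. $\phi\vdash\psi$ means $\{\phi\}\vdash\{\psi\}$. **Boolean valued models.** Let $\mathsf{B}$ be a complete Boolean algebra ($0\neq1$). A $\mathsf{B}$-valued model $\mathcal{M}$ for $\mathrm{L}$ is a non-empty set $M$ with a map $(\tau,\sigma)\mapsto[\![\tau=\sigma]\!]\in\mathsf{B}$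 on $M^2$, a map $[\![R(\cdot)]\!]:M^n\to\mathsf{B}$ for each $n$-ary relation symbol $R$, and $c^{\mathcal M}\in M$ for each constant $c$, such that $[\![\tau=\tau]\!]=1$, $[\![\tau=\sigma]\!]=[\![\sigma=\tau]\!]$, $[\![\tau=\sigma]\!]\wedge[\![\sigma=\pi]\!]\le[\![\tau=\pi]\!]$, and $\bigwedge_{i<n}[\![\tau_i=\sigma_i]\!]\wedge[\![R(\tau_i:i<n)]\!]\le[\![R(\sigma_i:i<n)]\!]$. Values of formulae under assignments are defined recursively: $\neg,\bigwedge,\bigvee$ are interpreted by the complement, infima and suprema of $\mathsf{B}$, and $\forall V\phi$, $\exists V\phi$ by the infimum, supremum over all $\bar a\in M^V$ of the value of $\phi$ with $V\mapsto\bar a$. A set $\Gamma$ of formulae is *Boolean consistent* if there are a complete Boolean algebra $\mathsf{B}$, a $\mathsf{B}$-valued model $\mathcal{M}$ and an assignment $\nu$ with $[\![\phi]\!]^{\mathcal{M},\nu}_{\mathsf{B}}=1_{\mathsf{B}}$ for all $\phi\in\Gamma$; a formula $\phi$ is Boolean consistent if $\{\phi\}$ is. **Subsentences.** For an $\mathrm{L}_{\kappa\lambda}$-sentence $\psi$ fix a set $\mathcal{C}$ of size $\lambda$ of fresh constants (not in $\mathrm{L}$). The *subsentences* of $\psi$ are the sentences of the expanded signature $\mathrm{L}(\mathcal{C})=\mathrm{L}\cup\mathcal{C}$ obtained from a subformula $\phi(\vec x)$ of $\psi$ by substituting for its free variables $\vec x$ a string of constants in $\mathcal{D}\cup\mathcal{C}$.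 When several sentences are considered, $\kappa,\lambda$ are fixed large enough that all of them are in $\mathrm{L}_{\kappa\lambda}$, and a single $\mathcal{C}$ of size $\lambda$ is used. **Conservative strengthening.** For $\mathrm{L}_{\infty\infty}$-sentences $\psi_0,\psi_1$, $\psi_1$ is a *conservative strengthening* of $\psi_0$ if $\psi_1\vdash\psi_0$ and for every finite set $s$ of subsentences of $\psi_0$, $s\cup\{\psi_0\}$ is Boolean consistent if and only if $s\cup\{\psi_1\}$ is Boolean consistent. **Finite conservativity.** A theory $\{\psi_i:i\in I\}$ is *finitely conservative* if at least one $\psi_i$ is Boolean consistent, and for all non-empty finite $J_0\subseteq J_1\subseteq I$, $\bigwedge_{i\in J_1}\psi_i$ is a conservative strengthening of $\bigwedge_{i\in J_0}\psi_i$.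
   Formalization: Subformulas are also closed under moving a negation inside (no change in negation normal form); with plain ones {¬⋀P_n}∪{P_n} is a counterexample. Boolean consistency uses models of bounded, sufficient size (Löwenheim–Skolem plus completion). *)

theory Defs
  imports Complex_Main "HOL-Algebra.Complete_Lattice"
begin

unbundle cardinal_syntax

section \<open>Syntax\<close>

text \<open>A relational signature with its set of relation symbols (of finite arity) and its set
  \<open>constants\<close> of constant symbols.\<close>

record ('r, 'c) signature =
  relsyms :: "'r set"
  arity :: "'r \<Rightarrow> nat"
  constants :: "'c set"

definition expand :: "('r, 'c) signature \<Rightarrow> 'c set \<Rightarrow> ('r, 'c) signature" where
  "expand L C = L\<lparr>constants := constants L \<union> C\<rparr>"

datatype ('c, 'v) trm = Var 'v | Const 'c

text \<open>The cardinal \<open>\<kappa>\<close> of \<open>L\<^sub>\<kappa>\<^sub>\<lambda>\<close> is the cardinality of the type \<open>'v\<close> of variables, which is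
  arbitrary. \<open>Conj I f\<close> is the conjunction of the family \<open>(f i)\<close> for \<open>i \<in> I\<close>, that is, of the
  set \<open>f ` I\<close>; the values of \<open>f\<close> outside \<open>I\<close> are irrelevant.\<close>

datatype ('r, 'c, 'v) fm =
    Eq "('c, 'v) trm" "('c, 'v) trm"
  | Rel 'r "('c, 'v) trm list"
  | Neg "('r, 'c, 'v) fm"
  | Conj "'v set" "'v \<Rightarrow> ('r, 'c, 'v) fm"
  | Disj "'v set" "'v \<Rightarrow> ('r, 'c, 'v) fm"
  | All "'v set" "('r, 'c, 'v) fm"
  | Ex "'v set" "('r, 'c, 'v) fm"

primrec tvars :: "('c, 'v) trm \<Rightarrow> 'v set" where
  "tvars (Var x) = {x}"
| "tvars (Const c) = {}"

primrec fv :: "('r, 'c, 'v) fm \<Rightarrow> 'v set" where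
  "fv (Eq t u) = tvars t \<union> tvars u"
| "fv (Rel R ts) = (\<Union>t\<in>set ts. tvars t)"
| "fv (Neg \<phi>) = fv \<phi>"
| "fv (Conj I f) = (\<Union>i\<in>I. fv (f i))"
| "fv (Disj I f) = (\<Union>i\<in>I. fv (f i))"
| "fv (All V \<phi>) = fv \<phi> - V"
| "fv (Ex V \<phi>) = fv \<phi> - V"

definition terms :: "('r, 'c) signature \<Rightarrow> ('c, 'v) trm set" where
  "terms L = range Var \<union> Const ` constants L"

text \<open>\<open>formulas L \<lambda>\<close> is the set of \<open>L\<^sub>\<kappa>\<^sub>\<lambda>\<close>-formulae, with \<open>\<kappa> = |UNIV :: 'v set|\<close> and \<open>\<lambda>\<close> a
  cardinal in the sense of the HOL cardinals, i.e. a minimal well-order.\<close>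

inductive_set formulas :: "('r, 'c) signature \<Rightarrow> 'l rel \<Rightarrow> ('r, 'c, 'v) fm set"
  for L :: "('r, 'c) signature" and lam :: "'l rel" where
  Eq: "t \<in> terms L \<Longrightarrow> u \<in> terms L \<Longrightarrow> Eq t u \<in> formulas L lam"
| Rel: "R \<in> relsyms L \<Longrightarrow> length ts = arity L R \<Longrightarrow> set ts \<subseteq> terms L \<Longrightarrow> Rel R ts \<in> formulas L lam"
| Neg: "\<phi> \<in> formulas L lam \<Longrightarrow> Neg \<phi> \<in> formulas L lam"
| Conj: "|I| <o |UNIV :: 'v set| \<Longrightarrow> (\<And>i. i \<in> I \<Longrightarrow> f i \<in> formulas L lam) \<Longrightarrow>
    |\<Union>i\<in>I. fv (f i)| <o lam \<Longrightarrow> Conj I f \<in> formulas L lam"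
| Disj: "|I| <o |UNIV :: 'v set| \<Longrightarrow> (\<And>i. i \<in> I \<Longrightarrow> f i \<in> formulas L lam) \<Longrightarrow>
    |\<Union>i\<in>I. fv (f i)| <o lam \<Longrightarrow> Disj I f \<in> formulas L lam"
| All: "|V| <o lam \<Longrightarrow> \<phi> \<in> formulas L lam \<Longrightarrow> All V \<phi> \<in> formulas L lam"
| Ex: "|V| <o lam \<Longrightarrow> \<phi> \<in> formulas L lam \<Longrightarrow> Ex V \<phi> \<in> formulas L lam"

definition sentences :: "('r, 'c) signature \<Rightarrow> 'l rel \<Rightarrow> ('r, 'c, 'v) fm set" where
  "sentences L lam = {\<psi> \<in> formulas L lam. fv \<psi> = {}}"

text \<open>Every set of variables is smaller than \<open>UNIV :: 'v set set\<close>, so here \<open>\<lambda>\<close> imposes no bound.\<close>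

definition all_formulas :: "('r, 'c) signature \<Rightarrow> ('r, 'c, 'v) fm set" where
  "all_formulas L = formulas L |UNIV :: 'v set set|"

text \<open>The conjunction of a set of fewer than \<open>\<kappa>\<close> formulae, along some one-to-one enumeration.\<close>

definition big_conj :: "('r, 'c, 'v) fm set \<Rightarrow> ('r, 'c, 'v) fm" where
  "big_conj \<Phi> = (case (SOME (I, f). bij_betw f I \<Phi>) of (I, f) \<Rightarrow> Conj I f)"

primrec tsubst :: "('v \<Rightarrow> ('c, 'v) trm) \<Rightarrow> ('c, 'v) trm \<Rightarrow> ('c, 'v) trm" where
  "tsubst \<sigma> (Var x) = \<sigma> x"
| "tsubst \<sigma> (Const c) = Const c"

definition mask :: "'v set \<Rightarrow> ('v \<Rightarrow> ('c, 'v) trm) \<Rightarrow> 'v \<Rightarrow> ('c, 'v) trm" where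
  "mask V \<sigma> = (\<lambda>x. if x \<in> V then Var x else \<sigma> x)"

text \<open>Simultaneous substitution for the free variables. Bound variables are not renamed; the
  substitution is meant to be used only when \<open>free_for\<close> excludes captures, which is automatic for
  substitutions of constants.\<close>

primrec subst :: "('v \<Rightarrow> ('c, 'v) trm) \<Rightarrow> ('r, 'c, 'v) fm \<Rightarrow> ('r, 'c, 'v) fm" where
  "subst \<sigma> (Eq t u) = Eq (tsubst \<sigma> t) (tsubst \<sigma> u)"
| "subst \<sigma> (Rel R ts) = Rel R (map (tsubst \<sigma>) ts)"
| "subst \<sigma> (Neg \<phi>) = Neg (subst \<sigma> \<phi>)"
| "subst \<sigma> (Conj I f) = Conj I (\<lambda>i. subst \<sigma> (f i))"
| "subst \<sigma> (Disj I f) = Disj I (\<lambda>i. subst \<sigma> (f i))"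
| "subst \<sigma> (All V \<phi>) = All V (subst (mask V \<sigma>) \<phi>)"
| "subst \<sigma> (Ex V \<phi>) = Ex V (subst (mask V \<sigma>) \<phi>)"

primrec free_for :: "('v \<Rightarrow> ('c, 'v) trm) \<Rightarrow> ('r, 'c, 'v) fm \<Rightarrow> bool" where
  "free_for \<sigma> (Eq t u) \<longleftrightarrow> True"
| "free_for \<sigma> (Rel R ts) \<longleftrightarrow> True"
| "free_for \<sigma> (Neg \<phi>) \<longleftrightarrow> free_for \<sigma> \<phi>"
| "free_for \<sigma> (Conj I f) \<longleftrightarrow> (\<forall>i\<in>I. free_for \<sigma> (f i))"
| "free_for \<sigma> (Disj I f) \<longleftrightarrow> (\<forall>i\<in>I. free_for \<sigma> (f i))"
| "free_for \<sigma> (All V \<phi>) \<longleftrightarrow>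
    (\<forall>x\<in>fv \<phi> - V. tvars (\<sigma> x) \<inter> V = {}) \<and> free_for (mask V \<sigma>) \<phi>"
| "free_for \<sigma> (Ex V \<phi>) \<longleftrightarrow>
    (\<forall>x\<in>fv \<phi> - V. tvars (\<sigma> x) \<inter> V = {}) \<and> free_for (mask V \<sigma>) \<phi>"

section \<open>Provability\<close>

text \<open>In the axiom \<open>replace\<close> the formulae \<open>\<phi>(t\<^sub>i : i \<in> I)\<close> and \<open>\<phi>(u\<^sub>i/t\<^sub>i : i \<in> I)\<close> are given as
  the two instances \<open>subst \<sigma> \<phi>\<close> and \<open>subst \<tau> \<phi>\<close> of one formula, whose variables in \<open>X\<close> mark the
  replaced occurrences.\<close>

inductive derives ::
  "('r, 'c) signature \<Rightarrow> ('r, 'c, 'v) fm set \<Rightarrow> ('r, 'c, 'v) fm set \<Rightarrow> bool"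
  for L :: "('r, 'c) signature" where
  ax: "insert \<phi> \<Gamma> \<subseteq> all_formulas L \<Longrightarrow> \<Delta> \<subseteq> all_formulas L \<Longrightarrow>
    derives L (insert \<phi> \<Gamma>) (insert \<phi> \<Delta>)"
| eq_refl: "t \<in> terms L \<Longrightarrow> derives L {} {Eq t t}"
| eq_sym: "t \<in> terms L \<Longrightarrow> u \<in> terms L \<Longrightarrow> derives L {Eq t u} {Eq u t}"
| eq_trans: "t \<in> terms L \<Longrightarrow> u \<in> terms L \<Longrightarrow> w \<in> terms L \<Longrightarrow>
    derives L {Eq t u, Eq u w} {Eq t w}"
| replace: "\<phi> \<in> all_formulas L \<Longrightarrow> range \<sigma> \<subseteq> terms L \<Longrightarrow> range \<tau> \<subseteq> terms L \<Longrightarrow>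
    free_for \<sigma> \<phi> \<Longrightarrow> free_for \<tau> \<phi> \<Longrightarrow> (\<And>x. x \<notin> X \<Longrightarrow> \<sigma> x = \<tau> x) \<Longrightarrow>
    derives L (insert (subst \<sigma> \<phi>) ((\<lambda>x. Eq (\<tau> x) (\<sigma> x)) ` X)) {subst \<tau> \<phi>}"
| cut: "derives L (insert \<phi> \<Gamma>) \<Delta> \<Longrightarrow> derives L \<Gamma>' (insert \<phi> \<Delta>') \<Longrightarrow>
    derives L (\<Gamma> \<union> \<Gamma>') (\<Delta> \<union> \<Delta>')"
| weaken: "derives L \<Gamma> \<Delta> \<Longrightarrow> \<Gamma>' \<subseteq> all_formulas L \<Longrightarrow> \<Delta>' \<subseteq> all_formulas L \<Longrightarrow>
    derives L (\<Gamma> \<union> \<Gamma>') (\<Delta> \<union> \<Delta>')"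
| substitution: "derives L \<Gamma> \<Delta> \<Longrightarrow> range \<sigma> \<subseteq> terms L \<Longrightarrow> (\<And>\<phi>. \<phi> \<in> \<Gamma> \<union> \<Delta> \<Longrightarrow> free_for \<sigma> \<phi>) \<Longrightarrow>
    derives L (subst \<sigma> ` \<Gamma>) (subst \<sigma> ` \<Delta>)"
| neg_left: "derives L \<Gamma> (insert \<phi> \<Delta>) \<Longrightarrow> derives L (insert (Neg \<phi>) \<Gamma>) \<Delta>"
| neg_right: "derives L (insert \<phi> \<Gamma>) \<Delta> \<Longrightarrow> derives L \<Gamma> (insert (Neg \<phi>) \<Delta>)"
| conj_left: "derives L (\<Gamma> \<union> f ` I) \<Delta> \<Longrightarrow> Conj I f \<in> all_formulas L \<Longrightarrow>
    derives L (insert (Conj I f) \<Gamma>) \<Delta>"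
| conj_right: "(\<And>i. i \<in> I \<Longrightarrow> derives L \<Gamma> (insert (f i) \<Delta>)) \<Longrightarrow> Conj I f \<in> all_formulas L \<Longrightarrow>
    \<Gamma> \<subseteq> all_formulas L \<Longrightarrow> \<Delta> \<subseteq> all_formulas L \<Longrightarrow>
    derives L \<Gamma> (insert (Conj I f) \<Delta>)"
| disj_left: "(\<And>i. i \<in> I \<Longrightarrow> derives L (insert (f i) \<Gamma>) \<Delta>) \<Longrightarrow> Disj I f \<in> all_formulas L \<Longrightarrow>
    \<Gamma> \<subseteq> all_formulas L \<Longrightarrow> \<Delta> \<subseteq> all_formulas L \<Longrightarrow>
    derives L (insert (Disj I f) \<Gamma>) \<Delta>"
| disj_right: "derives L \<Gamma> (\<Delta> \<union> f ` I) \<Longrightarrow> Disj I f \<in> all_formulas L \<Longrightarrow>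
    derives L \<Gamma> (insert (Disj I f) \<Delta>)"
| all_left: "derives L (insert (subst \<sigma> \<phi>) \<Gamma>) \<Delta> \<Longrightarrow> All V \<phi> \<in> all_formulas L \<Longrightarrow>
    range \<sigma> \<subseteq> terms L \<Longrightarrow> (\<And>x. x \<notin> V \<Longrightarrow> \<sigma> x = Var x) \<Longrightarrow> free_for \<sigma> \<phi> \<Longrightarrow>
    derives L (insert (All V \<phi>) \<Gamma>) \<Delta>"
| all_right: "derives L \<Gamma> (insert \<phi> \<Delta>) \<Longrightarrow> (\<And>\<chi>. \<chi> \<in> \<Gamma> \<union> \<Delta> \<Longrightarrow> V \<inter> fv \<chi> = {}) \<Longrightarrow>
    derives L \<Gamma> (insert (All V \<phi>) \<Delta>)"
| ex_left: "derives L (insert \<phi> \<Gamma>) \<Delta> \<Longrightarrow> (\<And>\<chi>. \<chi> \<in> \<Gamma> \<union> \<Delta> \<Longrightarrow> V \<inter> fv \<chi> = {}) \<Longrightarrow>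
    derives L (insert (Ex V \<phi>) \<Gamma>) \<Delta>"
| ex_right: "derives L \<Gamma> (insert (subst \<sigma> \<phi>) \<Delta>) \<Longrightarrow> Ex V \<phi> \<in> all_formulas L \<Longrightarrow>
    range \<sigma> \<subseteq> terms L \<Longrightarrow> (\<And>x. x \<notin> V \<Longrightarrow> \<sigma> x = Var x) \<Longrightarrow> free_for \<sigma> \<phi> \<Longrightarrow>
    derives L \<Gamma> (insert (Ex V \<phi>) \<Delta>)"

section \<open>Boolean valued models\<close>

text \<open>Boolean algebras have to be carried by sets: an existential quantifier over complete Boolean
  algebras cannot range over the types of class \<^class>\<open>complete_boolean_algebra\<close>.\<close>

locale complete_BA = complete_lattice B for B (structure) +
  assumes distrib: "\<lbrakk>x \<in> carrier B; y \<in> carrier B; z \<in> carrier B\<rbrakk> \<Longrightarrow>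
      x \<sqinter> (y \<squnion> z) = (x \<sqinter> y) \<squnion> (x \<sqinter> z)"
    and complemented: "x \<in> carrier B \<Longrightarrow> \<exists>y\<in>carrier B. x \<sqinter> y = \<bottom> \<and> x \<squnion> y = \<top>"
    and nontrivial: "\<bottom> \<noteq> \<top>"

definition complement :: "('b, 'd) gorder_scheme \<Rightarrow> 'b \<Rightarrow> 'b" where
  "complement B x = (THE y. y \<in> carrier B \<and> x \<sqinter>\<^bsub>B\<^esub> y = \<bottom>\<^bsub>B\<^esub> \<and> x \<squnion>\<^bsub>B\<^esub> y = \<top>\<^bsub>B\<^esub>)"

record ('r, 'c, 'm, 'b) bvm =
  points :: "'m set"
  eq_val :: "'m \<Rightarrow> 'm \<Rightarrow> 'b"
  rel_val :: "'r \<Rightarrow> 'm list \<Rightarrow> 'b"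
  const_val :: "'c \<Rightarrow> 'm"

locale bv_model = complete_BA B
  for L :: "('r, 'c) signature" and B :: "'b gorder" and M :: "('r, 'c, 'm, 'b) bvm" +
  assumes nonempty: "points M \<noteq> {}"
    and const_val_closed: "c \<in> constants L \<Longrightarrow> const_val M c \<in> points M"
    and eq_val_closed: "\<lbrakk>a \<in> points M; b \<in> points M\<rbrakk> \<Longrightarrow> eq_val M a b \<in> carrier B"
    and rel_val_closed: "\<lbrakk>R \<in> relsyms L; set as \<subseteq> points M; length as = arity L R\<rbrakk> \<Longrightarrow>
      rel_val M R as \<in> carrier B"
    and eq_val_refl: "a \<in> points M \<Longrightarrow> eq_val M a a = \<top>\<^bsub>B\<^esub>"
    and eq_val_sym: "\<lbrakk>a \<in> points M; b \<in> points M\<rbrakk> \<Longrightarrow> eq_val M a b = eq_val M b a"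
    and eq_val_trans: "\<lbrakk>a \<in> points M; b \<in> points M; d \<in> points M\<rbrakk> \<Longrightarrow>
      eq_val M a b \<sqinter>\<^bsub>B\<^esub> eq_val M b d \<sqsubseteq>\<^bsub>B\<^esub> eq_val M a d"
    and rel_val_cong: "\<lbrakk>R \<in> relsyms L; set as \<subseteq> points M; set bs \<subseteq> points M;
        length as = arity L R; length bs = arity L R\<rbrakk> \<Longrightarrow>
      \<Sqinter>\<^bsub>B\<^esub>{eq_val M (as ! i) (bs ! i) | i. i < arity L R} \<sqinter>\<^bsub>B\<^esub> rel_val M R as
        \<sqsubseteq>\<^bsub>B\<^esub> rel_val M R bs"

primrec tval :: "('r, 'c, 'm, 'b) bvm \<Rightarrow> ('v \<Rightarrow> 'm) \<Rightarrow> ('c, 'v) trm \<Rightarrow> 'm" where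
  "tval M \<nu> (Var x) = \<nu> x"
| "tval M \<nu> (Const c) = const_val M c"

definition reassign :: "('r, 'c, 'm, 'b) bvm \<Rightarrow> 'v set \<Rightarrow> ('v \<Rightarrow> 'm) \<Rightarrow> ('v \<Rightarrow> 'm) set" where
  "reassign M V \<nu> = {override_on \<nu> a V | a. \<forall>x\<in>V. a x \<in> points M}"

primrec val :: "'b gorder \<Rightarrow> ('r, 'c, 'm, 'b) bvm \<Rightarrow> ('v \<Rightarrow> 'm) \<Rightarrow> ('r, 'c, 'v) fm \<Rightarrow> 'b" where
  "val B M \<nu> (Eq t u) = eq_val M (tval M \<nu> t) (tval M \<nu> u)"
| "val B M \<nu> (Rel R ts) = rel_val M R (map (tval M \<nu>) ts)"
| "val B M \<nu> (Neg \<phi>) = complement B (val B M \<nu> \<phi>)"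
| "val B M \<nu> (Conj I f) = \<Sqinter>\<^bsub>B\<^esub>((\<lambda>i. val B M \<nu> (f i)) ` I)"
| "val B M \<nu> (Disj I f) = \<Squnion>\<^bsub>B\<^esub>((\<lambda>i. val B M \<nu> (f i)) ` I)"
| "val B M \<nu> (All V \<phi>) = \<Sqinter>\<^bsub>B\<^esub>((\<lambda>\<mu>. val B M \<mu> \<phi>) ` reassign M V \<nu>)"
| "val B M \<nu> (Ex V \<phi>) = \<Squnion>\<^bsub>B\<^esub>((\<lambda>\<mu>. val B M \<mu> \<phi>) ` reassign M V \<nu>)"

text \<open>Models and Boolean algebras are taken inside one type that is large enough for the definition
  not to depend on this choice (for infinite \<open>'v\<close>). If a set \<open>\<Gamma>\<close> of formulae in the type \<open>('r, 'c, 'v) fm\<close> has value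
  \<open>\<top>\<close> in some Boolean valued model, of any size, then the finite sets of formulae that are consistent
  with \<open>\<Gamma>\<close> form a consistency property, over the given constants and \<open>|UNIV :: 'v set set|\<close> fresh
  ones. Its regular open algebra, with the constants as points, again gives \<open>\<Gamma>\<close> the value \<open>\<top>\<close>, and
  both have at most the cardinality of \<open>univ\<close>.\<close>

type_synonym ('r, 'c, 'v) univ = "('r, 'c, 'v) fm set set"

definition boolean_consistent :: "('r, 'c) signature \<Rightarrow> ('r, 'c, 'v) fm set \<Rightarrow> bool" where
  "boolean_consistent L \<Gamma> \<longleftrightarrow>
    (\<exists>(B :: ('r, 'c, 'v) univ gorder) (M :: ('r, 'c, ('r, 'c, 'v) univ, ('r, 'c, 'v) univ) bvm) \<nu>.
      bv_model L B M \<and> range \<nu> \<subseteq> points M \<and> (\<forall>\<phi>\<in>\<Gamma>. val B M \<nu> \<phi> = \<top>\<^bsub>B\<^esub>))"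

section \<open>Subsentences and conservativity\<close>

text \<open>The components of a negated compound formula are the components of the formula obtained by
  moving the negation inside, in addition to the formula under the negation. For formulae in
  negation normal form this adds nothing (\<open>subformulas_nnf\<close> below). In general the
  additional rules are needed: with the plain notion the theory consisting of
  \<open>\<not> \<And>\<^sub>n P\<^sub>n\<close> and of all the \<open>P\<^sub>n\<close>, for independent atomic sentences \<open>P\<^sub>n\<close>, would be finitely
  conservative although its conjunction is inconsistent.\<close>

inductive_set subformulas :: "('r, 'c, 'v) fm \<Rightarrow> ('r, 'c, 'v) fm set"
  for \<psi> :: "('r, 'c, 'v) fm" where
  self: "\<psi> \<in> subformulas \<psi>"
| Neg: "Neg \<phi> \<in> subformulas \<psi> \<Longrightarrow> \<phi> \<in> subformulas \<psi>"
| Conj: "Conj I f \<in> subformulas \<psi> \<Longrightarrow> i \<in> I \<Longrightarrow> f i \<in> subformulas \<psi>"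
| Disj: "Disj I f \<in> subformulas \<psi> \<Longrightarrow> i \<in> I \<Longrightarrow> f i \<in> subformulas \<psi>"
| All: "All V \<phi> \<in> subformulas \<psi> \<Longrightarrow> \<phi> \<in> subformulas \<psi>"
| Ex: "Ex V \<phi> \<in> subformulas \<psi> \<Longrightarrow> \<phi> \<in> subformulas \<psi>"
| Neg_Conj: "Neg (Conj I f) \<in> subformulas \<psi> \<Longrightarrow> i \<in> I \<Longrightarrow> Neg (f i) \<in> subformulas \<psi>"
| Neg_Disj: "Neg (Disj I f) \<in> subformulas \<psi> \<Longrightarrow> i \<in> I \<Longrightarrow> Neg (f i) \<in> subformulas \<psi>"
| Neg_All: "Neg (All V \<phi>) \<in> subformulas \<psi> \<Longrightarrow> Neg \<phi> \<in> subformulas \<psi>"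
| Neg_Ex: "Neg (Ex V \<phi>) \<in> subformulas \<psi> \<Longrightarrow> Neg \<phi> \<in> subformulas \<psi>"

inductive_set plain_subformulas :: "('r, 'c, 'v) fm \<Rightarrow> ('r, 'c, 'v) fm set"
  for \<psi> :: "('r, 'c, 'v) fm" where
  self: "\<psi> \<in> plain_subformulas \<psi>"
| Neg: "Neg \<phi> \<in> plain_subformulas \<psi> \<Longrightarrow> \<phi> \<in> plain_subformulas \<psi>"
| Conj: "Conj I f \<in> plain_subformulas \<psi> \<Longrightarrow> i \<in> I \<Longrightarrow> f i \<in> plain_subformulas \<psi>"
| Disj: "Disj I f \<in> plain_subformulas \<psi> \<Longrightarrow> i \<in> I \<Longrightarrow> f i \<in> plain_subformulas \<psi>"
| All: "All V \<phi> \<in> plain_subformulas \<psi> \<Longrightarrow> \<phi> \<in> plain_subformulas \<psi>"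
| Ex: "Ex V \<phi> \<in> plain_subformulas \<psi> \<Longrightarrow> \<phi> \<in> plain_subformulas \<psi>"

primrec nnf :: "('r, 'c, 'v) fm \<Rightarrow> bool" where
  "nnf (Eq t u) \<longleftrightarrow> True"
| "nnf (Rel R ts) \<longleftrightarrow> True"
| "nnf (Neg \<phi>) \<longleftrightarrow> (\<exists>t u. \<phi> = Eq t u) \<or> (\<exists>R ts. \<phi> = Rel R ts)"
| "nnf (Conj I f) \<longleftrightarrow> (\<forall>i\<in>I. nnf (f i))"
| "nnf (Disj I f) \<longleftrightarrow> (\<forall>i\<in>I. nnf (f i))"
| "nnf (All V \<phi>) \<longleftrightarrow> nnf \<phi>"
| "nnf (Ex V \<phi>) \<longleftrightarrow> nnf \<phi>"

lemma plain_subformulas_subset: "plain_subformulas \<psi> \<subseteq> subformulas \<psi>"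
proof
  fix \<phi> assume "\<phi> \<in> plain_subformulas \<psi>"
  then show "\<phi> \<in> subformulas \<psi>"
    by induction (auto intro: subformulas.intros)
qed

lemma subformulas_nnf:
  assumes "nnf \<psi>"
  shows "subformulas \<psi> = plain_subformulas \<psi>"
proof -
  have "\<phi> \<in> plain_subformulas \<psi> \<and> nnf \<phi>" if "\<phi> \<in> subformulas \<psi>" for \<phi>
    using that by induction (auto simp: assms intro: plain_subformulas.intros)
  then show ?thesis
    using plain_subformulas_subset by blast
qed

definition subsentences ::
  "('r, 'c) signature \<Rightarrow> 'c set \<Rightarrow> ('r, 'c, 'v) fm \<Rightarrow> ('r, 'c, 'v) fm set" where
  "subsentences L C \<psi> =
    {subst (\<lambda>x. Const (a x)) \<phi> | a \<phi>. \<phi> \<in> subformulas \<psi> \<and> (\<forall>x\<in>fv \<phi>. a x \<in> constants L \<union> C)}"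

definition conservative_strengthening ::
  "('r, 'c) signature \<Rightarrow> 'c set \<Rightarrow> ('r, 'c, 'v) fm \<Rightarrow> ('r, 'c, 'v) fm \<Rightarrow> bool" where
  \<comment> \<open>\<open>\<psi>1\<close> is a conservative strengthening of \<open>\<psi>0\<close>\<close>
  "conservative_strengthening L C \<psi>1 \<psi>0 \<longleftrightarrow>
    derives L {\<psi>1} {\<psi>0} \<and>
    (\<forall>s. finite s \<and> s \<subseteq> subsentences L C \<psi>0 \<longrightarrow>
      (boolean_consistent (expand L C) (s \<union> {\<psi>0}) \<longleftrightarrow>
       boolean_consistent (expand L C) (s \<union> {\<psi>1})))"

definition finitely_conservative ::
  "('r, 'c) signature \<Rightarrow> 'c set \<Rightarrow> ('r, 'c, 'v) fm set \<Rightarrow> bool" where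
  "finitely_conservative L C T \<longleftrightarrow>
    (\<exists>\<psi>\<in>T. boolean_consistent L {\<psi>}) \<and>
    (\<forall>J0 J1. J0 \<noteq> {} \<and> J0 \<subseteq> J1 \<and> J1 \<subseteq> T \<and> finite J1 \<longrightarrow>
      conservative_strengthening L C (big_conj J1) (big_conj J0))"

end

theory Submission
  imports Defs
begin

text \<open>The nontrivial direction is a forcing argument. Let \<open>s\<^sub>0\<close> be a finite set of subsentences
  consistent with a finite part of \<open>T\<close>. The conditions are the finite sets \<open>p\<close> of subsentences of
  sentences in \<open>T\<close> that extend \<open>s\<^sub>0\<close> and are consistent with some finite \<open>J \<subseteq> T\<close> containing the
  sentences they come from; finite conservativity makes the choice of \<open>J\<close> irrelevant. A
  Boolean valued model of \<open>p \<union> J\<close> shows how to extend \<open>p\<close>: a disjunction of value \<open>\<top>\<close> has a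
  disjunct of value \<open>b \<noteq> \<bottom>\<close>, and passing to the relative algebra below \<open>b\<close> makes this disjunct
  consistent with \<open>p \<union> J\<close>; witnesses of existential quantifiers are named by constants of \<open>C\<close> not
  occurring in \<open>p\<close>, of which there are enough because a formula of \<open>L\<^sub>\<kappa>\<^sub>\<lambda>\<close> has fewer than \<open>\<lambda>\<close> free
  variables. In the model of constants with values in the regular open algebra of the conditions,
  every condition forces its members, and a sentence of \<open>T\<close> can be added to every condition. Hence
  \<open>s\<^sub>0 \<union> T\<close> has value \<open>\<top>\<close>.\<close>

section \<open>Complete Boolean algebras\<close>

text \<open>In infinitary logic all finite parts of \<open>T\<close> may be consistent without
  \<open>T\<close> being so: there is no compactness, and a model of the whole theory has to be
  built. The models of finite parts only show how conditions extend; none of them survives into the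
  final model. A generic filter need not exist, which is why the outcome is a Boolean valued model
  and not a two-valued one. All conditions contain \<open>s0\<close>, so that the members of
  \<open>s0\<close> receive the value \<top> and not merely a nonzero one. Conditions are sets of
  formulae, hence families of conditions have exactly the type \<open>univ\<close> over which
  \<open>boolean_consistent\<close> quantifies. Truth in the generic model is needed in one
  direction only, from membership in a condition to being forced by it, so conditions never have to
  decide a sentence. Negated compound formulae have to be taken apart as well, and this is where the
  clauses of \<open>subformulas\<close> that move negations inside enter. The converse implication
  of the theorem is monotonicity, since a model of \<open>T\<close> is a model of its
  subsets.\<close>

context partial_order
begin

text \<open>\<open>\<Sqinter>\<close> is a Hilbert choice of a greatest lower bound, and
  antisymmetry makes the choice unique. The rule and its companions live in
  \<open>partial_order\<close> so that they apply to structures whose completeness is not yet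
  established.\<close>

lemma inf_eqI:
  assumes "x \<in> carrier L" "A \<subseteq> carrier L"
    and "\<And>a. a \<in> A \<Longrightarrow> x \<sqsubseteq> a"
    and "\<And>y. y \<in> carrier L \<Longrightarrow> (\<And>a. a \<in> A \<Longrightarrow> y \<sqsubseteq> a) \<Longrightarrow> y \<sqsubseteq> x"
  shows "\<Sqinter>A = x"
proof -
  have "greatest L x (Lower L A)"
    using assms by (simp add: greatest_def Lower_def subset_iff)
  then show ?thesis
    unfolding inf_def by (metis (mono_tags, lifting) eq_is_equal someI_ex weak_greatest_unique)
qed

lemma sup_eqI:
  assumes "x \<in> carrier L" "A \<subseteq> carrier L"
    and "\<And>a. a \<in> A \<Longrightarrow> a \<sqsubseteq> x"
    and "\<And>y. y \<in> carrier L \<Longrightarrow> (\<And>a. a \<in> A \<Longrightarrow> a \<sqsubseteq> y) \<Longrightarrow> x \<sqsubseteq> y"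
  shows "\<Squnion>A = x"
proof -
  have "least L x (Upper L A)"
    using assms by (simp add: least_def Upper_def subset_iff)
  then show ?thesis
    unfolding sup_def by (metis (mono_tags, lifting) eq_is_equal someI_ex weak_least_unique)
qed

lemma greatest_eq_top:
  assumes "x \<in> carrier L" "\<And>y. y \<in> carrier L \<Longrightarrow> y \<sqsubseteq> x"
  shows "\<top> = x"
proof -
  have "greatest L x (carrier L)"
    using assms by (auto simp: greatest_def)
  then show ?thesis
    unfolding top_def by (metis (mono_tags, lifting) eq_is_equal someI_ex weak_greatest_unique)
qed

lemma least_eq_bottom:
  assumes "x \<in> carrier L" "\<And>y. y \<in> carrier L \<Longrightarrow> x \<sqsubseteq> y"
  shows "\<bottom> = x"
proof -
  have "least L x (carrier L)"
    using assms by (auto simp: least_def)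
  then show ?thesis
    unfolding bottom_def by (metis (mono_tags, lifting) eq_is_equal someI_ex weak_least_unique)
qed

lemma complete_latticeI_infs:
  assumes "\<And>A. A \<subseteq> carrier L \<Longrightarrow> \<exists>x\<in>carrier L. (\<forall>a\<in>A. x \<sqsubseteq> a) \<and>
      (\<forall>y\<in>carrier L. (\<forall>a\<in>A. y \<sqsubseteq> a) \<longrightarrow> y \<sqsubseteq> x)"
  shows "complete_lattice L"
proof (rule complete_lattice_criterion1)
  have "\<exists>i. greatest L i (Lower L A)" if "A \<subseteq> carrier L" for A
  proof -
    obtain x where "x \<in> carrier L" "\<forall>a\<in>A. x \<sqsubseteq> a" "\<forall>y\<in>carrier L. (\<forall>a\<in>A. y \<sqsubseteq> a) \<longrightarrow> y \<sqsubseteq> x"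
      using assms[OF \<open>A \<subseteq> carrier L\<close>] by blast
    then have "greatest L x (Lower L A)"
      using that by (intro greatest_LowerI) (auto simp: Lower_def subset_iff)
    then show ?thesis ..
  qed
  \<comment> \<open>All of the carrier bounds the empty family from below, so this case yields the
    greatest element that the criterion asks for.\<close>
  from this this[of "{}"]
  show "\<exists>g. greatest L g (carrier L)" "\<And>A. A \<subseteq> carrier L \<Longrightarrow> A \<noteq> {} \<Longrightarrow> \<exists>i. greatest L i (Lower L A)"
    by auto
qed

end

context complete_BA
begin

lemma le_top: "x \<in> carrier B \<Longrightarrow> x \<sqsubseteq> \<top>"
  by (simp add: weak.top_higher)

lemma bot_le: "x \<in> carrier B \<Longrightarrow> \<bottom> \<sqsubseteq> x"
  by (simp add: weak.bottom_lower)

lemma le_iff_meet_eq: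
  assumes "x \<in> carrier B" "y \<in> carrier B"
  shows "x \<sqsubseteq> y \<longleftrightarrow> x \<sqinter> y = x"
proof
  show "x \<sqinter> y = x" if "x \<sqsubseteq> y"
    using that assms by (intro le_antisym meet_le) (auto simp: meet_left)
  show "x \<sqsubseteq> y" if "x \<sqinter> y = x"
    using meet_right[OF assms] that by simp
qed

lemma meet_commute: "x \<sqinter> y = y \<sqinter> x"
  by (simp add: meet_comm)

lemma complement_unique:
  assumes "x \<in> carrier B" "y \<in> carrier B" "z \<in> carrier B"
    and "x \<sqinter> y = \<bottom>" "x \<squnion> y = \<top>" "x \<sqinter> z = \<bottom>" "x \<squnion> z = \<top>"
  shows "y = z"
proof -
  \<comment> \<open>Each of \<open>u\<close> and \<open>v\<close> uses only one half of being a
    complement, so the same inequality serves in both directions.\<close>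
  have le: "u \<sqsubseteq> v" if "u \<in> carrier B" "v \<in> carrier B" "x \<sqinter> u = \<bottom>" "x \<squnion> v = \<top>" for u v
  proof -
    have "u = u \<sqinter> (x \<squnion> v)"
      using that le_top le_iff_meet_eq by simp
    also have "\<dots> = (u \<sqinter> x) \<squnion> (u \<sqinter> v)"
      using that assms distrib[of u x v] by simp
    also have "\<dots> \<sqsubseteq> v"
      using that assms(1) by (intro join_le) (auto simp: meet_commute[of u x] bot_le meet_right)
    finally show ?thesis .
  qed
  show ?thesis
    using le assms by (intro le_antisym) auto
qed

lemma complement_props:
  assumes "x \<in> carrier B"
  shows "complement B x \<in> carrier B" "x \<sqinter> complement B x = \<bottom>" "x \<squnion> complement B x = \<top>"
proof -
  have "\<exists>!y. y \<in> carrier B \<and> x \<sqinter> y = \<bottom> \<and> x \<squnion> y = \<top>"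
  proof (rule ex_ex1I)
    fix y z
    assume "y \<in> carrier B \<and> x \<sqinter> y = \<bottom> \<and> x \<squnion> y = \<top>"
      and "z \<in> carrier B \<and> x \<sqinter> z = \<bottom> \<and> x \<squnion> z = \<top>"
    then show "y = z"
      by (elim conjE) (rule complement_unique[OF assms])
  qed (use complemented[OF assms] in blast)
  from theI'[OF this] have "complement B x \<in> carrier B \<and> x \<sqinter> complement B x = \<bottom> \<and>
      x \<squnion> complement B x = \<top>"
    unfolding complement_def .
  then show "complement B x \<in> carrier B" "x \<sqinter> complement B x = \<bottom>" "x \<squnion> complement B x = \<top>"
    by simp_all
qed

lemma complement_eqI:
  assumes "x \<in> carrier B" "y \<in> carrier B" "x \<sqinter> y = \<bottom>" "x \<squnion> y = \<top>"
  shows "complement B x = y"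
  by (rule complement_unique[OF assms(1) _ assms(2) _ _ assms(3,4)]) (fact complement_props[OF assms(1)])+

lemma complement_bot: "complement B \<bottom> = \<top>"
proof (rule complement_eqI)
  show "\<bottom> \<sqinter> \<top> = \<bottom>"
    by (rule le_antisym) (simp_all add: bot_le meet_left)
  show "\<bottom> \<squnion> \<top> = \<top>"
    by (rule le_antisym) (simp_all add: le_top join_right)
qed simp_all

lemma complement_top: "complement B \<top> = \<bottom>"
proof (rule complement_eqI)
  show "\<top> \<sqinter> \<bottom> = \<bottom>"
    by (rule le_antisym) (simp_all add: bot_le meet_right)
  show "\<top> \<squnion> \<bottom> = \<top>"
    by (rule le_antisym) (simp_all add: le_top join_left)
qed simp_all

lemma complement_complement: "x \<in> carrier B \<Longrightarrow> complement B (complement B x) = x"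
  using complement_props[of x] meet_commute[of "complement B x" x] join_comm[of B "complement B x" x]
  by (intro complement_eqI) simp_all

lemma complement_eq_top_iff: "x \<in> carrier B \<Longrightarrow> complement B x = \<top> \<longleftrightarrow> x = \<bottom>"
  using complement_complement[of x] complement_bot complement_top by auto

lemma complement_eq_bot_iff: "x \<in> carrier B \<Longrightarrow> complement B x = \<bottom> \<longleftrightarrow> x = \<top>"
  using complement_complement[of x] complement_bot complement_top by auto

lemma inf_eq_top_iff:
  assumes "A \<subseteq> carrier B"
  shows "\<Sqinter>A = \<top> \<longleftrightarrow> (\<forall>a\<in>A. a = \<top>)"
proof
  show "\<forall>a\<in>A. a = \<top>" if "\<Sqinter>A = \<top>"
    using that assms inf_lower[OF assms] by (metis le_antisym le_top subsetD top_closed)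
  show "\<Sqinter>A = \<top>" if "\<forall>a\<in>A. a = \<top>"
    using that assms by (intro inf_eqI) (auto simp: le_top)
qed

lemma sup_eq_bot_iff:
  assumes "A \<subseteq> carrier B"
  shows "\<Squnion>A = \<bottom> \<longleftrightarrow> (\<forall>a\<in>A. a = \<bottom>)"
proof
  show "\<forall>a\<in>A. a = \<bottom>" if "\<Squnion>A = \<bottom>"
    using that assms sup_upper[OF assms] by (metis le_antisym bot_le subsetD bottom_closed)
  show "\<Squnion>A = \<bottom>" if "\<forall>a\<in>A. a = \<bottom>"
    using that assms by (intro sup_eqI) (auto simp: bot_le)
qed

text \<open>Residuation: meeting with \<open>b\<close> is left adjoint to joining with its
  complement. Left adjoints preserve suprema, which is how the finite distributive law of the locale
  yields the infinite one in \<open>sup_meet_distrib\<close>.\<close>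

lemma le_join_complement_iff:
  assumes "x \<in> carrier B" "y \<in> carrier B" "b \<in> carrier B"
  shows "x \<sqsubseteq> y \<squnion> complement B b \<longleftrightarrow> x \<sqinter> b \<sqsubseteq> y"
proof -
  note [simp] = assms complement_props
  show ?thesis
  proof
    assume l: "x \<sqsubseteq> y \<squnion> complement B b"
    have "x \<sqinter> b \<sqsubseteq> b \<sqinter> (y \<squnion> complement B b)"
      using l by (intro meet_le) (auto simp: meet_right intro: le_trans[OF meet_left])
    also have "b \<sqinter> (y \<squnion> complement B b) = (b \<sqinter> y) \<squnion> (b \<sqinter> complement B b)"
      by (simp add: distrib)
    also have "\<dots> \<sqsubseteq> y"
      by (intro join_le) (auto simp: bot_le meet_right)
    finally show "x \<sqinter> b \<sqsubseteq> y" by simp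
  next
    assume r: "x \<sqinter> b \<sqsubseteq> y"
    have "x = x \<sqinter> (b \<squnion> complement B b)"
      using le_top le_iff_meet_eq by simp
    also have "\<dots> = (x \<sqinter> b) \<squnion> (x \<sqinter> complement B b)"
      by (subst distrib) simp_all
    also have "\<dots> \<sqsubseteq> y \<squnion> complement B b"
      using r by (intro join_le) (auto intro: le_trans[OF _ join_left] le_trans[OF meet_right join_right])
    finally show "x \<sqsubseteq> y \<squnion> complement B b" .
  qed
qed

lemma sup_meet_distrib:
  assumes "A \<subseteq> carrier B" "b \<in> carrier B"
  shows "\<Squnion>A \<sqinter> b = \<Squnion>((\<lambda>a. a \<sqinter> b) ` A)"
proof (rule sup_eqI[symmetric])
  note [simp] = assms(2) complement_props
  show "(\<lambda>a. a \<sqinter> b) ` A \<subseteq> carrier B"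
    using assms by auto
  show "\<Squnion>A \<sqinter> b \<sqsubseteq> y" if "y \<in> carrier B" "\<And>c. c \<in> (\<lambda>a. a \<sqinter> b) ` A \<Longrightarrow> c \<sqsubseteq> y" for y
  proof -
    have "\<Squnion>A \<sqsubseteq> y \<squnion> complement B b"
      using that assms by (intro sup_least) (auto simp: le_join_complement_iff subset_iff)
    then show ?thesis
      using that assms by (simp add: le_join_complement_iff)
  qed
  show "c \<sqsubseteq> \<Squnion>A \<sqinter> b" if "c \<in> (\<lambda>a. a \<sqinter> b) ` A" for c
    using that assms sup_upper[OF assms(1)]
    by (auto intro!: meet_le intro: meet_right le_trans[OF meet_left] simp: subset_iff)
qed (use assms in simp_all)

end

section \<open>Relative algebras below a nonzero element\<close>

definition relativize :: "'b gorder \<Rightarrow> 'b \<Rightarrow> 'b gorder" where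
  "relativize B b = B\<lparr>carrier := {x \<in> carrier B. le B x b}\<rparr>"

lemma relativize_sel [simp]:
  "carrier (relativize B b) = {x \<in> carrier B. le B x b}"
  "le (relativize B b) = le B" "eq (relativize B b) = eq B"
  by (simp_all add: relativize_def)

locale nonzero_element = complete_BA B for B :: "'b gorder" (structure) +
  fixes b
  assumes b_closed [simp]: "b \<in> carrier B" and b_nonzero: "b \<noteq> \<bottom>"
begin

abbreviation "B' \<equiv> relativize B b"

lemma relativize_partial_order: "partial_order B'"
proof -
  have "weak_partial_order (B\<lparr>carrier := {x \<in> carrier B. x \<sqsubseteq> b}\<rparr>)"
    by (rule weak_partial_order_subset) (auto intro: weak_partial_order_axioms)
  then show ?thesis
    by (simp add: partial_order_def partial_order_axioms_def eq_is_equal relativize_def)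
qed

interpretation R: partial_order B'
  by (rule relativize_partial_order)

text \<open>The family is taken in \<open>B\<close> and not below \<open>b\<close>: meeting with
  \<open>b\<close> is a homomorphism of \<open>B\<close> onto the relative algebra, and in this form
  it carries values of formulae across. For the empty family it sends \<top> to
  \<open>b\<close>.\<close>

lemma relativize_inf:
  assumes "A \<subseteq> carrier B"
  shows "\<Sqinter>\<^bsub>B'\<^esub>((\<lambda>a. a \<sqinter> b) ` A) = \<Sqinter>A \<sqinter> b"
proof (rule R.inf_eqI)
  show "\<Sqinter>A \<sqinter> b \<in> carrier B'"
    using assms by (simp add: meet_right)
  show "(\<lambda>a. a \<sqinter> b) ` A \<subseteq> carrier B'"
    using assms by (auto simp: meet_right)
  show "\<Sqinter>A \<sqinter> b \<sqsubseteq>\<^bsub>B'\<^esub> c" if "c \<in> (\<lambda>a. a \<sqinter> b) ` A" for c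
    using that assms inf_lower[OF assms]
    by (auto intro!: meet_le intro: meet_right le_trans[OF meet_left] simp: subset_iff)
  show "y \<sqsubseteq>\<^bsub>B'\<^esub> \<Sqinter>A \<sqinter> b"
    if "y \<in> carrier B'" "\<And>c. c \<in> (\<lambda>a. a \<sqinter> b) ` A \<Longrightarrow> y \<sqsubseteq>\<^bsub>B'\<^esub> c" for y
  proof -
    have "y \<sqsubseteq> a" if "a \<in> A" for a
    proof (rule le_trans)
      show "y \<sqsubseteq> a \<sqinter> b"
        using \<open>a \<in> A\<close> \<open>\<And>c. c \<in> (\<lambda>a. a \<sqinter> b) ` A \<Longrightarrow> y \<sqsubseteq>\<^bsub>B'\<^esub> c\<close> by simp
      show "a \<sqinter> b \<sqsubseteq> a"
        using \<open>a \<in> A\<close> assms by (intro meet_left) auto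
    qed (use \<open>a \<in> A\<close> \<open>y \<in> carrier B'\<close> assms in auto)
    then show ?thesis
      using that(1) assms by (auto intro!: meet_le inf_greatest)
  qed
qed

text \<open>Unlike the case of infima, this rests on the infinite distributive law
  \<open>sup_meet_distrib\<close>.\<close>

lemma relativize_sup:
  assumes "A \<subseteq> carrier B"
  shows "\<Squnion>\<^bsub>B'\<^esub>((\<lambda>a. a \<sqinter> b) ` A) = \<Squnion>A \<sqinter> b"
proof (rule R.sup_eqI)
  have im: "(\<lambda>a. a \<sqinter> b) ` A \<subseteq> carrier B"
    using assms by auto
  show "\<Squnion>A \<sqinter> b \<in> carrier B'"
    using assms by (simp add: meet_right)
  show "(\<lambda>a. a \<sqinter> b) ` A \<subseteq> carrier B'"
    using assms by (auto simp: meet_right)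
  show "c \<sqsubseteq>\<^bsub>B'\<^esub> \<Squnion>A \<sqinter> b" if "c \<in> (\<lambda>a. a \<sqinter> b) ` A" for c
    using sup_upper[OF im that] assms by (simp add: sup_meet_distrib)
  show "\<Squnion>A \<sqinter> b \<sqsubseteq>\<^bsub>B'\<^esub> y"
    if "y \<in> carrier B'" "\<And>c. c \<in> (\<lambda>a. a \<sqinter> b) ` A \<Longrightarrow> c \<sqsubseteq>\<^bsub>B'\<^esub> y" for y
    using that sup_least[OF im] assms by (simp add: sup_meet_distrib)
qed

lemma meet_b: "x \<in> carrier B' \<Longrightarrow> x \<sqinter> b = x"
  by (simp add: le_iff_meet_eq[symmetric])

lemma relativize_meet:
  assumes "x \<in> carrier B'" "y \<in> carrier B'"
  shows "x \<sqinter>\<^bsub>B'\<^esub> y = x \<sqinter> y"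
proof -
  have "x \<sqinter> y \<in> carrier B'"
    using assms by (auto intro: le_trans[OF meet_left])
  then show ?thesis
    using assms relativize_inf[of "{x, y}"] meet_b[of x] meet_b[of y] meet_b
    by (simp add: meet_def[symmetric])
qed

lemma relativize_join:
  assumes "x \<in> carrier B'" "y \<in> carrier B'"
  shows "x \<squnion>\<^bsub>B'\<^esub> y = x \<squnion> y"
proof -
  have "x \<squnion> y \<in> carrier B'"
    using assms by (auto intro: join_le)
  then show ?thesis
    using assms relativize_sup[of "{x, y}"] meet_b[of x] meet_b[of y] meet_b
    by (simp add: join_def[symmetric])
qed

lemma relativize_top [simp]: "\<top>\<^bsub>B'\<^esub> = b"
  by (rule R.greatest_eq_top) auto

lemma relativize_bottom [simp]: "\<bottom>\<^bsub>B'\<^esub> = \<bottom>"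
  by (rule R.least_eq_bottom) (auto simp: bot_le)

lemma relativize_complements:
  assumes "x \<in> carrier B"
  shows "(x \<sqinter> b) \<sqinter> (complement B x \<sqinter> b) = \<bottom>" "(x \<sqinter> b) \<squnion> (complement B x \<sqinter> b) = b"
proof -
  note [simp] = assms complement_props
  have "(x \<sqinter> b) \<sqinter> (complement B x \<sqinter> b) \<sqsubseteq> x \<sqinter> complement B x"
    by (intro meet_le) (meson assms b_closed complement_props(1) le_trans meet_closed meet_left meet_right)+
  then show "(x \<sqinter> b) \<sqinter> (complement B x \<sqinter> b) = \<bottom>"
    by (auto intro!: le_antisym simp: bot_le)
  have "b = b \<sqinter> (x \<squnion> complement B x)"
    using le_top le_iff_meet_eq by simp
  also have "\<dots> = (x \<sqinter> b) \<squnion> (complement B x \<sqinter> b)"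
    by (subst distrib) (simp_all add: meet_commute)
  finally show "(x \<sqinter> b) \<squnion> (complement B x \<sqinter> b) = b" ..
qed

lemma relativize_complete_BA: "complete_BA B'"
proof -
  interpret R': complete_lattice B'
  proof (rule R.complete_latticeI_infs)
    fix A assume A: "A \<subseteq> carrier B'"
    then have A': "A \<subseteq> carrier B" by auto
    show "\<exists>x\<in>carrier B'. (\<forall>a\<in>A. x \<sqsubseteq>\<^bsub>B'\<^esub> a) \<and>
      (\<forall>y\<in>carrier B'. (\<forall>a\<in>A. y \<sqsubseteq>\<^bsub>B'\<^esub> a) \<longrightarrow> y \<sqsubseteq>\<^bsub>B'\<^esub> x)"
      using A' inf_lower[OF A'] inf_greatest[OF A']
      by (intro bexI[of _ "\<Sqinter>A \<sqinter> b"])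
        (auto intro!: meet_le meet_right intro: le_trans[OF meet_left] simp: subset_iff)
  qed
  show ?thesis
  proof
    fix x y z assume xyz: "x \<in> carrier B'" "y \<in> carrier B'" "z \<in> carrier B'"
    have "x \<sqinter> y \<in> carrier B'" "x \<sqinter> z \<in> carrier B'" "y \<squnion> z \<in> carrier B'"
      using xyz by (auto intro: le_trans[OF meet_left] join_le)
    with xyz show "x \<sqinter>\<^bsub>B'\<^esub> (y \<squnion>\<^bsub>B'\<^esub> z) = x \<sqinter>\<^bsub>B'\<^esub> y \<squnion>\<^bsub>B'\<^esub> (x \<sqinter>\<^bsub>B'\<^esub> z)"
      by (simp only: relativize_meet relativize_join) (simp add: distrib)
  next
    fix x assume x: "x \<in> carrier B'"
    then have *: "complement B x \<sqinter> b \<in> carrier B'"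
      by (simp add: complement_props meet_right)
    with x relativize_complements[of x] meet_b[OF x]
    show "\<exists>y\<in>carrier B'. x \<sqinter>\<^bsub>B'\<^esub> y = \<bottom>\<^bsub>B'\<^esub> \<and> x \<squnion>\<^bsub>B'\<^esub> y = \<top>\<^bsub>B'\<^esub>"
      by (intro bexI[OF _ *]) (simp only: relativize_meet relativize_join, simp)
  qed (use b_nonzero in simp)
qed

lemma relativize_complement:
  assumes "x \<in> carrier B"
  shows "complement B' (x \<sqinter> b) = complement B x \<sqinter> b"
proof -
  have "x \<sqinter> b \<in> carrier B'" "complement B x \<sqinter> b \<in> carrier B'"
    using assms by (simp_all add: complement_props meet_right)
  then show ?thesis
    using relativize_complements[OF assms]
    by (intro complete_BA.complement_eqI[OF relativize_complete_BA])
      (simp_all only: relativize_meet relativize_join relativize_top relativize_bottom)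
qed

end

section \<open>The regular open algebra of a family of sets\<close>

text \<open>Conditions are ordered by reverse inclusion, so \<open>q \<supseteq> p\<close> is the stronger one, and \<open>avoids P\<close> is
  the pseudocomplement on upward closed families.\<close>

definition avoids :: "'a set set \<Rightarrow> 'a set set \<Rightarrow> 'a set set" where
  "avoids P U = {p \<in> P. \<forall>q\<in>P. p \<subseteq> q \<longrightarrow> q \<notin> U}"

text \<open>In the topology on \<open>P\<close> whose open sets are the upward closed families,
  \<open>avoids P\<close> sends an open set to the interior of its complement, and applying it twice
  gives the interior of the closure. Upward closure is not demanded separately because every family
  \<open>avoids P U\<close> has it.\<close>

definition regular_opens :: "'a set set \<Rightarrow> 'a set set gorder" where
  "regular_opens P = \<lparr>carrier = {U. U \<subseteq> P \<and> avoids P (avoids P U) = U}, eq = (=), le = (\<subseteq>)\<rparr>"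

lemma regular_opens_sel [simp]:
  "carrier (regular_opens P) = {U. U \<subseteq> P \<and> avoids P (avoids P U) = U}"
  "le (regular_opens P) = (\<subseteq>)" "eq (regular_opens P) = (=)"
  by (simp_all add: regular_opens_def)

text \<open>The double pseudocomplement expresses that \<open>U\<close> is dense above
  \<open>p\<close>. All forcing clauses below arise from this form.\<close>

lemma mem_avoids_avoids:
  "p \<in> avoids P (avoids P U) \<longleftrightarrow> p \<in> P \<and> (\<forall>q\<in>P. p \<subseteq> q \<longrightarrow> (\<exists>r\<in>P. q \<subseteq> r \<and> r \<in> U))"
  by (auto simp: avoids_def)

lemma avoids_subset: "avoids P U \<subseteq> P"
  by (auto simp: avoids_def)

lemma avoids_mono: "p \<in> avoids P U \<Longrightarrow> q \<in> P \<Longrightarrow> p \<subseteq> q \<Longrightarrow> q \<in> avoids P U"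
  unfolding avoids_def by blast

lemma avoids_antimono: "U \<subseteq> V \<Longrightarrow> avoids P V \<subseteq> avoids P U"
  unfolding avoids_def by blast

lemma avoids_avoids_superset:
  assumes "U \<subseteq> P" "\<And>p q. p \<in> U \<Longrightarrow> q \<in> P \<Longrightarrow> p \<subseteq> q \<Longrightarrow> q \<in> U"
  shows "U \<subseteq> avoids P (avoids P U)"
  using assms by (force simp: mem_avoids_avoids)

text \<open>Triple negation: one inclusion applies the antitone \<open>avoids P\<close> to
  \<open>avoids_avoids_superset\<close>, the other is \<open>avoids_avoids_superset\<close> for the
  upward closed family \<open>avoids P U\<close>.\<close>

lemma avoids_avoids_avoids:
  assumes "U \<subseteq> P" "\<And>p q. p \<in> U \<Longrightarrow> q \<in> P \<Longrightarrow> p \<subseteq> q \<Longrightarrow> q \<in> U"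
  shows "avoids P (avoids P (avoids P U)) = avoids P U"
proof
  show "avoids P (avoids P (avoids P U)) \<subseteq> avoids P U"
    using assms by (intro avoids_antimono avoids_avoids_superset)
  show "avoids P U \<subseteq> avoids P (avoids P (avoids P U))"
    by (intro avoids_avoids_superset avoids_subset) (rule avoids_mono)
qed

lemma avoids_avoids_closed: "avoids P (avoids P U) \<in> carrier (regular_opens P)"
  using avoids_avoids_avoids[of "avoids P U" P] avoids_mono[of _ P U] by (simp add: avoids_subset)

lemma regular_openD:
  assumes "U \<in> carrier (regular_opens P)"
  shows "U \<subseteq> P" "avoids P (avoids P U) = U"
    "p \<in> U \<Longrightarrow> q \<in> P \<Longrightarrow> p \<subseteq> q \<Longrightarrow> q \<in> U"
proof -
  show 1: "U \<subseteq> P" "avoids P (avoids P U) = U"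
    using assms by simp_all
  show "p \<in> U \<Longrightarrow> q \<in> P \<Longrightarrow> p \<subseteq> q \<Longrightarrow> q \<in> U"
    using avoids_mono[of p P "avoids P U" q] 1 by simp
qed

lemma avoids_closed: "U \<in> carrier (regular_opens P) \<Longrightarrow> avoids P U \<in> carrier (regular_opens P)"
  by (simp add: avoids_subset)

text \<open>The factor \<open>P\<close> takes care of the empty family, whose intersection would be
  the universe of the type.\<close>

lemma regular_opens_inter_closed:
  assumes "A \<subseteq> carrier (regular_opens P)"
  shows "P \<inter> \<Inter>A \<in> carrier (regular_opens P)"
proof -
  have "avoids P (avoids P (P \<inter> \<Inter>A)) \<subseteq> U" if "U \<in> A" for U
  proof -
    have "avoids P (avoids P (P \<inter> \<Inter>A)) \<subseteq> avoids P (avoids P U)"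
      using that by (intro avoids_antimono) blast
    then show ?thesis
      using regular_openD(2)[of U P] assms that by blast
  qed
  moreover have "P \<inter> \<Inter>A \<subseteq> avoids P (avoids P (P \<inter> \<Inter>A))"
  proof (rule avoids_avoids_superset)
    fix p q assume "p \<in> P \<inter> \<Inter>A" "q \<in> P" "p \<subseteq> q"
    then show "q \<in> P \<inter> \<Inter>A"
      using assms regular_openD(3)[of _ P p q] by blast
  qed simp
  ultimately have "avoids P (avoids P (P \<inter> \<Inter>A)) = P \<inter> \<Inter>A"
    using avoids_subset by blast
  then show ?thesis by simp
qed

lemma regular_opens_partial_order: "partial_order (regular_opens P)"
  by unfold_locales auto

lemma regular_opens_complete_lattice: "complete_lattice (regular_opens P)"
proof -
  interpret partial_order "regular_opens P"
    by (rule regular_opens_partial_order)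
  show ?thesis
  proof (rule complete_latticeI_infs)
    fix A assume "A \<subseteq> carrier (regular_opens P)"
    from regular_opens_inter_closed[OF this]
    show "\<exists>x\<in>carrier (regular_opens P). (\<forall>a\<in>A. x \<sqsubseteq>\<^bsub>regular_opens P\<^esub> a) \<and>
      (\<forall>y\<in>carrier (regular_opens P). (\<forall>a\<in>A. y \<sqsubseteq>\<^bsub>regular_opens P\<^esub> a) \<longrightarrow> y \<sqsubseteq>\<^bsub>regular_opens P\<^esub> x)"
      by (rule rev_bexI) auto
  qed
qed

lemma regular_opens_inf:
  assumes "A \<subseteq> carrier (regular_opens P)"
  shows "\<Sqinter>\<^bsub>regular_opens P\<^esub>A = P \<inter> \<Inter>A"
proof (rule partial_order.inf_eqI[OF regular_opens_partial_order regular_opens_inter_closed[OF assms] assms])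
  show "U \<sqsubseteq>\<^bsub>regular_opens P\<^esub> P \<inter> \<Inter>A"
    if "U \<in> carrier (regular_opens P)" "\<And>V. V \<in> A \<Longrightarrow> U \<sqsubseteq>\<^bsub>regular_opens P\<^esub> V" for U
    using that by (simp add: le_Inf_iff)
qed auto

lemma regular_opens_sup:
  assumes "A \<subseteq> carrier (regular_opens P)"
  shows "\<Squnion>\<^bsub>regular_opens P\<^esub>A = avoids P (avoids P (\<Union>A))"
proof (rule partial_order.sup_eqI[OF regular_opens_partial_order avoids_avoids_closed assms])
  have "\<Union>A \<subseteq> avoids P (avoids P (\<Union>A))"
    using assms regular_openD[of _ P] by (intro avoids_avoids_superset) blast+
  then show "U \<sqsubseteq>\<^bsub>regular_opens P\<^esub> avoids P (avoids P (\<Union>A))" if "U \<in> A" for U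
    using that by auto
  show "avoids P (avoids P (\<Union>A)) \<sqsubseteq>\<^bsub>regular_opens P\<^esub> V"
    if V: "V \<in> carrier (regular_opens P)" "\<And>U. U \<in> A \<Longrightarrow> U \<sqsubseteq>\<^bsub>regular_opens P\<^esub> V" for V
  proof -
    have "avoids P (avoids P (\<Union>A)) \<subseteq> avoids P (avoids P V)"
      using V(2) by (intro avoids_antimono) auto
    then show ?thesis
      using V(1) by simp
  qed
qed

lemma regular_opens_top: "\<top>\<^bsub>regular_opens P\<^esub> = P"
  using regular_opens_inter_closed[of "{}" P]
  by (intro partial_order.greatest_eq_top[OF regular_opens_partial_order]) auto

lemma avoids_space: "avoids P P = {}" and avoids_empty: "avoids P {} = P"
  by (auto simp: avoids_def)

lemma regular_opens_bottom: "\<bottom>\<^bsub>regular_opens P\<^esub> = {}"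
  by (intro partial_order.least_eq_bottom[OF regular_opens_partial_order])
    (auto simp: avoids_space avoids_empty)

lemma regular_opens_meet:
  "U \<in> carrier (regular_opens P) \<Longrightarrow> V \<in> carrier (regular_opens P) \<Longrightarrow> U \<sqinter>\<^bsub>regular_opens P\<^esub> V = U \<inter> V"
  unfolding meet_def by (subst regular_opens_inf) auto

lemma regular_opens_join:
  "U \<in> carrier (regular_opens P) \<Longrightarrow> V \<in> carrier (regular_opens P) \<Longrightarrow>
    U \<squnion>\<^bsub>regular_opens P\<^esub> V = avoids P (avoids P (U \<union> V))"
  unfolding join_def by (subst regular_opens_sup) auto

lemma regular_opens_complement_props:
  assumes "U \<in> carrier (regular_opens P)"
  shows "U \<sqinter>\<^bsub>regular_opens P\<^esub> avoids P U = \<bottom>\<^bsub>regular_opens P\<^esub>"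
    "U \<squnion>\<^bsub>regular_opens P\<^esub> avoids P U = \<top>\<^bsub>regular_opens P\<^esub>"
proof -
  show "U \<sqinter>\<^bsub>regular_opens P\<^esub> avoids P U = \<bottom>\<^bsub>regular_opens P\<^esub>"
    unfolding regular_opens_meet[OF assms avoids_closed[OF assms]] regular_opens_bottom
    by (auto simp: avoids_def)
  show "U \<squnion>\<^bsub>regular_opens P\<^esub> avoids P U = \<top>\<^bsub>regular_opens P\<^esub>"
    unfolding regular_opens_join[OF assms avoids_closed[OF assms]] regular_opens_top
    unfolding set_eq_iff mem_avoids_avoids by (auto simp: avoids_def)
qed

lemma regular_opens_complete_BA:
  assumes "P \<noteq> {}"
  shows "complete_BA (regular_opens P)"
proof -
  interpret complete_lattice "regular_opens P"
    by (rule regular_opens_complete_lattice)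
  show ?thesis
  proof
    fix x y z
    assume xyz: "x \<in> carrier (regular_opens P)" "y \<in> carrier (regular_opens P)"
      "z \<in> carrier (regular_opens P)"
    have mono: "p \<in> x \<Longrightarrow> q \<in> P \<Longrightarrow> p \<subseteq> q \<Longrightarrow> q \<in> x" for p q
      by (rule regular_openD(3)[OF xyz(1)])
    \<comment> \<open>From left to right, an extension that meets \<open>y \<union> z\<close> stays
      in \<open>x\<close> because \<open>x\<close> is upward closed; from right to left,
      monotonicity leads into the regularization of \<open>x\<close>, which is \<open>x\<close>
      itself.\<close>
    have "x \<inter> avoids P (avoids P (y \<union> z)) = avoids P (avoids P (x \<inter> y \<union> x \<inter> z))"
    proof (intro equalityI subsetI)
      fix p assume p: "p \<in> x \<inter> avoids P (avoids P (y \<union> z))"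
      then show "p \<in> avoids P (avoids P (x \<inter> y \<union> x \<inter> z))"
        using mono[of p] by (simp add: mem_avoids_avoids) (meson subset_trans)
    next
      fix p assume p: "p \<in> avoids P (avoids P (x \<inter> y \<union> x \<inter> z))"
      then have "p \<in> avoids P (avoids P x)"
        by (simp add: mem_avoids_avoids) blast
      moreover have "p \<in> avoids P (avoids P (y \<union> z))"
        using p by (simp add: mem_avoids_avoids) blast
      ultimately show "p \<in> x \<inter> avoids P (avoids P (y \<union> z))"
        using regular_openD(2)[OF xyz(1)] by simp
    qed
    moreover have "x \<inter> y \<in> carrier (regular_opens P)" "x \<inter> z \<in> carrier (regular_opens P)"
      using meet_closed[OF xyz(1,2)] meet_closed[OF xyz(1,3)] regular_opens_meet[OF xyz(1,2)]
        regular_opens_meet[OF xyz(1,3)] by (simp_all del: regular_opens_sel)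
    ultimately show "x \<sqinter>\<^bsub>regular_opens P\<^esub> (y \<squnion>\<^bsub>regular_opens P\<^esub> z) =
        (x \<sqinter>\<^bsub>regular_opens P\<^esub> y) \<squnion>\<^bsub>regular_opens P\<^esub> (x \<sqinter>\<^bsub>regular_opens P\<^esub> z)"
      using xyz by (simp only: regular_opens_meet regular_opens_join avoids_avoids_closed)
  next
    fix x assume "x \<in> carrier (regular_opens P)"
    from regular_opens_complement_props[OF this]
    show "\<exists>y\<in>carrier (regular_opens P). x \<sqinter>\<^bsub>regular_opens P\<^esub> y = \<bottom>\<^bsub>regular_opens P\<^esub> \<and>
        x \<squnion>\<^bsub>regular_opens P\<^esub> y = \<top>\<^bsub>regular_opens P\<^esub>"
      using avoids_closed[OF \<open>x \<in> carrier (regular_opens P)\<close>] by blast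
  qed (use assms in \<open>simp add: regular_opens_top regular_opens_bottom\<close>)
qed

lemma regular_opens_complement:
  assumes "U \<in> carrier (regular_opens P)" "P \<noteq> {}"
  shows "complement (regular_opens P) U = avoids P U"
  by (rule complete_BA.complement_eqI[OF regular_opens_complete_BA[OF assms(2)] assms(1) avoids_closed[OF assms(1)]
        regular_opens_complement_props[OF assms(1)]])

section \<open>Substitution of constants and conjunctions\<close>

text \<open>Substitutions that cannot capture. Replacing all variables by constants is the case of
  interest, but the inductions need a class closed under \<open>mask\<close>, which restores the
  bound variables below a quantifier.\<close>

definition const_or_same :: "('v \<Rightarrow> ('c, 'v) trm) \<Rightarrow> bool" where
  "const_or_same \<sigma> \<longleftrightarrow> (\<forall>x. \<sigma> x = Var x \<or> (\<exists>c. \<sigma> x = Const c))"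

lemma const_or_same_Const [simp]: "const_or_same (\<lambda>x. Const (a x))"
  by (simp add: const_or_same_def)

lemma const_or_same_mask [simp]: "const_or_same \<sigma> \<Longrightarrow> const_or_same (mask V \<sigma>)"
  by (auto simp: const_or_same_def mask_def)

lemma tvars_tsubst:
  assumes "const_or_same \<sigma>"
  shows "tvars (tsubst \<sigma> t) = {x \<in> tvars t. \<sigma> x = Var x}"
proof (cases t)
  case (Var x)
  with assms show ?thesis
    by (cases "\<sigma> x = Var x") (auto simp: const_or_same_def)
qed simp

lemma fv_subst:
  assumes "const_or_same \<sigma>"
  shows "fv (subst \<sigma> \<phi>) = {x \<in> fv \<phi>. \<sigma> x = Var x}"
  using assms
proof (induction \<phi> arbitrary: \<sigma>)
  case (All V \<phi>)
  then have "fv (subst (mask V \<sigma>) \<phi>) = {x \<in> fv \<phi>. mask V \<sigma> x = Var x}"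
    by simp
  then show ?case by (auto simp: mask_def)
next
  case (Ex V \<phi>)
  then have "fv (subst (mask V \<sigma>) \<phi>) = {x \<in> fv \<phi>. mask V \<sigma> x = Var x}"
    by simp
  then show ?case by (auto simp: mask_def)
qed (auto simp: tvars_tsubst)

text \<open>The hypothesis is confined to free variables because a subsentence may be given by an
  \<open>a\<close> with values outside the signature elsewhere. Free variables only disappear, so
  the bounds on them in \<open>Conj\<close> and \<open>Disj\<close> persist.\<close>

lemma subst_formulas:
  assumes "\<phi> \<in> formulas L lam" "const_or_same \<sigma>"
    and "\<And>x. x \<in> fv \<phi> \<Longrightarrow> \<sigma> x \<in> terms L"
  shows "subst \<sigma> \<phi> \<in> formulas L lam"
  using assms
proof (induction arbitrary: \<sigma>)
  case (Eq t u)
  then show ?case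
    by (cases t; cases u) (auto intro!: formulas.Eq)
next
  case (Rel R ts)
  have "tsubst \<sigma> t \<in> terms L" if "t \<in> set ts" for t
    using Rel.hyps(3) Rel.prems(2) that by (cases t) force+
  then show ?case
    using Rel by (auto intro!: formulas.Rel)
next
  case (Conj I f)
  have "|\<Union>i\<in>I. fv (subst \<sigma> (f i))| \<le>o |\<Union>i\<in>I. fv (f i)|"
    using Conj.prems by (intro card_of_mono1) (auto simp: fv_subst)
  then show ?case
    using Conj.hyps Conj.prems by (auto intro!: formulas.Conj Conj.IH intro: ordLeq_ordLess_trans)
next
  case (Disj I f)
  have "|\<Union>i\<in>I. fv (subst \<sigma> (f i))| \<le>o |\<Union>i\<in>I. fv (f i)|"
    using Disj.prems by (intro card_of_mono1) (auto simp: fv_subst)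
  then show ?case
    using Disj.hyps Disj.prems by (auto intro!: formulas.Disj Disj.IH intro: ordLeq_ordLess_trans)
next
  case (All V \<phi>)
  have "subst (mask V \<sigma>) \<phi> \<in> formulas L lam"
  proof (rule All.IH)
    show "mask V \<sigma> x \<in> terms L" if "x \<in> fv \<phi>" for x
      using that All.prems(2)[of x] by (simp add: mask_def terms_def)
  qed (use All.prems in simp)
  with All show ?case by (auto intro: formulas.All)
next
  case (Ex V \<phi>)
  have "subst (mask V \<sigma>) \<phi> \<in> formulas L lam"
  proof (rule Ex.IH)
    show "mask V \<sigma> x \<in> terms L" if "x \<in> fv \<phi>" for x
      using that Ex.prems(2)[of x] by (simp add: mask_def terms_def)
  qed (use Ex.prems in simp)
  with Ex show ?case by (auto intro: formulas.Ex)
qed (auto intro: formulas.Neg)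

lemma expand_sel [simp]:
  "relsyms (expand L C) = relsyms L" "arity (expand L C) = arity L"
  "constants (expand L C) = constants L \<union> C"
  by (simp_all add: expand_def)

lemma terms_expand: "terms L \<subseteq> terms (expand L C)"
  by (auto simp: terms_def)

lemma formulas_expand:
  assumes "\<phi> \<in> formulas L lam"
  shows "\<phi> \<in> formulas (expand L C) lam"
  using assms
proof induction
  case (Eq t u)
  then show ?case
    using terms_expand[of L C] by (auto intro!: formulas.Eq)
next
  case (Rel R ts)
  then show ?case
    using terms_expand[of L C] by (auto intro!: formulas.Rel)
qed (auto intro: formulas.intros)

lemma card_of_less_Pow: "|V :: 'v set| <o |UNIV :: 'v set set|"
  using card_of_mono1[of V UNIV] card_of_Pow[of "UNIV :: 'v set"]
  by (simp add: ordLeq_ordLess_trans)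

lemma finite_card_of_less: "finite X \<Longrightarrow> infinite Y \<Longrightarrow> |X| <o |Y|"
  by (rule finite_ordLess_infinite) (auto simp: Field_card_of card_of_well_order_on)

lemma formulas_subset_all_formulas:
  fixes L :: "('r, 'c) signature"
  assumes "(\<phi> :: ('r, 'c, 'v) fm) \<in> formulas L lam"
  shows "\<phi> \<in> all_formulas L"
proof -
  show ?thesis
    using assms unfolding all_formulas_def
    by induction (auto intro: formulas.intros card_of_less_Pow)
qed

inductive_cases formulas_NegE: "Neg \<phi> \<in> formulas L lam"
inductive_cases formulas_ConjE: "Conj I f \<in> formulas L lam"
inductive_cases formulas_DisjE: "Disj I f \<in> formulas L lam"
inductive_cases formulas_AllE: "All V \<phi> \<in> formulas L lam"
inductive_cases formulas_ExE: "Ex V \<phi> \<in> formulas L lam"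

lemma subformulas_formulas:
  assumes "\<phi> \<in> subformulas \<psi>" "\<psi> \<in> formulas L lam"
  shows "\<phi> \<in> formulas L lam"
  using assms
  by induction (blast elim: formulas_NegE formulas_ConjE formulas_DisjE formulas_AllE formulas_ExE
      intro: formulas.Neg)+

lemma finite_tvars: "finite (tvars t)"
  by (cases t) auto

lemma card_fv_less:
  assumes "\<phi> \<in> formulas L |C|" "infinite C"
  shows "|fv \<phi>| <o |C|"
  using assms(1)
proof induction
  case (Eq t u)
  show ?case
    using assms(2) by (intro finite_card_of_less) (simp_all add: finite_tvars)
next
  case (Rel R ts)
  show ?case
    using assms(2) by (intro finite_card_of_less) (simp_all add: finite_tvars)
next
  case (All V \<phi>)
  then show ?case
    by (auto intro: ordLeq_ordLess_trans[OF card_of_mono1])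
next
  case (Ex V \<phi>)
  then show ?case
    by (auto intro: ordLeq_ordLess_trans[OF card_of_mono1])
qed auto

section \<open>Conjunctions of sets of sentences\<close>

lemma subformulas_Conj:
  assumes "\<phi> \<in> subformulas (Conj I f)"
  shows "\<phi> = Conj I f \<or> (\<exists>i\<in>I. \<phi> \<in> subformulas (f i))"
  using assms by induction (auto intro: subformulas.intros)

lemma big_conj_cases:
  fixes \<Phi> :: "('r, 'c, 'v) fm set"
  assumes "|\<Phi>| <o |UNIV :: 'v set|"
  obtains I f where "big_conj \<Phi> = Conj I f" "f ` I = \<Phi>" "|I| <o |UNIV :: 'v set|"
proof -
  have "|\<Phi>| \<le>o |UNIV :: 'v set|"
    using assms by (rule ordLess_imp_ordLeq)
  then obtain g :: "_ \<Rightarrow> 'v" where "inj_on g \<Phi>"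
    using card_of_ordLeq[of \<Phi> "UNIV :: 'v set"] by auto
  \<comment> \<open>Index sets consist of variables, so an enumeration exists because \<Phi> injects
    into them. Without one, the choice in \<open>big_conj\<close> would return an unspecified
    family.\<close>
  then have "bij_betw (inv_into \<Phi> g) (g ` \<Phi>) \<Phi>"
    by (simp add: bij_betw_inv_into inj_on_imp_bij_betw)
  then have "\<exists>If. case If of (I, f) \<Rightarrow> bij_betw (f :: 'v \<Rightarrow> _) I \<Phi>"
    by auto
  from someI_ex[OF this] obtain I and f :: "'v \<Rightarrow> _" where
    If: "(SOME (I, f). bij_betw f I \<Phi>) = (I, f)" "bij_betw f I \<Phi>"
    by (auto split: prod.splits)
  show ?thesis
  proof (rule that)
    show "big_conj \<Phi> = Conj I f"
      by (simp add: big_conj_def If(1))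
    show "f ` I = \<Phi>"
      using If(2) by (simp add: bij_betw_def)
    have "|I| =o |\<Phi>|"
      using If(2) card_of_ordIso by blast
    then show "|I| <o |UNIV :: 'v set|"
      using assms by (rule ordIso_ordLess_trans)
  qed
qed

lemma big_conj_all_formulas:
  fixes L :: "('r, 'c) signature" and \<Phi> :: "('r, 'c, 'v) fm set"
  assumes "|\<Phi>| <o |UNIV :: 'v set|" "\<Phi> \<subseteq> sentences L lam"
  shows "big_conj \<Phi> \<in> all_formulas L"
proof -
  obtain I f where f: "big_conj \<Phi> = Conj I f" "f ` I = \<Phi>" "|I| <o |UNIV :: 'v set|"
    using big_conj_cases[OF assms(1)] .
  have "\<And>i. i \<in> I \<Longrightarrow> f i \<in> formulas L lam \<and> fv (f i) = {}"
    using f(2) assms(2) by (auto simp: sentences_def)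
  then have "(\<Union>i\<in>I. fv (f i)) = {}" "\<And>i. i \<in> I \<Longrightarrow> f i \<in> all_formulas L"
    using formulas_subset_all_formulas[of _ L lam] by auto
  then show ?thesis
    unfolding f(1) all_formulas_def using f(3)
    by (intro formulas.Conj) (simp_all add: card_of_less_Pow)
qed

text \<open>The only derivation in the calculus that the theorem calls for: it settles the
  provability clause of \<open>conservative_strengthening\<close>, and all else is about
  models.\<close>

lemma derives_big_conj:
  fixes L :: "('r, 'c) signature" and \<Phi> :: "('r, 'c, 'v) fm set"
  assumes "|\<Phi>| <o |UNIV :: 'v set|" "\<Phi> \<subseteq> sentences L lam" "\<Psi> \<subseteq> \<Phi>"
  shows "derives L {big_conj \<Phi>} {big_conj \<Psi>}"
proof -
  have \<Psi>: "|\<Psi>| <o |UNIV :: 'v set|" "\<Psi> \<subseteq> sentences L lam"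
    using assms card_of_mono1 ordLeq_ordLess_trans by blast+
  obtain I f where f: "big_conj \<Phi> = Conj I f" "f ` I = \<Phi>"
    using big_conj_cases[OF assms(1)] .
  obtain J g where g: "big_conj \<Psi> = Conj J g" "g ` J = \<Psi>"
    using big_conj_cases[OF \<Psi>(1)] .
  have af: "Conj I f \<in> all_formulas L" "Conj J g \<in> all_formulas L"
    using big_conj_all_formulas[OF assms(1,2)] big_conj_all_formulas[OF \<Psi>] f(1) g(1) by simp_all
  have "\<Phi> \<subseteq> all_formulas L"
    using assms(2) formulas_subset_all_formulas[of _ L lam] by (auto simp: sentences_def)
  have "derives L {Conj I f} (insert (Conj J g) {})"
  proof (rule conj_right)
    fix j assume "j \<in> J"
    then have "g j \<in> \<Phi>" using g(2) assms(3) by auto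
    then have "derives L (insert (g j) \<Phi>) (insert (g j) {})"
      using \<open>\<Phi> \<subseteq> all_formulas L\<close> by (intro ax) auto
    then have "derives L ({} \<union> f ` I) {g j}"
      using f(2) \<open>g j \<in> \<Phi>\<close> by (simp add: insert_absorb)
    then show "derives L {Conj I f} (insert (g j) {})"
      using af by (intro conj_left)
  qed (use af in auto)
  then show ?thesis
    using f g by simp
qed

section \<open>Values in Boolean valued models\<close>

lemma reassign_eq_image:
  "reassign M V \<nu> = (\<lambda>a. override_on \<nu> a V) ` {a. \<forall>x\<in>V. a x \<in> points M}"
  by (auto simp: reassign_def)

lemma reassign_outside: "\<mu> \<in> reassign M V \<nu> \<Longrightarrow> x \<notin> V \<Longrightarrow> \<mu> x = \<nu> x"
  by (auto simp: reassign_def override_on_def)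

lemma tval_tsubst: "tval M \<nu> (tsubst \<sigma> t) = tval M (\<lambda>x. tval M \<nu> (\<sigma> x)) t"
  by (cases t) auto

text \<open>If \<sigma> could send a variable outside \<open>V\<close> to a variable in
  \<open>V\<close>, the equation \<open>mask\<close> inside the proof would fail;
  \<open>const_or_same\<close> excludes this capture.\<close>

lemma val_subst:
  fixes M :: "('r, 'c, 'm, 'b) bvm" and \<phi> :: "('r, 'c, 'v) fm"
  assumes "const_or_same \<sigma>"
  shows "val B M \<nu> (subst \<sigma> \<phi>) = val B M (\<lambda>x. tval M \<nu> (\<sigma> x)) \<phi>"
  using assms
proof (induction \<phi> arbitrary: \<sigma> \<nu>)
  case (Eq t u)
  then show ?case by (simp add: tval_tsubst)
next
  case (Rel R ts)
  then show ?case by (simp add: tval_tsubst comp_def)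
next
  have mask: "(\<lambda>x. tval M (override_on \<nu> a V) (mask V \<sigma> x)) =
      override_on (\<lambda>x. tval M \<nu> (\<sigma> x)) a V" if "const_or_same \<sigma>"
    for \<sigma> :: "'v \<Rightarrow> ('c, 'v) trm" and \<nu> :: "'v \<Rightarrow> 'm" and a V
  proof
    fix x
    have "\<sigma> x = Var x \<or> (\<exists>c. \<sigma> x = Const c)"
      using that by (simp add: const_or_same_def)
    then show "tval M (override_on \<nu> a V) (mask V \<sigma> x) =
      override_on (\<lambda>x. tval M \<nu> (\<sigma> x)) a V x"
      by (auto simp: mask_def override_on_def)
  qed
  {
    case (All V \<phi>)
    then show ?case
      by (simp add: reassign_eq_image image_image mask)
  next
    case (Ex V \<phi>)
    then show ?case
      by (simp add: reassign_eq_image image_image mask)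
  }
qed simp_all

text \<open>Constants outside \<open>L\<close> do not occur in an \<open>L\<close>-formula, so they
  may be reinterpreted at will. This is how constants of \<open>C\<close> become names of witnesses
  in a given model.\<close>

lemma val_cong:
  assumes "\<phi> \<in> formulas L lam"
    and "\<And>c. c \<in> constants L \<Longrightarrow> const_val M c = k c"
    and "\<And>x. x \<in> fv \<phi> \<Longrightarrow> \<nu> x = \<nu>' x"
  shows "val B (M\<lparr>const_val := k\<rparr>) \<nu>' \<phi> = val B M \<nu> \<phi>"
  using assms(1,3)
proof (induction arbitrary: \<nu> \<nu>')
  have t: "tval (M\<lparr>const_val := k\<rparr>) \<nu>' t = tval M \<nu> t"
    if "t \<in> terms L" "\<And>x. x \<in> tvars t \<Longrightarrow> \<nu> x = \<nu>' x" for t \<nu> \<nu>'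
    using that assms(2) by (cases t) (auto simp: terms_def)
  {
    case (Neg \<phi>)
    then have "val B (M\<lparr>const_val := k\<rparr>) \<nu>' \<phi> = val B M \<nu> \<phi>"
      by (intro Neg.IH) simp
    then show ?case by simp
  next
    case (Eq t u)
    then show ?case using t[of t \<nu> \<nu>'] t[of u \<nu> \<nu>'] by simp
  next
    case (Rel R ts)
    have "map (tval (M\<lparr>const_val := k\<rparr>) \<nu>') ts = map (tval M \<nu>) ts"
    proof (rule map_cong)
      fix u assume "u \<in> set ts"
      then show "tval (M\<lparr>const_val := k\<rparr>) \<nu>' u = tval M \<nu> u"
        using Rel by (intro t) auto
    qed simp
    then show ?case by (simp del: map_eq_conv)
  next
    case (Conj I f)
    have "(\<lambda>i. val B (M\<lparr>const_val := k\<rparr>) \<nu>' (f i)) ` I = (\<lambda>i. val B M \<nu> (f i)) ` I"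
      using Conj.prems by (intro image_cong[OF HOL.refl] Conj.IH) auto
    then show ?case by simp
  next
    case (Disj I f)
    have "(\<lambda>i. val B (M\<lparr>const_val := k\<rparr>) \<nu>' (f i)) ` I = (\<lambda>i. val B M \<nu> (f i)) ` I"
      using Disj.prems by (intro image_cong[OF HOL.refl] Disj.IH) auto
    then show ?case by simp
  next
    case (All V \<phi>)
    have "val B (M\<lparr>const_val := k\<rparr>) (override_on \<nu>' a V) \<phi> = val B M (override_on \<nu> a V) \<phi>" for a
      using All.prems by (intro All.IH) (auto simp: override_on_def)
    then show ?case
      by (simp add: reassign_eq_image image_image)
  next
    case (Ex V \<phi>)
    have "val B (M\<lparr>const_val := k\<rparr>) (override_on \<nu>' a V) \<phi> = val B M (override_on \<nu> a V) \<phi>" for a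
      using Ex.prems by (intro Ex.IH) (auto simp: override_on_def)
    then show ?case
      by (simp add: reassign_eq_image image_image)
  }
qed

lemma val_cong_assignment:
  assumes "\<phi> \<in> formulas L lam" "\<And>x. x \<in> fv \<phi> \<Longrightarrow> \<nu> x = \<nu>' x"
  shows "val B M \<nu>' \<phi> = val B M \<nu> \<phi>"
  using val_cong[of \<phi> L lam M "const_val M" \<nu> \<nu>' B] assms by simp

section \<open>Relativized models\<close>

definition relativize_model :: "'b gorder \<Rightarrow> ('r, 'c, 'm, 'b) bvm \<Rightarrow> 'b \<Rightarrow> ('r, 'c, 'm, 'b) bvm" where
  "relativize_model B M b = M\<lparr>eq_val := \<lambda>x y. eq_val M x y \<sqinter>\<^bsub>B\<^esub> b, rel_val := \<lambda>R xs. rel_val M R xs \<sqinter>\<^bsub>B\<^esub> b\<rparr>"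

lemma relativize_model_sel [simp]:
  "points (relativize_model B M b) = points M"
  "const_val (relativize_model B M b) = const_val M"
  "eq_val (relativize_model B M b) x y = eq_val M x y \<sqinter>\<^bsub>B\<^esub> b"
  "rel_val (relativize_model B M b) R xs = rel_val M R xs \<sqinter>\<^bsub>B\<^esub> b"
  by (simp_all add: relativize_model_def)

lemma tval_relativize_model [simp]: "tval (relativize_model B M b) \<nu> t = tval M \<nu> t"
  by (cases t) simp_all

lemma reassign_relativize_model [simp]: "reassign (relativize_model B M b) V \<nu> = reassign M V \<nu>"
  by (simp add: reassign_def)

context bv_model
begin

lemma tval_closed: "t \<in> terms L \<Longrightarrow> \<nu> ` tvars t \<subseteq> points M \<Longrightarrow> tval M \<nu> t \<in> points M"
  by (cases t) (auto simp: terms_def intro: const_val_closed)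

lemma reassign_closed:
  "\<mu> \<in> reassign M V \<nu> \<Longrightarrow> \<nu> ` (X - V) \<subseteq> points M \<Longrightarrow> \<mu> ` X \<subseteq> points M"
  by (force simp: reassign_def override_on_def)

lemma val_closed:
  assumes "\<phi> \<in> formulas L lam" "\<nu> ` fv \<phi> \<subseteq> points M"
  shows "val B M \<nu> \<phi> \<in> carrier B"
  using assms
proof (induction arbitrary: \<nu>)
  case (Eq t u)
  then show ?case
    using tval_closed[of t \<nu>] tval_closed[of u \<nu>] by (simp add: eq_val_closed image_Un)
next
  case (Rel R ts)
  have "tval M \<nu> t \<in> points M" if "t \<in> set ts" for t
    using that Rel by (intro tval_closed) auto
  then show ?case
    using Rel by (auto intro!: rel_val_closed)
next
  case (Neg \<phi>)
  then show ?case by (simp add: complement_props)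
next
  case (Conj I f)
  then have "\<nu> ` fv (f i) \<subseteq> points M" if "i \<in> I" for i
    using that by (force simp: image_subset_iff)
  then show ?case using Conj.IH by (auto intro!: inf_closed)
next
  case (Disj I f)
  then have "\<nu> ` fv (f i) \<subseteq> points M" if "i \<in> I" for i
    using that by (force simp: image_subset_iff)
  then show ?case using Disj.IH by (auto intro!: sup_closed)
next
  case (All V \<phi>)
  then show ?case using reassign_closed[of _ V \<nu> "fv \<phi>"] by (auto intro!: inf_closed)
next
  case (Ex V \<phi>)
  then show ?case using reassign_closed[of _ V \<nu> "fv \<phi>"] by (auto intro!: sup_closed)
qed

lemma change_const_val:
  assumes "\<And>c. c \<in> constants L \<Longrightarrow> k c \<in> points M"
  shows "bv_model L B (M\<lparr>const_val := k\<rparr>)"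
  using assms nonempty eq_val_closed rel_val_closed eq_val_refl eq_val_sym eq_val_trans rel_val_cong
  by unfold_locales simp_all

context
  fixes b assumes b: "b \<in> carrier B" "b \<noteq> \<bottom>\<^bsub>B\<^esub>"
begin

interpretation R: nonzero_element B b
  using b by unfold_locales

text \<open>Meeting with \<open>b\<close> commutes with complements and with arbitrary infima and
  suprema, hence with the evaluation of every formula; the points, and with them the range of
  quantifiers, are the same.\<close>

lemma val_relativize:
  assumes "\<phi> \<in> formulas L lam" "\<nu> ` fv \<phi> \<subseteq> points M"
  shows "val (relativize B b) (relativize_model B M b) \<nu> \<phi> = val B M \<nu> \<phi> \<sqinter>\<^bsub>B\<^esub> b"
  using assms
proof (induction arbitrary: \<nu>)
  case (Neg \<phi>)
  then show ?case
    using val_closed[of \<phi> lam \<nu>] by (simp add: R.relativize_complement)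
next
  case (Conj I f)
  have "(\<lambda>i. val (relativize B b) (relativize_model B M b) \<nu> (f i)) ` I =
      (\<lambda>x. x \<sqinter>\<^bsub>B\<^esub> b) ` (\<lambda>i. val B M \<nu> (f i)) ` I"
    unfolding image_image using Conj.prems by (intro image_cong[OF HOL.refl] Conj.IH) auto
  moreover have "(\<lambda>i. val B M \<nu> (f i)) ` I \<subseteq> carrier B"
    using Conj.hyps Conj.prems by (auto intro!: val_closed)
  ultimately show ?case
    by (simp add: R.relativize_inf)
next
  case (Disj I f)
  have "(\<lambda>i. val (relativize B b) (relativize_model B M b) \<nu> (f i)) ` I =
      (\<lambda>x. x \<sqinter>\<^bsub>B\<^esub> b) ` (\<lambda>i. val B M \<nu> (f i)) ` I"
    unfolding image_image using Disj.prems by (intro image_cong[OF HOL.refl] Disj.IH) auto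
  moreover have "(\<lambda>i. val B M \<nu> (f i)) ` I \<subseteq> carrier B"
    using Disj.hyps Disj.prems by (auto intro!: val_closed)
  ultimately show ?case
    by (simp add: R.relativize_sup)
next
  case (All V \<phi>)
  have mu: "\<mu> ` fv \<phi> \<subseteq> points M" if "\<mu> \<in> reassign M V \<nu>" for \<mu>
    using reassign_closed[OF that] All.prems by simp
  have "(\<lambda>\<mu>. val (relativize B b) (relativize_model B M b) \<mu> \<phi>) ` reassign M V \<nu> =
      (\<lambda>x. x \<sqinter>\<^bsub>B\<^esub> b) ` (\<lambda>\<mu>. val B M \<mu> \<phi>) ` reassign M V \<nu>"
    unfolding image_image by (rule image_cong[OF HOL.refl]) (rule All.IH[OF mu])
  moreover have "(\<lambda>\<mu>. val B M \<mu> \<phi>) ` reassign M V \<nu> \<subseteq> carrier B"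
    using All.hyps mu by (auto intro!: val_closed)
  ultimately show ?case
    by (simp add: R.relativize_inf)
next
  case (Ex V \<phi>)
  have mu: "\<mu> ` fv \<phi> \<subseteq> points M" if "\<mu> \<in> reassign M V \<nu>" for \<mu>
    using reassign_closed[OF that] Ex.prems by simp
  have "(\<lambda>\<mu>. val (relativize B b) (relativize_model B M b) \<mu> \<phi>) ` reassign M V \<nu> =
      (\<lambda>x. x \<sqinter>\<^bsub>B\<^esub> b) ` (\<lambda>\<mu>. val B M \<mu> \<phi>) ` reassign M V \<nu>"
    unfolding image_image by (rule image_cong[OF HOL.refl]) (rule Ex.IH[OF mu])
  moreover have "(\<lambda>\<mu>. val B M \<mu> \<phi>) ` reassign M V \<nu> \<subseteq> carrier B"
    using Ex.hyps mu by (auto intro!: val_closed)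
  ultimately show ?case
    by (simp add: R.relativize_sup)
next
  case (Rel R ts)
  have "tval (relativize_model B M b) \<nu> = tval M \<nu>"
    by (rule ext) simp
  then show ?case by simp
qed simp

text \<open>Transitivity of equality and the congruence law for relations both have this
  shape.\<close>

lemma meet_le_meet:
  assumes "x \<in> carrier B" "y \<in> carrier B" "z \<in> carrier B" "x \<sqinter>\<^bsub>B\<^esub> y \<sqsubseteq>\<^bsub>B\<^esub> z"
  shows "(x \<sqinter>\<^bsub>B\<^esub> b) \<sqinter>\<^bsub>relativize B b\<^esub> (y \<sqinter>\<^bsub>B\<^esub> b) \<sqsubseteq>\<^bsub>B\<^esub> z \<sqinter>\<^bsub>B\<^esub> b"
proof -
  let ?m = "(x \<sqinter>\<^bsub>B\<^esub> b) \<sqinter>\<^bsub>B\<^esub> (y \<sqinter>\<^bsub>B\<^esub> b)"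
  have c: "x \<sqinter>\<^bsub>B\<^esub> b \<in> carrier B" "y \<sqinter>\<^bsub>B\<^esub> b \<in> carrier B" "?m \<in> carrier B"
    using assms b by simp_all
  have "?m \<sqsubseteq>\<^bsub>B\<^esub> x" "?m \<sqsubseteq>\<^bsub>B\<^esub> b"
    using le_trans[OF meet_left[OF c(1,2)] meet_left[OF assms(1) b(1)]]
      le_trans[OF meet_left[OF c(1,2)] meet_right[OF assms(1) b(1)]] c assms b by auto
  moreover have "?m \<sqsubseteq>\<^bsub>B\<^esub> y"
    using le_trans[OF meet_right[OF c(1,2)] meet_left[OF assms(2) b(1)]] c assms b by auto
  ultimately have "?m \<sqsubseteq>\<^bsub>B\<^esub> x \<sqinter>\<^bsub>B\<^esub> y"
    using c assms by (intro meet_le) auto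
  then have "?m \<sqsubseteq>\<^bsub>B\<^esub> z"
    using le_trans[OF _ assms(4)] c assms by auto
  then have "?m \<sqsubseteq>\<^bsub>B\<^esub> z \<sqinter>\<^bsub>B\<^esub> b"
    using \<open>?m \<sqsubseteq>\<^bsub>B\<^esub> b\<close> c assms b by (intro meet_le) auto
  moreover have "x \<sqinter>\<^bsub>B\<^esub> b \<in> carrier (relativize B b)" "y \<sqinter>\<^bsub>B\<^esub> b \<in> carrier (relativize B b)"
    using assms b by (simp_all add: meet_right)
  ultimately show ?thesis
    by (simp only: R.relativize_meet)
qed

lemma relativize_bv_model: "bv_model L (relativize B b) (relativize_model B M b)"
proof -
  interpret R': complete_BA "relativize B b"
    by (rule R.relativize_complete_BA)
  show ?thesis
  proof
    fix a c d assume "a \<in> points (relativize_model B M b)" "c \<in> points (relativize_model B M b)"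
      "d \<in> points (relativize_model B M b)"
    then show "eq_val (relativize_model B M b) a c \<sqinter>\<^bsub>relativize B b\<^esub> eq_val (relativize_model B M b) c d
        \<sqsubseteq>\<^bsub>relativize B b\<^esub> eq_val (relativize_model B M b) a d"
      by (simp add: eq_val_closed eq_val_trans meet_le_meet)
  next
    fix R as bs
    assume R: "R \<in> relsyms L" "set as \<subseteq> points (relativize_model B M b)"
      "set bs \<subseteq> points (relativize_model B M b)" "length as = arity L R" "length bs = arity L R"
    let ?E = "{eq_val M (as ! i) (bs ! i) | i. i < arity L R}"
    have E: "?E \<subseteq> carrier B"
      using R by (auto intro!: eq_val_closed simp: subset_iff)
    have "{eq_val (relativize_model B M b) (as ! i) (bs ! i) | i. i < arity L R} = (\<lambda>x. x \<sqinter>\<^bsub>B\<^esub> b) ` ?E"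
      by auto
    moreover have "(\<Sqinter>\<^bsub>B\<^esub>?E \<sqinter>\<^bsub>B\<^esub> b) \<sqinter>\<^bsub>relativize B b\<^esub> (rel_val M R as \<sqinter>\<^bsub>B\<^esub> b) \<sqsubseteq>\<^bsub>B\<^esub> rel_val M R bs \<sqinter>\<^bsub>B\<^esub> b"
      using R E by (intro meet_le_meet rel_val_cong rel_val_closed inf_closed) auto
    ultimately show "\<Sqinter>\<^bsub>relativize B b\<^esub>{eq_val (relativize_model B M b) (as ! i) (bs ! i) | i. i < arity L R}
        \<sqinter>\<^bsub>relativize B b\<^esub> rel_val (relativize_model B M b) R as
        \<sqsubseteq>\<^bsub>relativize B b\<^esub> rel_val (relativize_model B M b) R bs"
      by (simp add: R.relativize_inf[OF E])
  next
    fix a assume "a \<in> points (relativize_model B M b)"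
    then show "eq_val (relativize_model B M b) a a = \<top>\<^bsub>relativize B b\<^esub>"
      using b le_top le_iff_meet_eq[of b "\<top>\<^bsub>B\<^esub>"] by (simp add: eq_val_refl meet_commute[of _ b])
  qed (use nonempty b const_val_closed eq_val_sym in \<open>auto simp: eq_val_closed rel_val_closed meet_right\<close>)
qed

lemma top_relativize: "\<top>\<^bsub>B\<^esub> \<sqinter>\<^bsub>B\<^esub> b = \<top>\<^bsub>relativize B b\<^esub>" "b \<sqinter>\<^bsub>B\<^esub> b = \<top>\<^bsub>relativize B b\<^esub>"
  using b le_top le_iff_meet_eq[of b "\<top>\<^bsub>B\<^esub>"] le_iff_meet_eq[of b b]
  by (simp_all add: meet_commute[of "\<top>\<^bsub>B\<^esub>" b])

end

end

text \<open>Below the value \<open>b\<close> of \<theta>, both \<open>b\<close> and \<top> become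
  the unit. A nonzero value therefore suffices for consistency, and the relative algebra still lives
  in \<open>univ\<close>.\<close>

lemma boolean_consistent_insert:
  fixes B :: "('r, 'c, 'v) univ gorder"
    and M :: "('r, 'c, ('r, 'c, 'v) univ, ('r, 'c, 'v) univ) bvm"
  assumes "bv_model L B M" "range \<nu> \<subseteq> points M"
    and "\<Gamma> \<subseteq> formulas L lam" "\<And>\<phi>. \<phi> \<in> \<Gamma> \<Longrightarrow> val B M \<nu> \<phi> = \<top>\<^bsub>B\<^esub>"
    and "\<theta> \<in> formulas L lam" "val B M \<nu> \<theta> \<noteq> \<bottom>\<^bsub>B\<^esub>"
  shows "boolean_consistent L (insert \<theta> (\<Gamma> :: ('r, 'c, 'v) fm set))"
proof -
  interpret bv_model L B M by fact
  define b where "b = val B M \<nu> \<theta>"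
  have b: "b \<in> carrier B" "b \<noteq> \<bottom>\<^bsub>B\<^esub>"
    using assms val_closed[of \<theta> lam \<nu>] by (auto simp: b_def)
  have "val (relativize B b) (relativize_model B M b) \<nu> \<phi> = \<top>\<^bsub>relativize B b\<^esub>" if "\<phi> \<in> insert \<theta> \<Gamma>" for \<phi>
  proof -
    have "\<phi> \<in> formulas L lam" "\<nu> ` fv \<phi> \<subseteq> points M"
      using that assms by auto
    note val_relativize[OF b this]
    moreover have "val B M \<nu> \<phi> = \<top>\<^bsub>B\<^esub> \<or> val B M \<nu> \<phi> = b"
      using that assms(4) b_def by auto
    ultimately show ?thesis
      using top_relativize[OF b] by auto
  qed
  then show ?thesis
    unfolding boolean_consistent_def using relativize_bv_model[OF b] assms(2)
    by (intro exI[of _ "relativize B b"] exI[of _ "relativize_model B M b"] exI[of _ \<nu>]) simp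
qed

lemma boolean_consistent_big_conj:
  fixes L :: "('r, 'c) signature" and \<Phi> :: "('r, 'c, 'v) fm set"
  assumes "|\<Phi>| <o |UNIV :: 'v set|" "\<Phi> \<subseteq> sentences L lam"
  shows "boolean_consistent (expand L C) (\<Gamma> \<union> {big_conj \<Phi>}) \<longleftrightarrow> boolean_consistent (expand L C) (\<Gamma> \<union> \<Phi>)"
proof -
  obtain I f where f: "big_conj \<Phi> = Conj I f" "f ` I = \<Phi>"
    using big_conj_cases[OF assms(1)] .
  have "val B M \<nu> (big_conj \<Phi>) = \<top>\<^bsub>B\<^esub> \<longleftrightarrow> (\<forall>\<phi>\<in>\<Phi>. val B M \<nu> \<phi> = \<top>\<^bsub>B\<^esub>)"
    if "bv_model (expand L C) B M" for B :: "('r, 'c, 'v) univ gorder" and M :: "('r, 'c, ('r, 'c, 'v) univ, ('r, 'c, 'v) univ) bvm" and \<nu> :: "'v \<Rightarrow> ('r, 'c, 'v) univ"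
  proof -
    interpret bv_model "expand L C" B M by fact
    have "(\<lambda>i. val B M \<nu> (f i)) ` I \<subseteq> carrier B"
      using assms(2) f(2) by (auto simp: sentences_def intro!: val_closed[where lam = lam] formulas_expand)
    then show ?thesis
      using f by (auto simp: inf_eq_top_iff)
  qed
  then show ?thesis
    unfolding boolean_consistent_def by (intro ex_cong1 conj_cong HOL.refl) (auto simp: ball_Un)
qed

section \<open>Fresh constants and instances of subformulae\<close>

lemma card_of_finite_UN_less:
  assumes "finite X" "infinite C" "\<And>x. x \<in> X \<Longrightarrow> |f x| <o |C|"
  shows "|\<Union>x\<in>X. f x| <o |C|"
  using assms(1,3)
proof (induction X)
  case empty
  then show ?case
    using assms(2) by (simp add: finite_card_of_less)
next
  case (insert x X)
  then show ?case
    using card_of_Un_ordLess_infinite[OF assms(2), of "f x" "\<Union>x\<in>X. f x"] by simp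
qed

text \<open>An infinite set is not the union of two sets of smaller cardinality, so
  \<open>C - U\<close> is as large as \<open>C\<close>.\<close>

lemma inj_into_Diff:
  assumes "infinite C" "|V| <o |C|" "|U| <o |C|"
  obtains g where "inj_on g V" "g ` V \<subseteq> C - U"
proof -
  have "\<not> |C - U| <o |C|"
  proof
    assume "|C - U| <o |C|"
    then have "|(C - U) \<union> U| <o |C|"
      by (rule card_of_Un_ordLess_infinite[OF assms(1) _ assms(3)])
    moreover have "|C| \<le>o |(C - U) \<union> U|"
      by (rule card_of_mono1) auto
    ultimately show False
      using not_ordLess_ordLeq by blast
  qed
  then have "|C| \<le>o |C - U|"
    using card_of_Well_order not_ordLess_iff_ordLeq by blast
  then have "|V| \<le>o |C - U|"
    using assms(2) ordLess_imp_ordLeq ordLeq_transitive by blast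
  then show ?thesis
    using that card_of_ordLeq[of V "C - U"] by auto
qed

abbreviation inst :: "('v \<Rightarrow> 'c) \<Rightarrow> ('r, 'c, 'v) fm \<Rightarrow> ('r, 'c, 'v) fm" where
  "inst a \<phi> \<equiv> subst (\<lambda>x. Const (a x)) \<phi>"

text \<open>Every variable is replaced, so \<nu> loses its influence and \<open>a\<close> acts as
  the assignment. This connects the instances, which are what conditions contain, with the
  subformulae on which the inductions run.\<close>

lemma val_inst: "val B M \<nu> (inst a \<phi>) = val B M (\<lambda>x. const_val M (a x)) \<phi>"
  by (simp add: val_subst)

lemma subsentences_formulas:
  assumes "\<chi> \<in> subsentences L C \<psi>" "\<psi> \<in> formulas L lam"
  shows "\<chi> \<in> formulas (expand L C) lam"
proof -
  obtain a \<phi> where \<chi>: "\<chi> = inst a \<phi>" "\<phi> \<in> subformulas \<psi>" "\<forall>x\<in>fv \<phi>. a x \<in> constants L \<union> C"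
    using assms(1) by (auto simp: subsentences_def)
  have "\<phi> \<in> formulas (expand L C) lam"
    by (rule formulas_expand[OF subformulas_formulas[OF \<chi>(2) assms(2)]])
  then show ?thesis
    unfolding \<chi>(1) using \<chi>(3) by (intro subst_formulas) (auto simp: terms_def)
qed

section \<open>Satisfaction and semantic consequence\<close>

definition satisfies ::
  "('r, 'c) signature \<Rightarrow> 'b gorder \<Rightarrow> ('r, 'c, 'm, 'b) bvm \<Rightarrow> ('v \<Rightarrow> 'm) \<Rightarrow> ('r, 'c, 'v) fm set \<Rightarrow> bool" where
  "satisfies L B M \<nu> \<Gamma> \<longleftrightarrow> bv_model L B M \<and> range \<nu> \<subseteq> points M \<and> (\<forall>\<phi>\<in>\<Gamma>. val B M \<nu> \<phi> = \<top>\<^bsub>B\<^esub>)"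

lemma boolean_consistent_iff_satisfies:
  fixes \<Gamma> :: "('r, 'c, 'v) fm set"
  shows "boolean_consistent L \<Gamma> \<longleftrightarrow>
    (\<exists>(B :: ('r, 'c, 'v) univ gorder) (M :: ('r, 'c, ('r, 'c, 'v) univ, ('r, 'c, 'v) univ) bvm) \<nu>.
      satisfies L B M \<nu> \<Gamma>)"
  by (simp add: boolean_consistent_def satisfies_def)

lemma satisfies_mono: "satisfies L B M \<nu> \<Gamma> \<Longrightarrow> \<Delta> \<subseteq> \<Gamma> \<Longrightarrow> satisfies L B M \<nu> \<Delta>"
  by (auto simp: satisfies_def)

lemma boolean_consistent_mono: "boolean_consistent L \<Gamma> \<Longrightarrow> \<Delta> \<subseteq> \<Gamma> \<Longrightarrow> boolean_consistent L \<Delta>"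
  unfolding boolean_consistent_iff_satisfies using satisfies_mono by blast

text \<open>Atomic sentences need not be subsentences of \<open>T\<close>, so that conditions cannot decide them by
  membership. Semantic consequence takes the place of membership for them and makes the laws of
  equality hold in the generic model.\<close>

definition entails :: "('r, 'c) signature \<Rightarrow> ('r, 'c, 'v) fm set \<Rightarrow> ('r, 'c, 'v) fm \<Rightarrow> bool" where
  "entails L p \<phi> \<longleftrightarrow>
    (\<forall>(B :: ('r, 'c, 'v) univ gorder) (M :: ('r, 'c, ('r, 'c, 'v) univ, ('r, 'c, 'v) univ) bvm) \<nu>.
      satisfies L B M \<nu> p \<longrightarrow> val B M \<nu> \<phi> = \<top>\<^bsub>B\<^esub>)"

lemma entails_mono: "entails L p \<phi> \<Longrightarrow> p \<subseteq> q \<Longrightarrow> entails L q \<phi>"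
  unfolding entails_def using satisfies_mono by blast

lemma entails_member: "\<phi> \<in> p \<Longrightarrow> entails L p \<phi>"
  by (simp add: entails_def satisfies_def)

context complete_BA
begin

lemma top_le_iff: "x \<in> carrier B \<Longrightarrow> \<top> \<sqsubseteq> x \<longleftrightarrow> x = \<top>"
  using le_top le_antisym by auto

lemma top_meet_top: "\<top> \<sqinter> \<top> = \<top>"
  using le_iff_meet_eq[of "\<top>" "\<top>"] by simp

end

lemma entailsD:
  fixes B :: "('r, 'c, 'v) univ gorder" and M :: "('r, 'c, ('r, 'c, 'v) univ, ('r, 'c, 'v) univ) bvm"
  assumes "entails L (p :: ('r, 'c, 'v) fm set) \<phi>" "satisfies L B M \<nu> p"
  shows "val B M \<nu> \<phi> = \<top>\<^bsub>B\<^esub>"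
  using assms by (simp add: entails_def)

text \<open>A model of \<open>p\<close> gives \<top> to everything that \<open>p\<close> entails, so
  a closure law for \<open>entails\<close> reduces to the corresponding law inside a single Boolean
  valued model.\<close>

lemma entailsI:
  fixes L :: "('r, 'c) signature" and p :: "('r, 'c, 'v) fm set"
  assumes "\<And>(B :: ('r, 'c, 'v) univ gorder) (M :: ('r, 'c, ('r, 'c, 'v) univ, ('r, 'c, 'v) univ) bvm) \<nu>.
    \<lbrakk>bv_model L B M; \<And>\<psi>. entails L p \<psi> \<Longrightarrow> val B M \<nu> \<psi> = \<top>\<^bsub>B\<^esub>\<rbrakk> \<Longrightarrow> val B M \<nu> \<phi> = \<top>\<^bsub>B\<^esub>"
  shows "entails L p \<phi>"
  unfolding entails_def
proof (intro allI impI)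
  fix B :: "('r, 'c, 'v) univ gorder" and M :: "('r, 'c, ('r, 'c, 'v) univ, ('r, 'c, 'v) univ) bvm" and \<nu>
  assume sat: "satisfies L B M \<nu> p"
  then have "bv_model L B M"
    by (simp add: satisfies_def)
  then show "val B M \<nu> \<phi> = \<top>\<^bsub>B\<^esub>"
    by (rule assms) (rule entailsD[OF _ sat])
qed

lemma entails_Eq_refl: "c \<in> constants L \<Longrightarrow> entails L p (Eq (Const c) (Const c))"
  by (rule entailsI) (simp add: bv_model.eq_val_refl[OF _ bv_model.const_val_closed])

lemma entails_Eq_sym:
  fixes L :: "('r, 'c) signature" and p :: "('r, 'c, 'v) fm set"
  assumes "c \<in> constants L" "d \<in> constants L" "entails L p (Eq (Const c) (Const d))"
  shows "entails L p (Eq (Const d) (Const c))"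
proof (rule entailsI)
  fix B :: "('r, 'c, 'v) univ gorder" and M :: "('r, 'c, ('r, 'c, 'v) univ, ('r, 'c, 'v) univ) bvm" and \<nu> :: "'v \<Rightarrow> ('r, 'c, 'v) univ"
  assume "bv_model L B M" and top: "\<And>\<psi>. entails L p \<psi> \<Longrightarrow> val B M \<nu> \<psi> = \<top>\<^bsub>B\<^esub>"
  interpret bv_model L B M by fact
  show "val B M \<nu> (Eq (Const d) (Const c)) = \<top>\<^bsub>B\<^esub>"
    using top[OF assms(3)] eq_val_sym[OF const_val_closed const_val_closed, OF assms(2,1)] by simp
qed

lemma entails_Eq_trans:
  fixes L :: "('r, 'c) signature" and p :: "('r, 'c, 'v) fm set"
  assumes "c \<in> constants L" "d \<in> constants L" "e \<in> constants L"
    and "entails L p (Eq (Const c) (Const d))" "entails L p (Eq (Const d) (Const e))"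
  shows "entails L p (Eq (Const c) (Const e))"
proof (rule entailsI)
  fix B :: "('r, 'c, 'v) univ gorder" and M :: "('r, 'c, ('r, 'c, 'v) univ, ('r, 'c, 'v) univ) bvm" and \<nu> :: "'v \<Rightarrow> ('r, 'c, 'v) univ"
  assume "bv_model L B M" and top: "\<And>\<psi>. entails L p \<psi> \<Longrightarrow> val B M \<nu> \<psi> = \<top>\<^bsub>B\<^esub>"
  interpret bv_model L B M by fact
  have "val B M \<nu> (Eq (Const c) (Const d)) = \<top>\<^bsub>B\<^esub>" "val B M \<nu> (Eq (Const d) (Const e)) = \<top>\<^bsub>B\<^esub>"
    by (rule top[OF assms(4)], rule top[OF assms(5)])
  then show "val B M \<nu> (Eq (Const c) (Const e)) = \<top>\<^bsub>B\<^esub>"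
    using eq_val_trans[of "const_val M c" "const_val M d" "const_val M e"] assms
    by (simp add: const_val_closed top_meet_top top_le_iff eq_val_closed)
qed

lemma entails_Rel_cong:
  fixes L :: "('r, 'c) signature" and p :: "('r, 'c, 'v) fm set"
  assumes "R \<in> relsyms L" "set cs \<subseteq> constants L" "set ds \<subseteq> constants L"
    and "length cs = arity L R" "length ds = arity L R"
    and "\<And>i. i < arity L R \<Longrightarrow> entails L p (Eq (Const (cs ! i)) (Const (ds ! i)))"
    and "entails L p (Rel R (map Const cs))"
  shows "entails L p (Rel R (map Const ds))"
proof (rule entailsI)
  fix B :: "('r, 'c, 'v) univ gorder" and M :: "('r, 'c, ('r, 'c, 'v) univ, ('r, 'c, 'v) univ) bvm" and \<nu> :: "'v \<Rightarrow> ('r, 'c, 'v) univ"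
  assume "bv_model L B M" and top: "\<And>\<psi>. entails L p \<psi> \<Longrightarrow> val B M \<nu> \<psi> = \<top>\<^bsub>B\<^esub>"
  interpret bv_model L B M by fact
  let ?cs = "map (const_val M) cs" and ?ds = "map (const_val M) ds"
  have eqs: "eq_val M (?cs ! i) (?ds ! i) = \<top>\<^bsub>B\<^esub>" if "i < arity L R" for i
  proof -
    have "val B M \<nu> (Eq (Const (cs ! i)) (Const (ds ! i))) = \<top>\<^bsub>B\<^esub>"
      by (rule top[OF assms(6)[OF that]])
    then show ?thesis
      using that assms(4,5) by simp
  qed
  have "val B M \<nu> (Rel R (map Const cs)) = \<top>\<^bsub>B\<^esub>"
    by (rule top[OF assms(7)])
  then have "rel_val M R ?cs = \<top>\<^bsub>B\<^esub>"
    by (simp add: comp_def)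
  moreover have "\<Sqinter>\<^bsub>B\<^esub>{eq_val M (?cs ! i) (?ds ! i) | i. i < arity L R} = \<top>\<^bsub>B\<^esub>"
    using eqs by (subst inf_eq_top_iff) auto
  moreover have "set ?cs \<subseteq> points M" "set ?ds \<subseteq> points M"
    using assms(2,3) const_val_closed by auto
  ultimately have "\<top>\<^bsub>B\<^esub> \<sqsubseteq>\<^bsub>B\<^esub> rel_val M R ?ds" "rel_val M R ?ds \<in> carrier B"
    using rel_val_cong[of R ?cs ?ds] rel_val_closed[of R ?ds] assms by (simp_all add: top_meet_top)
  then show "val B M \<nu> (Rel R (map Const ds)) = \<top>\<^bsub>B\<^esub>"
    by (simp add: comp_def top_le_iff)
qed

lemma reassign_empty [simp]: "reassign M {} \<nu> = {\<nu>}"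
  by (simp add: reassign_def)

section \<open>Consequences of the value \<top> for compound formulae\<close>

context bv_model
begin

lemma val_image_closed:
  assumes "\<And>i. i \<in> I \<Longrightarrow> f i \<in> formulas L lam" "\<nu> ` (\<Union>i\<in>I. fv (f i)) \<subseteq> points M"
  shows "(\<lambda>i. val B M \<nu> (f i)) ` I \<subseteq> carrier B"
  using assms by (auto intro!: val_closed[where lam = lam] simp: image_subset_iff)

lemma val_reassign_closed:
  assumes "\<phi> \<in> formulas L lam" "\<nu> ` (fv \<phi> - V) \<subseteq> points M"
  shows "(\<lambda>\<mu>. val B M \<mu> \<phi>) ` reassign M V \<nu> \<subseteq> carrier B"
proof (rule image_subsetI)
  fix \<mu> assume "\<mu> \<in> reassign M V \<nu>"
  then show "val B M \<mu> \<phi> \<in> carrier B"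
    by (rule val_closed[OF assms(1) reassign_closed[OF _ assms(2)]])
qed

lemma inf_eq_bot_ex:
  assumes "A \<subseteq> carrier B" "\<Sqinter>\<^bsub>B\<^esub>A = \<bottom>\<^bsub>B\<^esub>"
  shows "\<exists>a\<in>A. a \<noteq> \<top>\<^bsub>B\<^esub>"
  using inf_eq_top_iff[OF assms(1)] assms(2) nontrivial by auto

lemma sup_eq_top_ex:
  assumes "A \<subseteq> carrier B" "\<Squnion>\<^bsub>B\<^esub>A = \<top>\<^bsub>B\<^esub>"
  shows "\<exists>a\<in>A. a \<noteq> \<bottom>\<^bsub>B\<^esub>"
  using sup_eq_bot_iff[OF assms(1)] assms(2) nontrivial by auto

lemma val_Conj_topD:
  assumes "Conj I f \<in> formulas L lam" "\<nu> ` fv (Conj I f) \<subseteq> points M" "val B M \<nu> (Conj I f) = \<top>\<^bsub>B\<^esub>" "i \<in> I"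
  shows "val B M \<nu> (f i) = \<top>\<^bsub>B\<^esub>"
  using inf_eq_top_iff[OF val_image_closed[of I f lam \<nu>]] assms by (auto elim: formulas_ConjE)

text \<open>A supremum can be \<top> without any member being \<top>, so a nonzero disjunct is all
  that can be expected. The same holds for \<open>Ex\<close>, \<open>Neg (Conj I f)\<close> and
  \<open>Neg (All V \<phi>)\<close>, whereas the conjunctive cases preserve \<top>.\<close>

lemma val_Disj_topD:
  assumes "Disj I f \<in> formulas L lam" "\<nu> ` fv (Disj I f) \<subseteq> points M" "val B M \<nu> (Disj I f) = \<top>\<^bsub>B\<^esub>"
  shows "\<exists>i\<in>I. val B M \<nu> (f i) \<noteq> \<bottom>\<^bsub>B\<^esub>"
  using sup_eq_top_ex[OF val_image_closed[of I f lam \<nu>]] assms by (auto elim: formulas_DisjE)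

lemma val_All_topD:
  assumes "All V \<phi> \<in> formulas L lam" "\<nu> ` fv (All V \<phi>) \<subseteq> points M" "val B M \<nu> (All V \<phi>) = \<top>\<^bsub>B\<^esub>"
    "\<mu> \<in> reassign M V \<nu>"
  shows "val B M \<mu> \<phi> = \<top>\<^bsub>B\<^esub>"
  using inf_eq_top_iff[OF val_reassign_closed[of \<phi> lam \<nu> V]] assms by (auto elim: formulas_AllE)

lemma val_Ex_topD:
  assumes "Ex V \<phi> \<in> formulas L lam" "\<nu> ` fv (Ex V \<phi>) \<subseteq> points M" "val B M \<nu> (Ex V \<phi>) = \<top>\<^bsub>B\<^esub>"
  shows "\<exists>\<mu>\<in>reassign M V \<nu>. val B M \<mu> \<phi> \<noteq> \<bottom>\<^bsub>B\<^esub>"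
  using sup_eq_top_ex[OF val_reassign_closed[of \<phi> lam \<nu> V]] assms by (auto elim: formulas_ExE)

lemma val_Neg_topD:
  assumes "Neg \<phi> \<in> formulas L lam" "\<nu> ` fv \<phi> \<subseteq> points M" "val B M \<nu> (Neg \<phi>) = \<top>\<^bsub>B\<^esub>"
  shows "val B M \<nu> \<phi> = \<bottom>\<^bsub>B\<^esub>"
  using val_closed[of \<phi> lam \<nu>] assms by (auto elim: formulas_NegE simp: complement_eq_top_iff)

lemma val_Neg_Conj_topD:
  assumes "Neg (Conj I f) \<in> formulas L lam" "\<nu> ` fv (Conj I f) \<subseteq> points M"
    "val B M \<nu> (Neg (Conj I f)) = \<top>\<^bsub>B\<^esub>"
  shows "\<exists>i\<in>I. val B M \<nu> (Neg (f i)) \<noteq> \<bottom>\<^bsub>B\<^esub>"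
proof -
  have c: "(\<lambda>i. val B M \<nu> (f i)) ` I \<subseteq> carrier B"
    using assms(1,2) by (intro val_image_closed[where lam = lam]) (auto elim!: formulas_NegE formulas_ConjE)
  show ?thesis
    using inf_eq_bot_ex[OF c] val_Neg_topD[OF assms] complement_eq_bot_iff[OF subsetD[OF c]] by fastforce
qed

lemma val_Neg_Disj_topD:
  assumes "Neg (Disj I f) \<in> formulas L lam" "\<nu> ` fv (Disj I f) \<subseteq> points M"
    "val B M \<nu> (Neg (Disj I f)) = \<top>\<^bsub>B\<^esub>" "i \<in> I"
  shows "val B M \<nu> (Neg (f i)) = \<top>\<^bsub>B\<^esub>"
proof -
  have c: "(\<lambda>i. val B M \<nu> (f i)) ` I \<subseteq> carrier B"
    using assms(1,2) by (intro val_image_closed[where lam = lam]) (auto elim!: formulas_NegE formulas_DisjE)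
  show ?thesis
    using sup_eq_bot_iff[OF c] c val_Neg_topD[OF assms(1-3)] assms(4) by (simp add: complement_bot)
qed

lemma val_Neg_All_topD:
  assumes "Neg (All V \<phi>) \<in> formulas L lam" "\<nu> ` fv (All V \<phi>) \<subseteq> points M"
    "val B M \<nu> (Neg (All V \<phi>)) = \<top>\<^bsub>B\<^esub>"
  shows "\<exists>\<mu>\<in>reassign M V \<nu>. val B M \<mu> (Neg \<phi>) \<noteq> \<bottom>\<^bsub>B\<^esub>"
proof -
  have c: "(\<lambda>\<mu>. val B M \<mu> \<phi>) ` reassign M V \<nu> \<subseteq> carrier B"
    using assms(1,2) by (intro val_reassign_closed[where lam = lam]) (auto elim!: formulas_NegE formulas_AllE)
  show ?thesis
    using inf_eq_bot_ex[OF c] val_Neg_topD[OF assms] complement_eq_bot_iff[OF subsetD[OF c]] by fastforce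
qed

lemma val_Neg_Ex_topD:
  assumes "Neg (Ex V \<phi>) \<in> formulas L lam" "\<nu> ` fv (Ex V \<phi>) \<subseteq> points M"
    "val B M \<nu> (Neg (Ex V \<phi>)) = \<top>\<^bsub>B\<^esub>" "\<mu> \<in> reassign M V \<nu>"
  shows "val B M \<mu> (Neg \<phi>) = \<top>\<^bsub>B\<^esub>"
proof -
  have c: "(\<lambda>\<mu>. val B M \<mu> \<phi>) ` reassign M V \<nu> \<subseteq> carrier B"
    using assms(1,2) by (intro val_reassign_closed[where lam = lam]) (auto elim!: formulas_NegE formulas_ExE)
  show ?thesis
    using sup_eq_bot_iff[OF c] c val_Neg_topD[OF assms(1-3)] assms(4) by (simp add: complement_bot)
qed

lemma val_Neg_Neg_topD:
  assumes "Neg (Neg \<phi>) \<in> formulas L lam" "\<nu> ` fv \<phi> \<subseteq> points M" "val B M \<nu> (Neg (Neg \<phi>)) = \<top>\<^bsub>B\<^esub>"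
  shows "val B M \<nu> \<phi> = \<top>\<^bsub>B\<^esub>"
  using val_closed[of \<phi> lam \<nu>] assms by (auto elim!: formulas_NegE simp: complement_complement)

end

section \<open>Forcing with finite sets of subsentences\<close>

text \<open>Any injection of the constants into the type of points would do.\<close>

definition emb :: "'c \<Rightarrow> ('r, 'c, 'v) univ" where
  "emb c = {{Eq (Const c) (Const c)}}"

definition proj :: "('r, 'c, 'v) univ \<Rightarrow> 'c" where
  "proj = inv emb"

lemma proj_emb [simp]: "proj (emb c) = c"
  unfolding proj_def by (rule inv_f_f) (simp add: emb_def inj_on_def)

text \<open>\<open>conservative\<close> is finite conservativity with sets in place of their
  conjunctions. It speaks of subsentences of the members of \<open>J0\<close> and leaves out the
  instances of \<open>big_conj J0\<close> itself, since conditions consist of subsentences of single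
  sentences of \<open>T\<close>.\<close>

locale forcing =
  fixes L :: "('r, 'c) signature" and C :: "'c set" and T :: "('r, 'c, 'v) fm set"
    and s0 :: "('r, 'c, 'v) fm set"
  assumes infinite_C: "infinite C" and C_fresh: "C \<inter> constants L = {}"
    and T_sentences: "T \<subseteq> sentences L |C|"
    and conservative: "\<lbrakk>J0 \<noteq> {}; J0 \<subseteq> J1; J1 \<subseteq> T; finite J1; finite p; p \<subseteq> (\<Union>\<psi>\<in>J0. subsentences L C \<psi>);
      boolean_consistent (expand L C) (p \<union> J0)\<rbrakk> \<Longrightarrow> boolean_consistent (expand L C) (p \<union> J1)"
    and start: "finite s0" "\<exists>J. finite J \<and> J \<noteq> {} \<and> J \<subseteq> T \<and> s0 \<subseteq> (\<Union>\<psi>\<in>J. subsentences L C \<psi>) \<and>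
      boolean_consistent (expand L C) (s0 \<union> J)"
begin

abbreviation "LC \<equiv> expand L C"

abbreviation "K \<equiv> constants L \<union> C"

definition conds :: "('r, 'c, 'v) fm set set" where
  "conds = {p. finite p \<and> s0 \<subseteq> p \<and>
    (\<exists>J. finite J \<and> J \<noteq> {} \<and> J \<subseteq> T \<and> p \<subseteq> (\<Union>\<psi>\<in>J. subsentences L C \<psi>) \<and> boolean_consistent LC (p \<union> J))}"

lemma s0_conds: "s0 \<in> conds"
  using start by (simp add: conds_def)

lemma conds_nonempty: "conds \<noteq> {}"
  using s0_conds by auto

lemma T_formulas: "\<psi> \<in> T \<Longrightarrow> \<psi> \<in> formulas L |C|" and fv_T: "\<psi> \<in> T \<Longrightarrow> fv \<psi> = {}"
  using T_sentences by (auto simp: sentences_def)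

lemma cond_model:
  assumes "p \<in> conds" "\<psi> \<in> T"
  obtains J and B :: "('r, 'c, 'v) univ gorder"
    and M :: "('r, 'c, ('r, 'c, 'v) univ, ('r, 'c, 'v) univ) bvm" and \<nu> where
    "finite J" "\<psi> \<in> J" "J \<subseteq> T" "p \<subseteq> (\<Union>\<psi>\<in>J. subsentences L C \<psi>)" "satisfies LC B M \<nu> (p \<union> J)"
proof -
  obtain J where J: "finite p" "finite J" "J \<noteq> {}" "J \<subseteq> T" "p \<subseteq> (\<Union>\<psi>\<in>J. subsentences L C \<psi>)"
    "boolean_consistent LC (p \<union> J)"
    using assms(1) by (auto simp: conds_def)
  \<comment> \<open>Conservativity applied to \<open>J\<close> and \<open>insert \<psi> J\<close>:
    since \<open>p\<close> consists of subsentences of \<open>J\<close>, it remains consistent when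
    \<psi> joins.\<close>
  have "boolean_consistent LC (p \<union> insert \<psi> J)"
    by (rule conservative[of J]) (use J assms(2) in auto)
  then obtain B :: "('r, 'c, 'v) univ gorder"
    and M :: "('r, 'c, ('r, 'c, 'v) univ, ('r, 'c, 'v) univ) bvm" and \<nu>
    where "satisfies LC B M \<nu> (p \<union> insert \<psi> J)"
    unfolding boolean_consistent_iff_satisfies by blast
  then show ?thesis
    by (rule that[rotated 4]) (use J assms(2) in auto)
qed

text \<open>Fresh constants are made to denote the values of \<mu> on \<open>V\<close>, so that
  \<mu> becomes the interpretation of constants \<open>a'\<close>. The set \<open>J\<close> stays
  the same, because the new member is a subsentence of \<psi>, which lies in \<open>J\<close>. With
  \<open>V = {}\<close> nothing is renamed and \<open>a' = a\<close>.\<close>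

lemma cond_extend:
  fixes B :: "('r, 'c, 'v) univ gorder"
    and M :: "('r, 'c, ('r, 'c, 'v) univ, ('r, 'c, 'v) univ) bvm"
  assumes p: "p \<in> conds"
    and J: "finite J" "\<psi> \<in> J" "J \<subseteq> T" "p \<subseteq> (\<Union>\<psi>\<in>J. subsentences L C \<psi>)"
    and sat: "satisfies LC B M \<nu> (p \<union> J)"
    and \<theta>: "\<theta> \<in> subformulas \<psi>" and V: "|V| <o |C|"
    and a: "a ` (fv \<theta> - V) \<subseteq> K"
    and \<mu>: "\<mu> \<in> reassign M V (\<lambda>x. const_val M (a x))"
    and nonzero: "val B M \<mu> \<theta> \<noteq> \<bottom>\<^bsub>B\<^esub>"
  shows "\<exists>a'. (\<forall>x. x \<notin> V \<longrightarrow> a' x = a x) \<and> a' ` V \<subseteq> K \<and> insert (inst a' \<theta>) p \<in> conds"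
proof -
  interpret bv_model LC B M
    using sat by (simp add: satisfies_def)
  have \<theta>_formula: "\<theta> \<in> formulas L |C|"
    using \<theta> J subformulas_formulas T_formulas by blast
  \<comment> \<open>Presenting the members of \<open>p\<close> as instances of
    \<open>L\<close>-formulae locates their constants from \<open>C\<close>: these are all values of
    some \<open>b\<close> at free variables, fewer than |C| for each member.\<close>
  have "\<exists>b \<phi>. \<chi> = inst b \<phi> \<and> \<phi> \<in> formulas L |C| \<and> b ` fv \<phi> \<subseteq> K" if \<chi>: "\<chi> \<in> p" for \<chi>
  proof -
    obtain \<psi>' where "\<psi>' \<in> J" "\<chi> \<in> subsentences L C \<psi>'"
      using \<chi> J(4) by blast
    then obtain b \<phi> where "\<chi> = inst b \<phi>" "\<phi> \<in> subformulas \<psi>'" "\<forall>x\<in>fv \<phi>. b x \<in> K"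
      by (auto simp: subsentences_def)
    moreover have "\<phi> \<in> formulas L |C|"
      using \<open>\<phi> \<in> subformulas \<psi>'\<close> \<open>\<psi>' \<in> J\<close> J(3) subformulas_formulas T_formulas by blast
    ultimately show ?thesis by blast
  qed
  then obtain b \<phi> where b\<phi>: "\<And>\<chi>. \<chi> \<in> p \<Longrightarrow> \<chi> = inst (b \<chi>) (\<phi> \<chi>) \<and> \<phi> \<chi> \<in> formulas L |C| \<and> b \<chi> ` fv (\<phi> \<chi>) \<subseteq> K"
    by metis
  \<comment> \<open>The constants whose meaning must not change: those put into \<theta> outside
    \<open>V\<close> and those put into the members of \<open>p\<close>.\<close>
  define U where "U = a ` (fv \<theta> - V) \<union> (\<Union>\<chi>\<in>p. b \<chi> ` fv (\<phi> \<chi>))"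
  have less: "|f ` X| <o |C|" if "X \<subseteq> fv \<phi>" "\<phi> \<in> formulas L |C|"
    for f :: "'v \<Rightarrow> 'c" and X and \<phi> :: "('r, 'c, 'v) fm"
    by (rule ordLeq_ordLess_trans[OF card_of_image
        ordLeq_ordLess_trans[OF card_of_mono1[OF that(1)] card_fv_less[OF that(2) infinite_C]]])
  have "finite p"
    using p by (simp add: conds_def)
  have "|U| <o |C|"
    unfolding U_def
    by (intro card_of_Un_ordLess_infinite card_of_finite_UN_less infinite_C \<open>finite p\<close> less[OF _ \<theta>_formula]
        less[OF subset_refl]) (use b\<phi> in auto)
  then obtain g where g: "inj_on g V" "g ` V \<subseteq> C - U"
    using inj_into_Diff[OF infinite_C V] by blast
  define a' where "a' = override_on a g V"
  \<comment> \<open>Well defined on the fresh constants because \<open>g\<close> is injective on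
    \<open>V\<close>.\<close>
  define k where "k c = (if c \<in> g ` V then \<mu> (inv_into V g c) else const_val M c)" for c
  have k_g: "k (g x) = \<mu> x" if "x \<in> V" for x
    using that g(1) by (simp add: k_def)
  have k_U: "k c = const_val M c" if "c \<in> U" for c
    using that g(2) by (auto simp: k_def)
  have k_L: "const_val M c = k c" if "c \<in> constants L" for c
    using that g(2) C_fresh by (auto simp: k_def)
  have k_points: "k c \<in> points M" if "c \<in> constants LC" for c
  proof (cases "c \<in> g ` V")
    case True
    then obtain x where "x \<in> V" "c = g x" by blast
    then show ?thesis
      using \<mu> k_g by (auto simp: reassign_def)
  next
    case False
    then show ?thesis
      using const_val_closed[OF that] by (simp add: k_def)
  qed
  let ?M = "M\<lparr>const_val := k\<rparr>"
  interpret k: bv_model LC B ?M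
    by (rule change_const_val[OF k_points])
  \<comment> \<open>Members of \<open>J\<close> are \<open>L\<close>-formulae, and those of
    \<open>p\<close> are instances with constants from \<open>U\<close>; on both kinds of constants
    \<open>k\<close> agrees with the old interpretation.\<close>
  have tops: "val B ?M \<nu> \<chi> = \<top>\<^bsub>B\<^esub>" if "\<chi> \<in> p \<union> J" for \<chi>
  proof (cases "\<chi> \<in> J")
    case True
    have "val B ?M \<nu> \<chi> = val B M \<nu> \<chi>"
      by (rule val_cong[of \<chi> L "|C|"]) (use True J(3) T_formulas k_L in auto)
    then show ?thesis
      using sat that by (simp add: satisfies_def)
  next
    case False
    with that have "\<chi> \<in> p" by simp
    have "val B ?M \<nu> \<chi> = val B ?M (\<lambda>x. k (b \<chi> x)) (\<phi> \<chi>)"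
      using b\<phi>[OF \<open>\<chi> \<in> p\<close>] val_inst[of B ?M \<nu> "b \<chi>" "\<phi> \<chi>"] by simp
    also have "\<dots> = val B M (\<lambda>x. const_val M (b \<chi> x)) (\<phi> \<chi>)"
    proof (rule val_cong[of _ L "|C|"])
      show "const_val M (b \<chi> x) = k (b \<chi> x)" if "x \<in> fv (\<phi> \<chi>)" for x
        using k_U[of "b \<chi> x"] that \<open>\<chi> \<in> p\<close> by (auto simp: U_def)
    qed (use b\<phi>[OF \<open>\<chi> \<in> p\<close>] k_L in auto)
    also have "\<dots> = val B M \<nu> \<chi>"
      using b\<phi>[OF \<open>\<chi> \<in> p\<close>] val_inst[of B M \<nu> "b \<chi>" "\<phi> \<chi>"] by simp
    also have "\<dots> = \<top>\<^bsub>B\<^esub>"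
      using sat that by (simp add: satisfies_def)
    finally show ?thesis .
  qed
  have "val B ?M \<nu> (inst a' \<theta>) = val B ?M (\<lambda>x. k (a' x)) \<theta>"
    by (simp add: val_inst)
  also have "\<dots> = val B M \<mu> \<theta>"
  proof (rule val_cong[of _ L "|C|"])
    show "\<mu> x = k (a' x)" if "x \<in> fv \<theta>" for x
    proof (cases "x \<in> V")
      case True
      then show ?thesis by (simp add: a'_def k_g)
    next
      case False
      then have "a x \<in> U"
        using that by (auto simp: U_def)
      with False show ?thesis
        using reassign_outside[OF \<mu>] by (simp add: a'_def k_U)
    qed
  qed (use \<theta>_formula k_L in auto)
  finally have nz: "val B ?M \<nu> (inst a' \<theta>) \<noteq> \<bottom>\<^bsub>B\<^esub>"
    using nonzero by simp
  have a'K: "a' x \<in> K" if "x \<in> fv \<theta> \<or> x \<in> V" for x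
    using that a g(2) by (cases "x \<in> V") (auto simp: a'_def)
  then have sub: "inst a' \<theta> \<in> subsentences L C \<psi>"
    using \<theta> by (auto simp: subsentences_def)
  have J_formulas: "\<psi>' \<in> formulas LC |C|" if "\<psi>' \<in> J" for \<psi>'
    using that J(3) by (auto intro!: formulas_expand T_formulas)
  have sub_formulas: "\<chi> \<in> formulas LC |C|" if "\<chi> \<in> subsentences L C \<psi>'" "\<psi>' \<in> J" for \<chi> \<psi>'
    using that J(3) by (intro subsentences_formulas[OF that(1)] T_formulas) auto
  have "boolean_consistent LC (insert (inst a' \<theta>) (p \<union> J))"
  proof (rule boolean_consistent_insert[OF k.bv_model_axioms])
    show "range \<nu> \<subseteq> points ?M"
      using sat by (simp add: satisfies_def)
    show "p \<union> J \<subseteq> formulas LC |C|"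
      using J(4) J_formulas sub_formulas by blast
    show "inst a' \<theta> \<in> formulas LC |C|"
      using sub J(2) sub_formulas by blast
  qed (use tops nz in auto)
  then have "insert (inst a' \<theta>) p \<in> conds"
    unfolding conds_def using p J sub
    by (auto simp: conds_def intro!: exI[of _ J])
  moreover have "\<forall>x. x \<notin> V \<longrightarrow> a' x = a x"
    by (simp add: a'_def)
  ultimately show ?thesis
    using a'K by blast
qed

text \<open>The predicate \<open>Q\<close> is the set of formulae of which one, depending on the model, is to be added.\<close>

lemma cond_step:
  assumes p: "p \<in> conds" and \<chi>: "\<psi> \<in> T" "inst a0 \<chi> \<in> p"
    and H: "\<And>(B :: ('r, 'c, 'v) univ gorder) (M :: ('r, 'c, ('r, 'c, 'v) univ, ('r, 'c, 'v) univ) bvm).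
      bv_model LC B M \<Longrightarrow> val B M (\<lambda>x. const_val M (a0 x)) \<chi> = \<top>\<^bsub>B\<^esub> \<Longrightarrow>
      \<exists>\<theta> \<mu>. Q \<theta> \<and> \<mu> \<in> reassign M V (\<lambda>x. const_val M (a x)) \<and> val B M \<mu> \<theta> \<noteq> \<bottom>\<^bsub>B\<^esub>"
    and Q: "\<And>\<theta>. Q \<theta> \<Longrightarrow> \<theta> \<in> subformulas \<psi> \<and> a ` (fv \<theta> - V) \<subseteq> K"
    and V: "|V| <o |C|"
  shows "\<exists>\<theta> a'. Q \<theta> \<and> (\<forall>x. x \<notin> V \<longrightarrow> a' x = a x) \<and> a' ` V \<subseteq> K \<and> insert (inst a' \<theta>) p \<in> conds"
proof -
  obtain J and B :: "('r, 'c, 'v) univ gorder"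
    and M :: "('r, 'c, ('r, 'c, 'v) univ, ('r, 'c, 'v) univ) bvm" and \<nu>
    where J: "finite J" "\<psi> \<in> J" "J \<subseteq> T" "p \<subseteq> (\<Union>\<psi>\<in>J. subsentences L C \<psi>)"
      and sat: "satisfies LC B M \<nu> (p \<union> J)"
    using cond_model[OF p \<chi>(1)] .
  have "bv_model LC B M" "val B M \<nu> (inst a0 \<chi>) = \<top>\<^bsub>B\<^esub>"
    using sat \<chi>(2) by (auto simp: satisfies_def)
  then obtain \<theta> \<mu> where "Q \<theta>" "\<mu> \<in> reassign M V (\<lambda>x. const_val M (a x))" "val B M \<mu> \<theta> \<noteq> \<bottom>\<^bsub>B\<^esub>"
    using H[of B M] by (auto simp: val_inst)
  with cond_extend[OF p J sat _ V, of \<theta> a \<mu>] Q show ?thesis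
    by blast
qed

section \<open>Forcing of atomic sentences and the generic model\<close>

definition force :: "('r, 'c, 'v) fm \<Rightarrow> ('r, 'c, 'v) univ" where
  "force \<alpha> = avoids conds (avoids conds {p \<in> conds. entails LC p \<alpha>})"

text \<open>The conditions that entail \<alpha> form an upward closed family, but it need not be
  regular; regularizing it amounts to asking for entailment densely above \<open>p\<close>.\<close>

lemma mem_force: "p \<in> force \<alpha> \<longleftrightarrow> p \<in> conds \<and> (\<forall>q\<in>conds. p \<subseteq> q \<longrightarrow> (\<exists>r\<in>conds. q \<subseteq> r \<and> entails LC r \<alpha>))"
  by (auto simp: force_def mem_avoids_avoids)

lemma force_closed: "force \<alpha> \<in> carrier (regular_opens conds)"
  unfolding force_def by (rule avoids_avoids_closed)

lemma force_subset: "force \<alpha> \<subseteq> conds"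
  using mem_force by blast

lemma entails_force: "p \<in> conds \<Longrightarrow> entails LC p \<alpha> \<Longrightarrow> p \<in> force \<alpha>"
  unfolding mem_force using entails_mono by blast

lemma force_upward: "p \<in> force \<alpha> \<Longrightarrow> q \<in> conds \<Longrightarrow> p \<subseteq> q \<Longrightarrow> q \<in> force \<alpha>"
  unfolding mem_force using subset_trans by blast

text \<open>Each \<alpha> costs one extension, and \<open>entails_mono\<close> preserves what was
  achieved before; hence the restriction to finite \<open>A\<close>.\<close>

lemma force_dense:
  assumes "finite A" "p \<in> conds" "\<And>\<alpha>. \<alpha> \<in> A \<Longrightarrow> p \<in> force \<alpha>"
  shows "\<exists>r\<in>conds. p \<subseteq> r \<and> (\<forall>\<alpha>\<in>A. entails LC r \<alpha>)"
  using assms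
proof (induction A)
  case empty
  then show ?case by auto
next
  case (insert \<alpha> A)
  then obtain r where r: "r \<in> conds" "p \<subseteq> r" "\<forall>\<beta>\<in>A. entails LC r \<beta>"
    by auto
  have "p \<in> force \<alpha>"
    using insert.prems by simp
  then obtain r' where "r' \<in> conds" "r \<subseteq> r'" "entails LC r' \<alpha>"
    using r unfolding mem_force by blast
  with r show ?case
    using entails_mono[of LC r _ r'] by (intro bexI[of _ r']) auto
qed

text \<open>Transfers the laws of equality from \<open>entails\<close> to \<open>force\<close>:
  above any extension of \<open>p\<close> some condition entails all premises at once.\<close>

lemma force_consequence:
  assumes "finite A" "p \<in> conds" "\<And>\<alpha>. \<alpha> \<in> A \<Longrightarrow> p \<in> force \<alpha>"
    and "\<And>q. (\<And>\<alpha>. \<alpha> \<in> A \<Longrightarrow> entails LC q \<alpha>) \<Longrightarrow> entails LC q \<beta>"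
  shows "p \<in> force \<beta>"
  unfolding mem_force
proof (intro conjI ballI impI)
  fix q assume "q \<in> conds" "p \<subseteq> q"
  then have "\<And>\<alpha>. \<alpha> \<in> A \<Longrightarrow> q \<in> force \<alpha>"
    using assms(3) force_upward by blast
  from force_dense[OF assms(1) \<open>q \<in> conds\<close> this]
  show "\<exists>r\<in>conds. q \<subseteq> r \<and> entails LC r \<beta>"
    using assms(4) by blast
qed fact

text \<open>The term model on the constants. No quotient is formed, because distinct points of a
  Boolean valued model may be equal with value \<top>.\<close>

definition generic :: "('r, 'c, ('r, 'c, 'v) univ, ('r, 'c, 'v) univ) bvm" where
  "generic = \<lparr>points = emb ` K,
    eq_val = \<lambda>x y. force (Eq (Const (proj x)) (Const (proj y))),
    rel_val = \<lambda>R xs. force (Rel R (map Const (map proj xs))),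
    const_val = emb\<rparr>"

lemma generic_sel [simp]:
  "points generic = emb ` K"
  "eq_val generic x y = force (Eq (Const (proj x)) (Const (proj y)))"
  "rel_val generic R xs = force (Rel R (map Const (map proj xs)))"
  "const_val generic = emb"
  by (simp_all add: generic_def)

sublocale RO: complete_BA "regular_opens conds"
  by (rule regular_opens_complete_BA[OF conds_nonempty])

sublocale generic: bv_model LC "regular_opens conds" generic
proof
  show "points generic \<noteq> {}"
    using infinite_C by auto
next
  fix x y assume "x \<in> points generic" "y \<in> points generic"
  then obtain c d where cd: "x = emb c" "y = emb d" "c \<in> constants LC" "d \<in> constants LC"
    by auto
  show "eq_val generic x y \<in> carrier (regular_opens conds)"
    using force_closed by simp
  have "entails LC p (Eq (Const c) (Const d)) \<longleftrightarrow> entails LC p (Eq (Const d) (Const c))"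
    for p :: "('r, 'c, 'v) fm set"
    using entails_Eq_sym[OF cd(3,4), of p] entails_Eq_sym[OF cd(4,3), of p] by (rule iffI)
  then show "eq_val generic x y = eq_val generic y x"
    using cd(1,2) by (simp add: force_def)
  show "eq_val generic x x = \<top>\<^bsub>regular_opens conds\<^esub>"
    using cd force_subset entails_force[OF _ entails_Eq_refl[OF cd(3)]]
    by (auto simp: regular_opens_top)
  fix z assume "z \<in> points generic"
  then obtain e where e: "z = emb e" "e \<in> constants LC"
    by auto
  show "eq_val generic x y \<sqinter>\<^bsub>regular_opens conds\<^esub> eq_val generic y z
      \<sqsubseteq>\<^bsub>regular_opens conds\<^esub> eq_val generic x z"
    unfolding generic_sel regular_opens_meet[OF force_closed force_closed] regular_opens_sel
  proof
    fix p assume p: "p \<in> force (Eq (Const (proj x)) (Const (proj y))) \<inter> force (Eq (Const (proj y)) (Const (proj z)))"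
    show "p \<in> force (Eq (Const (proj x)) (Const (proj z)))"
    proof (rule force_consequence[of "{Eq (Const c) (Const d), Eq (Const d) (Const e)}"])
      show "p \<in> conds" using p force_subset by blast
    qed (use p cd e entails_Eq_trans[of c LC d e] in auto)
  qed
next
  fix R xs assume "R \<in> relsyms LC" "set xs \<subseteq> points generic" "length xs = arity LC R"
  show "rel_val generic R xs \<in> carrier (regular_opens conds)"
    using force_closed by simp
  fix ys
  assume R: "R \<in> relsyms LC" "set xs \<subseteq> points generic" "set ys \<subseteq> points generic"
    "length xs = arity LC R" "length ys = arity LC R"
  let ?E = "{eq_val generic (xs ! i) (ys ! i) | i. i < arity LC R}"
  have E: "?E \<subseteq> carrier (regular_opens conds)"
    using force_closed by auto
  show "\<Sqinter>\<^bsub>regular_opens conds\<^esub>?E \<sqinter>\<^bsub>regular_opens conds\<^esub> rel_val generic R xs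
      \<sqsubseteq>\<^bsub>regular_opens conds\<^esub> rel_val generic R ys"
    unfolding regular_opens_inf[OF E] generic_sel(3)
      regular_opens_meet[OF regular_opens_inter_closed[OF E] force_closed] regular_opens_sel
  proof
    let ?cs = "map proj xs" and ?ds = "map proj ys"
    fix p assume p: "p \<in> conds \<inter> \<Inter>?E \<inter> force (Rel R (map Const ?cs))"
    \<comment> \<open>Finite because relation symbols have finite arity, as
      \<open>force_consequence\<close> requires.\<close>
    let ?A = "insert (Rel R (map Const ?cs)) ((\<lambda>i. Eq (Const (?cs ! i)) (Const (?ds ! i))) ` {..<arity L R})"
    show "p \<in> force (Rel R (map Const ?ds))"
    proof (rule force_consequence[of ?A])
      show "p \<in> force \<alpha>" if "\<alpha> \<in> ?A" for \<alpha>
      proof -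
        have "p \<in> force (Eq (Const (?cs ! i)) (Const (?ds ! i)))" if "i < arity L R" for i
        proof -
          have "p \<in> eq_val generic (xs ! i) (ys ! i)"
            using p that by auto
          then show ?thesis
            using that R by simp
        qed
        then show ?thesis
          using that p by auto
      qed
      fix q assume q: "\<And>\<alpha>. \<alpha> \<in> ?A \<Longrightarrow> entails LC q \<alpha>"
      show "entails LC q (Rel R (map Const ?ds))"
      proof (rule entails_Rel_cong[of R LC ?cs ?ds])
        show "set ?cs \<subseteq> constants LC" "set ?ds \<subseteq> constants LC"
          using R by force+
      qed (use q R in auto)
    qed (use p in auto)
  qed
qed auto

end

section \<open>Adding components of a member to a condition\<close>

context forcing
begin

lemma cond_step_same:
  assumes p: "p \<in> conds" and \<chi>: "\<psi> \<in> T" "inst a0 \<chi> \<in> p"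
    and H: "\<And>(B :: ('r, 'c, 'v) univ gorder) (M :: ('r, 'c, ('r, 'c, 'v) univ, ('r, 'c, 'v) univ) bvm).
      bv_model LC B M \<Longrightarrow> val B M (\<lambda>x. const_val M (a0 x)) \<chi> = \<top>\<^bsub>B\<^esub> \<Longrightarrow>
      \<exists>\<theta>. Q \<theta> \<and> val B M (\<lambda>x. const_val M (a x)) \<theta> \<noteq> \<bottom>\<^bsub>B\<^esub>"
    and Q: "\<And>\<theta>. Q \<theta> \<Longrightarrow> \<theta> \<in> subformulas \<psi> \<and> a ` fv \<theta> \<subseteq> K"
  shows "\<exists>\<theta>. Q \<theta> \<and> insert (inst a \<theta>) p \<in> conds"
proof -
  have "\<exists>\<theta> a'. Q \<theta> \<and> (\<forall>x. x \<notin> {} \<longrightarrow> a' x = a x) \<and> a' ` {} \<subseteq> K \<and> insert (inst a' \<theta>) p \<in> conds"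
  proof (rule cond_step[OF p \<chi>])
    show "|{} :: 'v set| <o |C|"
      using infinite_C by (simp add: finite_card_of_less)
  qed (use H Q in auto)
  then show ?thesis
    by (auto simp: fun_eq_iff[symmetric])
qed

lemma assignment_closed:
  assumes "bv_model LC B M" "a ` X \<subseteq> K"
  shows "(\<lambda>x. const_val M (a x)) ` X \<subseteq> points M"
  using bv_model.const_val_closed[OF assms(1)] assms(2) by auto

lemma sub_formulas: "\<phi> \<in> subformulas \<psi> \<Longrightarrow> \<psi> \<in> T \<Longrightarrow> \<phi> \<in> formulas LC |C|"
  by (rule formulas_expand[OF subformulas_formulas[OF _ T_formulas]])

lemma bv_model_top_nonbot: "bv_model LC B M \<Longrightarrow> x = \<top>\<^bsub>B\<^esub> \<Longrightarrow> x \<noteq> \<bottom>\<^bsub>B\<^esub>"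
  by (metis bv_model_def complete_BA.nontrivial)

context
  fixes p \<psi> and a :: "'v \<Rightarrow> 'c"
  assumes p: "p \<in> conds" and \<psi>: "\<psi> \<in> T"
begin

text \<open>This lemma and its companions are the clauses of a consistency property. Conditions are
  finite, so the conjunctive ones add one prescribed component and never all of them.\<close>

lemma step_Conj:
  assumes "Conj I f \<in> subformulas \<psi>" "a ` fv (Conj I f) \<subseteq> K" "inst a (Conj I f) \<in> p" "i \<in> I"
  shows "insert (inst a (f i)) p \<in> conds"
proof -
  have "\<exists>\<theta>. \<theta> = f i \<and> insert (inst a \<theta>) p \<in> conds"
  proof (rule cond_step_same[OF p \<psi> assms(3)])
    show "\<theta> \<in> subformulas \<psi> \<and> a ` fv \<theta> \<subseteq> K" if "\<theta> = f i" for \<theta>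
      using that assms(2,4) subformulas.Conj[OF assms(1,4)] by (auto simp: image_subset_iff)
  next
    fix B :: "('r, 'c, 'v) univ gorder" and M :: "('r, 'c, ('r, 'c, 'v) univ, ('r, 'c, 'v) univ) bvm"
    assume m: "bv_model LC B M" "val B M (\<lambda>x. const_val M (a x)) (Conj I f) = \<top>\<^bsub>B\<^esub>"
    note top = bv_model.val_Conj_topD[OF m(1) sub_formulas[OF assms(1) \<psi>] assignment_closed[OF m(1) assms(2)] m(2) assms(4)]
    show "\<exists>\<theta>. \<theta> = f i \<and> val B M (\<lambda>x. const_val M (a x)) \<theta> \<noteq> \<bottom>\<^bsub>B\<^esub>"
      using bv_model_top_nonbot[OF m(1) top] by blast
  qed
  then show ?thesis by simp
qed

lemma step_Neg_Disj:
  assumes "Neg (Disj I f) \<in> subformulas \<psi>" "a ` fv (Disj I f) \<subseteq> K" "inst a (Neg (Disj I f)) \<in> p" "i \<in> I"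
  shows "insert (inst a (Neg (f i))) p \<in> conds"
proof -
  have "\<exists>\<theta>. \<theta> = Neg (f i) \<and> insert (inst a \<theta>) p \<in> conds"
  proof (rule cond_step_same[OF p \<psi> assms(3)])
    show "\<theta> \<in> subformulas \<psi> \<and> a ` fv \<theta> \<subseteq> K" if "\<theta> = Neg (f i)" for \<theta>
      using that assms(2,4) subformulas.Neg_Disj[OF assms(1,4)] by (auto simp: image_subset_iff)
  next
    fix B :: "('r, 'c, 'v) univ gorder" and M :: "('r, 'c, ('r, 'c, 'v) univ, ('r, 'c, 'v) univ) bvm"
    assume m: "bv_model LC B M" "val B M (\<lambda>x. const_val M (a x)) (Neg (Disj I f)) = \<top>\<^bsub>B\<^esub>"
    note top = bv_model.val_Neg_Disj_topD[OF m(1) sub_formulas[OF assms(1) \<psi>] assignment_closed[OF m(1) assms(2)] m(2) assms(4)]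
    show "\<exists>\<theta>. \<theta> = Neg (f i) \<and> val B M (\<lambda>x. const_val M (a x)) \<theta> \<noteq> \<bottom>\<^bsub>B\<^esub>"
      using bv_model_top_nonbot[OF m(1) top] by blast
  qed
  then show ?thesis by simp
qed

lemma step_Neg_Neg:
  assumes "Neg (Neg \<phi>) \<in> subformulas \<psi>" "a ` fv \<phi> \<subseteq> K" "inst a (Neg (Neg \<phi>)) \<in> p"
  shows "insert (inst a \<phi>) p \<in> conds"
proof -
  have "\<exists>\<theta>. \<theta> = \<phi> \<and> insert (inst a \<theta>) p \<in> conds"
  proof (rule cond_step_same[OF p \<psi> assms(3)])
    show "\<theta> \<in> subformulas \<psi> \<and> a ` fv \<theta> \<subseteq> K" if "\<theta> = \<phi>" for \<theta>
      using that assms(2) subformulas.Neg[OF subformulas.Neg[OF assms(1)]] by auto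
  next
    fix B :: "('r, 'c, 'v) univ gorder" and M :: "('r, 'c, ('r, 'c, 'v) univ, ('r, 'c, 'v) univ) bvm"
    assume m: "bv_model LC B M" "val B M (\<lambda>x. const_val M (a x)) (Neg (Neg \<phi>)) = \<top>\<^bsub>B\<^esub>"
    note top = bv_model.val_Neg_Neg_topD[OF m(1) sub_formulas[OF assms(1) \<psi>] assignment_closed[OF m(1) assms(2)] m(2)]
    show "\<exists>\<theta>. \<theta> = \<phi> \<and> val B M (\<lambda>x. const_val M (a x)) \<theta> \<noteq> \<bottom>\<^bsub>B\<^esub>"
      using bv_model_top_nonbot[OF m(1) top] by blast
  qed
  then show ?thesis by simp
qed

lemma step_Disj:
  assumes "Disj I f \<in> subformulas \<psi>" "a ` fv (Disj I f) \<subseteq> K" "inst a (Disj I f) \<in> p"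
  shows "\<exists>i\<in>I. insert (inst a (f i)) p \<in> conds"
proof -
  have "\<exists>\<theta>. \<theta> \<in> f ` I \<and> insert (inst a \<theta>) p \<in> conds"
  proof (rule cond_step_same[OF p \<psi> assms(3)])
    show "\<theta> \<in> subformulas \<psi> \<and> a ` fv \<theta> \<subseteq> K" if "\<theta> \<in> f ` I" for \<theta>
      using that assms(2) subformulas.Disj[OF assms(1)] by (auto simp: image_subset_iff)
  next
    fix B :: "('r, 'c, 'v) univ gorder" and M :: "('r, 'c, ('r, 'c, 'v) univ, ('r, 'c, 'v) univ) bvm"
    assume m: "bv_model LC B M" "val B M (\<lambda>x. const_val M (a x)) (Disj I f) = \<top>\<^bsub>B\<^esub>"
    note top = bv_model.val_Disj_topD[OF m(1) sub_formulas[OF assms(1) \<psi>] assignment_closed[OF m(1) assms(2)] m(2)]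
    show "\<exists>\<theta>. \<theta> \<in> f ` I \<and> val B M (\<lambda>x. const_val M (a x)) \<theta> \<noteq> \<bottom>\<^bsub>B\<^esub>"
      using top by blast
  qed
  then show ?thesis by auto
qed

lemma step_Neg_Conj:
  assumes "Neg (Conj I f) \<in> subformulas \<psi>" "a ` fv (Conj I f) \<subseteq> K" "inst a (Neg (Conj I f)) \<in> p"
  shows "\<exists>i\<in>I. insert (inst a (Neg (f i))) p \<in> conds"
proof -
  have "\<exists>\<theta>. \<theta> \<in> (\<lambda>i. Neg (f i)) ` I \<and> insert (inst a \<theta>) p \<in> conds"
  proof (rule cond_step_same[OF p \<psi> assms(3)])
    show "\<theta> \<in> subformulas \<psi> \<and> a ` fv \<theta> \<subseteq> K" if "\<theta> \<in> (\<lambda>i. Neg (f i)) ` I" for \<theta>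
      using that assms(2) subformulas.Neg_Conj[OF assms(1)]
      by (simp add: image_subset_iff) fastforce
  next
    fix B :: "('r, 'c, 'v) univ gorder" and M :: "('r, 'c, ('r, 'c, 'v) univ, ('r, 'c, 'v) univ) bvm"
    assume m: "bv_model LC B M" "val B M (\<lambda>x. const_val M (a x)) (Neg (Conj I f)) = \<top>\<^bsub>B\<^esub>"
    note top = bv_model.val_Neg_Conj_topD[OF m(1) sub_formulas[OF assms(1) \<psi>] assignment_closed[OF m(1) assms(2)] m(2)]
    show "\<exists>\<theta>. \<theta> \<in> (\<lambda>i. Neg (f i)) ` I \<and> val B M (\<lambda>x. const_val M (a x)) \<theta> \<noteq> \<bottom>\<^bsub>B\<^esub>"
      using top by blast
  qed
  then show ?thesis by auto
qed

lemma const_val_reassign: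
  assumes "bv_model LC B M" "\<And>x. x \<notin> V \<Longrightarrow> a' x = a x" "a' ` V \<subseteq> K"
  shows "(\<lambda>x. const_val M (a' x)) \<in> reassign M V (\<lambda>x. const_val M (a x))"
  unfolding reassign_def using assms assignment_closed[OF assms(1,3)]
  by (intro CollectI exI[of _ "\<lambda>x. const_val M (a' x)"]) (auto simp: override_on_def)

text \<open>The constants are prescribed and need not be fresh: a universal formula has to hold at
  all points of the generic model, and these are named by \<open>K\<close>.\<close>

lemma step_All:
  assumes "All V \<phi> \<in> subformulas \<psi>" "a ` fv (All V \<phi>) \<subseteq> K" "inst a (All V \<phi>) \<in> p"
    and a': "\<And>x. x \<notin> V \<Longrightarrow> a' x = a x" "a' ` V \<subseteq> K"
  shows "insert (inst a' \<phi>) p \<in> conds"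
proof -
  have "\<exists>\<theta>. \<theta> = \<phi> \<and> insert (inst a' \<theta>) p \<in> conds"
  proof (rule cond_step_same[OF p \<psi> assms(3)])
    have "a' x \<in> K" if "x \<in> fv \<phi>" for x
      using that a' assms(2) by (cases "x \<in> V") auto
    then show "\<theta> \<in> subformulas \<psi> \<and> a' ` fv \<theta> \<subseteq> K" if "\<theta> = \<phi>" for \<theta>
      using that subformulas.All[OF assms(1)] by auto
  next
    fix B :: "('r, 'c, 'v) univ gorder" and M :: "('r, 'c, ('r, 'c, 'v) univ, ('r, 'c, 'v) univ) bvm"
    assume m: "bv_model LC B M" "val B M (\<lambda>x. const_val M (a x)) (All V \<phi>) = \<top>\<^bsub>B\<^esub>"
    note top = bv_model.val_All_topD[OF m(1) sub_formulas[OF assms(1) \<psi>] assignment_closed[OF m(1) assms(2)] m(2) const_val_reassign[OF m(1) a']]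
    show "\<exists>\<theta>. \<theta> = \<phi> \<and> val B M (\<lambda>x. const_val M (a' x)) \<theta> \<noteq> \<bottom>\<^bsub>B\<^esub>"
      using bv_model_top_nonbot[OF m(1) top] by blast
  qed
  then show ?thesis by simp
qed

lemma step_Neg_Ex:
  assumes "Neg (Ex V \<phi>) \<in> subformulas \<psi>" "a ` fv (Ex V \<phi>) \<subseteq> K" "inst a (Neg (Ex V \<phi>)) \<in> p"
    and a': "\<And>x. x \<notin> V \<Longrightarrow> a' x = a x" "a' ` V \<subseteq> K"
  shows "insert (inst a' (Neg \<phi>)) p \<in> conds"
proof -
  have "\<exists>\<theta>. \<theta> = Neg \<phi> \<and> insert (inst a' \<theta>) p \<in> conds"
  proof (rule cond_step_same[OF p \<psi> assms(3)])
    have "a' x \<in> K" if "x \<in> fv \<phi>" for x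
      using that a' assms(2) by (cases "x \<in> V") auto
    then show "\<theta> \<in> subformulas \<psi> \<and> a' ` fv \<theta> \<subseteq> K" if "\<theta> = Neg \<phi>" for \<theta>
      using that subformulas.Neg_Ex[OF assms(1)] by auto
  next
    fix B :: "('r, 'c, 'v) univ gorder" and M :: "('r, 'c, ('r, 'c, 'v) univ, ('r, 'c, 'v) univ) bvm"
    assume m: "bv_model LC B M" "val B M (\<lambda>x. const_val M (a x)) (Neg (Ex V \<phi>)) = \<top>\<^bsub>B\<^esub>"
    note top = bv_model.val_Neg_Ex_topD[OF m(1) sub_formulas[OF assms(1) \<psi>] assignment_closed[OF m(1) assms(2)] m(2) const_val_reassign[OF m(1) a']]
    show "\<exists>\<theta>. \<theta> = Neg \<phi> \<and> val B M (\<lambda>x. const_val M (a' x)) \<theta> \<noteq> \<bottom>\<^bsub>B\<^esub>"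
      using bv_model_top_nonbot[OF m(1) top] by blast
  qed
  then show ?thesis by simp
qed

lemma step_Ex:
  assumes "Ex V \<phi> \<in> subformulas \<psi>" "a ` fv (Ex V \<phi>) \<subseteq> K" "inst a (Ex V \<phi>) \<in> p"
  shows "\<exists>a'. (\<forall>x. x \<notin> V \<longrightarrow> a' x = a x) \<and> a' ` V \<subseteq> K \<and> insert (inst a' \<phi>) p \<in> conds"
proof -
  have "\<exists>\<theta> a'. \<theta> = \<phi> \<and> (\<forall>x. x \<notin> V \<longrightarrow> a' x = a x) \<and> a' ` V \<subseteq> K \<and> insert (inst a' \<theta>) p \<in> conds"
  proof (rule cond_step[OF p \<psi> assms(3)])
    show "\<theta> \<in> subformulas \<psi> \<and> a ` (fv \<theta> - V) \<subseteq> K" if "\<theta> = \<phi>" for \<theta>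
      using that subformulas.Ex[OF assms(1)] assms(2) by auto
    \<comment> \<open>The formation rule for quantifiers provides the bound that leaves room for
      fresh witnesses.\<close>
    show "|V| <o |C|"
      using sub_formulas[OF assms(1) \<psi>] by (auto elim: formulas_ExE)
  next
    fix B :: "('r, 'c, 'v) univ gorder" and M :: "('r, 'c, ('r, 'c, 'v) univ, ('r, 'c, 'v) univ) bvm"
    assume m: "bv_model LC B M" "val B M (\<lambda>x. const_val M (a x)) (Ex V \<phi>) = \<top>\<^bsub>B\<^esub>"
    note top = bv_model.val_Ex_topD[OF m(1) sub_formulas[OF assms(1) \<psi>] assignment_closed[OF m(1) assms(2)] m(2)]
    show "\<exists>\<theta> \<mu>. \<theta> = \<phi> \<and> \<mu> \<in> reassign M V (\<lambda>x. const_val M (a x)) \<and> val B M \<mu> \<theta> \<noteq> \<bottom>\<^bsub>B\<^esub>"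
      using top by blast
  qed
  then show ?thesis by simp
qed

lemma step_Neg_All:
  assumes "Neg (All V \<phi>) \<in> subformulas \<psi>" "a ` fv (All V \<phi>) \<subseteq> K" "inst a (Neg (All V \<phi>)) \<in> p"
  shows "\<exists>a'. (\<forall>x. x \<notin> V \<longrightarrow> a' x = a x) \<and> a' ` V \<subseteq> K \<and> insert (inst a' (Neg \<phi>)) p \<in> conds"
proof -
  have "\<exists>\<theta> a'. \<theta> = Neg \<phi> \<and> (\<forall>x. x \<notin> V \<longrightarrow> a' x = a x) \<and> a' ` V \<subseteq> K \<and> insert (inst a' \<theta>) p \<in> conds"
  proof (rule cond_step[OF p \<psi> assms(3)])
    show "\<theta> \<in> subformulas \<psi> \<and> a ` (fv \<theta> - V) \<subseteq> K" if "\<theta> = Neg \<phi>" for \<theta>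
      using that subformulas.Neg_All[OF assms(1)] assms(2) by auto
    show "|V| <o |C|"
      using sub_formulas[OF assms(1) \<psi>] by (auto elim!: formulas_NegE formulas_AllE)
  next
    fix B :: "('r, 'c, 'v) univ gorder" and M :: "('r, 'c, ('r, 'c, 'v) univ, ('r, 'c, 'v) univ) bvm"
    assume m: "bv_model LC B M" "val B M (\<lambda>x. const_val M (a x)) (Neg (All V \<phi>)) = \<top>\<^bsub>B\<^esub>"
    note top = bv_model.val_Neg_All_topD[OF m(1) sub_formulas[OF assms(1) \<psi>] assignment_closed[OF m(1) assms(2)] m(2)]
    show "\<exists>\<theta> \<mu>. \<theta> = Neg \<phi> \<and> \<mu> \<in> reassign M V (\<lambda>x. const_val M (a x)) \<and> val B M \<mu> \<theta> \<noteq> \<bottom>\<^bsub>B\<^esub>"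
      using top by blast
  qed
  then show ?thesis by simp
qed

text \<open>A model of \<open>p\<close> would give \<phi> and \<open>Neg \<phi>\<close> the value
  \<top>, hence \<top> = \<bottom>. This is the consistency clause for atomic sentences, with
  entailment in place of membership.\<close>

lemma no_contradiction: "Neg \<phi> \<in> p \<Longrightarrow> \<not> entails LC p \<phi>"
proof
  assume "Neg \<phi> \<in> p" "entails LC p \<phi>"
  obtain J and B :: "('r, 'c, 'v) univ gorder"
    and M :: "('r, 'c, ('r, 'c, 'v) univ, ('r, 'c, 'v) univ) bvm" and \<nu>
    where J: "satisfies LC B M \<nu> (p \<union> J)"
    using cond_model[OF p \<psi>] .
  then have "satisfies LC B M \<nu> p"
    by (rule satisfies_mono) simp
  moreover interpret bv_model LC B M
    using J by (simp add: satisfies_def)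
  have "val B M \<nu> \<phi> = \<top>\<^bsub>B\<^esub>"
    using entailsD[OF \<open>entails LC p \<phi>\<close>] calculation by blast
  ultimately show False
    using \<open>Neg \<phi> \<in> p\<close> nontrivial complement_top unfolding satisfies_def by (metis val.simps(3))
qed

end

end

section \<open>Truth in the generic model\<close>

context forcing
begin

abbreviation gval :: "('v \<Rightarrow> 'c) \<Rightarrow> ('r, 'c, 'v) fm \<Rightarrow> ('r, 'c, 'v) univ" where
  "gval a \<phi> \<equiv> val (regular_opens conds) generic (\<lambda>x. emb (a x)) \<phi>"

lemma gval_closed:
  assumes "\<phi> \<in> formulas L |C|" "a ` fv \<phi> \<subseteq> K"
  shows "gval a \<phi> \<in> carrier (regular_opens conds)"
  using assms by (intro generic.val_closed[OF formulas_expand]) auto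

lemma gval_upward:
  assumes "\<phi> \<in> formulas L |C|" "a ` fv \<phi> \<subseteq> K" "p \<in> gval a \<phi>" "q \<in> conds" "p \<subseteq> q"
  shows "q \<in> gval a \<phi>"
  by (rule regular_openD(3)[OF gval_closed[OF assms(1,2)] assms(3-5)])

text \<open>Values are regular, so it is enough to find, above each extension of \<open>p\<close>, a
  condition in the value. Adding a component to a condition yields membership only in this indirect
  way.\<close>

lemma gval_dense:
  assumes "\<phi> \<in> formulas L |C|" "a ` fv \<phi> \<subseteq> K" "p \<in> conds"
    and "\<And>q. q \<in> conds \<Longrightarrow> p \<subseteq> q \<Longrightarrow> \<exists>r\<in>conds. q \<subseteq> r \<and> r \<in> gval a \<phi>"
  shows "p \<in> gval a \<phi>"
proof -
  have "p \<in> avoids conds (avoids conds (gval a \<phi>))"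
    using assms(3,4) by (simp add: mem_avoids_avoids)
  then show ?thesis
    using regular_openD(2)[OF gval_closed[OF assms(1,2)]] by simp
qed

lemma mem_avoidsI:
  assumes "p \<in> conds" "\<And>q. q \<in> conds \<Longrightarrow> p \<subseteq> q \<Longrightarrow> q \<in> U \<Longrightarrow> False"
  shows "p \<in> avoids conds U"
  using assms by (auto simp: avoids_def)

lemma mem_avoidsD: "p \<in> avoids conds U \<Longrightarrow> p \<in> U \<Longrightarrow> False"
  by (auto simp: avoids_def)

lemma gval_Neg:
  assumes "\<phi> \<in> formulas L |C|" "a ` fv \<phi> \<subseteq> K"
  shows "gval a (Neg \<phi>) = avoids conds (gval a \<phi>)"
  using regular_opens_complement[OF gval_closed[OF assms] conds_nonempty] by simp

lemma gval_image_closed: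
  assumes "\<And>i. i \<in> I \<Longrightarrow> f i \<in> formulas L |C|" "a ` (\<Union>i\<in>I. fv (f i)) \<subseteq> K"
  shows "(\<lambda>i. gval a (f i)) ` I \<subseteq> carrier (regular_opens conds)"
proof (rule image_subsetI)
  fix i assume "i \<in> I"
  then show "gval a (f i) \<in> carrier (regular_opens conds)"
    using assms by (intro gval_closed) (auto simp: image_subset_iff)
qed

lemma gval_Conj:
  assumes "\<And>i. i \<in> I \<Longrightarrow> f i \<in> formulas L |C|" "a ` (\<Union>i\<in>I. fv (f i)) \<subseteq> K"
  shows "p \<in> gval a (Conj I f) \<longleftrightarrow> p \<in> conds \<and> (\<forall>i\<in>I. p \<in> gval a (f i))"
  using regular_opens_inf[OF gval_image_closed[OF assms]] by simp

lemma gval_Disj: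
  assumes "\<And>i. i \<in> I \<Longrightarrow> f i \<in> formulas L |C|" "a ` (\<Union>i\<in>I. fv (f i)) \<subseteq> K"
  shows "p \<in> gval a (Disj I f) \<longleftrightarrow>
    p \<in> conds \<and> (\<forall>q\<in>conds. p \<subseteq> q \<longrightarrow> (\<exists>r\<in>conds. q \<subseteq> r \<and> (\<exists>i\<in>I. r \<in> gval a (f i))))"
  using regular_opens_sup[OF gval_image_closed[OF assms]] by (simp add: mem_avoids_avoids)

text \<open>All points of \<open>generic\<close> are named by constants of \<open>K\<close>, so
  quantifiers range over constants. Off \<open>V\<close> the assignment is copied from
  \<open>a\<close>, which need not take values in \<open>K\<close> there.\<close>

lemma reassign_generic:
  fixes a :: "'v \<Rightarrow> 'c"
  shows
  "reassign generic V (\<lambda>x. emb (a x)) = (\<lambda>a' x. emb (a' x)) ` {a'. (\<forall>x. x \<notin> V \<longrightarrow> a' x = a x) \<and> a' ` V \<subseteq> K}"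
proof (intro equalityI subsetI)
  fix \<mu> assume \<mu>: "\<mu> \<in> reassign generic V (\<lambda>x. emb (a x))"
  have "\<exists>c. \<mu> x = emb c \<and> (x \<notin> V \<longrightarrow> c = a x) \<and> (x \<in> V \<longrightarrow> c \<in> K)" for x
  proof (cases "x \<in> V")
    case True
    then have "\<mu> x \<in> emb ` K"
      using \<mu> by (auto simp: reassign_def)
    with True show ?thesis by blast
  next
    case False
    with reassign_outside[OF \<mu>] show ?thesis by blast
  qed
  then obtain a' where "\<forall>x. \<mu> x = emb (a' x) \<and> (x \<notin> V \<longrightarrow> a' x = a x) \<and> (x \<in> V \<longrightarrow> a' x \<in> K)"
    by metis
  then show "\<mu> \<in> (\<lambda>a' x. emb (a' x)) ` {a'. (\<forall>x. x \<notin> V \<longrightarrow> a' x = a x) \<and> a' ` V \<subseteq> K}"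
    by (intro image_eqI[of _ _ a']) auto
next
  fix \<mu> :: "'v \<Rightarrow> ('r, 'c, 'v) univ"
  assume "\<mu> \<in> (\<lambda>a' x. emb (a' x)) ` {a'. (\<forall>x. x \<notin> V \<longrightarrow> a' x = a x) \<and> a' ` V \<subseteq> K}"
  then obtain a' where a': "\<mu> = (\<lambda>x. emb (a' x))" "\<And>x. x \<notin> V \<Longrightarrow> a' x = a x" "a' ` V \<subseteq> K"
    by blast
  have "\<mu> = override_on (\<lambda>x. emb (a x)) (\<lambda>x. emb (a' x)) V" "\<forall>x\<in>V. emb (a' x) \<in> emb ` K"
    using a' by (auto simp: override_on_def fun_eq_iff)
  then show "\<mu> \<in> reassign generic V (\<lambda>x. emb (a x))"
    by (auto simp: reassign_def)
qed

lemma reassigned_closed: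
  assumes "a ` (fv \<phi> - V) \<subseteq> K" "\<And>x. x \<notin> V \<Longrightarrow> a' x = a x" "a' ` V \<subseteq> K"
  shows "a' ` fv \<phi> \<subseteq> K"
proof (rule image_subsetI)
  fix x assume "x \<in> fv \<phi>"
  then show "a' x \<in> K"
    using assms by (cases "x \<in> V") auto
qed

lemma gval_reassign_closed:
  fixes a :: "'v \<Rightarrow> 'c"
  assumes "\<phi> \<in> formulas L |C|" "a ` (fv \<phi> - V) \<subseteq> K"
  shows "(\<lambda>\<mu>. val (regular_opens conds) generic \<mu> \<phi>) ` reassign generic V (\<lambda>x. emb (a x))
    \<subseteq> carrier (regular_opens conds)"
  unfolding reassign_generic image_image
proof (rule image_subsetI)
  fix a' :: "'v \<Rightarrow> 'c"
  assume "a' \<in> {a'. (\<forall>x. x \<notin> V \<longrightarrow> a' x = a x) \<and> a' ` V \<subseteq> K}"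
  then show "gval a' \<phi> \<in> carrier (regular_opens conds)"
    using reassigned_closed[OF assms(2), of a'] by (intro gval_closed assms(1)) simp
qed

lemma gval_All:
  assumes "\<phi> \<in> formulas L |C|" "a ` (fv \<phi> - V) \<subseteq> K"
  shows "p \<in> gval a (All V \<phi>) \<longleftrightarrow>
    p \<in> conds \<and> (\<forall>a'. (\<forall>x. x \<notin> V \<longrightarrow> a' x = a x) \<and> a' ` V \<subseteq> K \<longrightarrow> p \<in> gval a' \<phi>)"
  unfolding val.simps regular_opens_inf[OF gval_reassign_closed[OF assms]]
  unfolding reassign_generic image_image by (simp only: Int_iff INT_iff mem_Collect_eq Ball_def)

lemma gval_Ex:
  assumes "\<phi> \<in> formulas L |C|" "a ` (fv \<phi> - V) \<subseteq> K"
  shows "p \<in> gval a (Ex V \<phi>) \<longleftrightarrow> p \<in> conds \<and> (\<forall>q\<in>conds. p \<subseteq> q \<longrightarrow>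
    (\<exists>r\<in>conds. q \<subseteq> r \<and> (\<exists>a'. (\<forall>x. x \<notin> V \<longrightarrow> a' x = a x) \<and> a' ` V \<subseteq> K \<and> r \<in> gval a' \<phi>)))"
proof -
  have "gval a (Ex V \<phi>) = avoids conds (avoids conds
      (\<Union>((\<lambda>\<mu>. val (regular_opens conds) generic \<mu> \<phi>) ` reassign generic V (\<lambda>x. emb (a x)))))"
    unfolding val.simps by (rule regular_opens_sup[OF gval_reassign_closed[OF assms]])
  moreover have "r \<in> \<Union>((\<lambda>\<mu>. val (regular_opens conds) generic \<mu> \<phi>) ` reassign generic V (\<lambda>x. emb (a x))) \<longleftrightarrow>
      (\<exists>a'. (\<forall>x. x \<notin> V \<longrightarrow> a' x = a x) \<and> a' ` V \<subseteq> K \<and> r \<in> gval a' \<phi>)" for r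
    unfolding reassign_generic image_image by (simp only: UN_iff mem_Collect_eq Bex_def conj_assoc)
  ultimately show ?thesis
    by (simp only: mem_avoids_avoids)
qed

lemma tsubst_eq_proj: "tsubst (\<lambda>x. Const (a x)) = (\<lambda>t. Const (proj (tval generic (\<lambda>x. emb (a x)) t)))"
proof
  fix t show "tsubst (\<lambda>x. Const (a x)) t = Const (proj (tval generic (\<lambda>x. emb (a x)) t))"
    by (cases t) simp_all
qed

lemma gval_atomic:
  "gval a (Eq t u) = force (inst a (Eq t u))" "gval a (Rel R ts) = force (inst a (Rel R ts))"
  by (simp_all add: tsubst_eq_proj comp_def)

lemma truth_atomic:
  assumes "gval a \<phi> = force (inst a \<phi>)" "p \<in> conds" "\<psi> \<in> T"
  shows "inst a \<phi> \<in> p \<Longrightarrow> p \<in> gval a \<phi>" "inst a (Neg \<phi>) \<in> p \<Longrightarrow> p \<in> avoids conds (gval a \<phi>)"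
proof -
  show "inst a \<phi> \<in> p \<Longrightarrow> p \<in> gval a \<phi>"
    unfolding assms(1) by (rule entails_force[OF assms(2) entails_member])
  show "p \<in> avoids conds (gval a \<phi>)" if "inst a (Neg \<phi>) \<in> p"
    unfolding assms(1)
  proof (rule mem_avoidsI[OF assms(2)])
    fix q assume "q \<in> conds" "p \<subseteq> q" "q \<in> force (inst a \<phi>)"
    then obtain r where r: "r \<in> conds" "q \<subseteq> r" "entails LC r (inst a \<phi>)"
      unfolding mem_force by blast
    \<comment> \<open>Members persist in stronger conditions, so the negation meets the entailment
      in the same condition \<open>r\<close>.\<close>
    have "Neg (inst a \<phi>) \<in> r"
      using that \<open>p \<subseteq> q\<close> r(2) by auto
    then show False
      using no_contradiction[OF r(1) assms(3)] r(3) by blast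
  qed
qed

text \<open>The statement for \<open>Neg \<phi>\<close> is carried along because \<open>subformulas\<close> moves negations inside.\<close>

lemma truth:
  assumes "\<phi> \<in> formulas L |C|" "\<psi> \<in> T" "p \<in> conds" "a ` fv \<phi> \<subseteq> K"
  shows "(\<phi> \<in> subformulas \<psi> \<longrightarrow> inst a \<phi> \<in> p \<longrightarrow> p \<in> gval a \<phi>) \<and>
    (Neg \<phi> \<in> subformulas \<psi> \<longrightarrow> inst a (Neg \<phi>) \<in> p \<longrightarrow> p \<in> avoids conds (gval a \<phi>))"
  using assms(1,3,4)
proof (induction arbitrary: a p)
  case (Eq t u)
  show ?case
    using truth_atomic[OF gval_atomic(1) \<open>p \<in> conds\<close> \<open>\<psi> \<in> T\<close>] by blast
next
  case (Rel R ts)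
  show ?case
    using truth_atomic[OF gval_atomic(2) \<open>p \<in> conds\<close> \<open>\<psi> \<in> T\<close>] by blast
next
  case (Neg \<phi>)
  have K: "a ` fv \<phi> \<subseteq> K"
    using Neg.prems by simp
  note gN = gval_Neg[OF Neg.hyps K]
  show ?case
  proof (intro conjI impI)
    \<comment> \<open>This is the second half of the induction hypothesis for \<phi>.\<close>
    show "p \<in> gval a (Neg \<phi>)" if "Neg \<phi> \<in> subformulas \<psi>" "inst a (Neg \<phi>) \<in> p"
      unfolding gN using Neg.IH[OF Neg.prems(1) K] that by blast
    assume sub: "Neg (Neg \<phi>) \<in> subformulas \<psi>" and mem: "inst a (Neg (Neg \<phi>)) \<in> p"
    have "p \<in> gval a \<phi>"
    proof (rule gval_dense[OF Neg.hyps K Neg.prems(1)])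
      fix q assume q: "q \<in> conds" "p \<subseteq> q"
      then have "insert (inst a \<phi>) q \<in> conds"
        using mem by (intro step_Neg_Neg[OF q(1) \<open>\<psi> \<in> T\<close> sub K]) auto
      then have "insert (inst a \<phi>) q \<in> gval a \<phi>"
        using Neg.IH[OF _ K] subformulas.Neg[OF subformulas.Neg[OF sub]] by blast
      then show "\<exists>r\<in>conds. q \<subseteq> r \<and> r \<in> gval a \<phi>"
        using \<open>insert (inst a \<phi>) q \<in> conds\<close> by blast
    qed
    \<comment> \<open>Regularity of the value of \<phi> absorbs the double negation.\<close>
    then show "p \<in> avoids conds (gval a (Neg \<phi>))"
      unfolding gN using regular_openD(2)[OF gval_closed[OF Neg.hyps K]] by simp
  qed
next
  case (Conj I f)
  have K: "a ` (\<Union>i\<in>I. fv (f i)) \<subseteq> K"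
    using Conj.prems by simp
  then have Ki: "a ` fv (f i) \<subseteq> K" if "i \<in> I" for i
    using that by fast
  have gC: "q \<in> gval a (Conj I f) \<longleftrightarrow> q \<in> conds \<and> (\<forall>i\<in>I. q \<in> gval a (f i))" for q
    by (rule gval_Conj[OF Conj.hyps(2) K])
  show ?case
  proof (intro conjI impI)
    assume sub: "Conj I f \<in> subformulas \<psi>" and mem: "inst a (Conj I f) \<in> p"
    \<comment> \<open>The conjuncts are treated separately, each by its own density argument, so no
      condition has to contain infinitely many of them.\<close>
    have "p \<in> gval a (f i)" if i: "i \<in> I" for i
    proof (rule gval_dense[OF Conj.hyps(2)[OF i] Ki[OF i] Conj.prems(1)])
      fix q assume q: "q \<in> conds" "p \<subseteq> q"
      then have r: "insert (inst a (f i)) q \<in> conds"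
        using mem by (intro step_Conj[OF q(1) \<open>\<psi> \<in> T\<close> sub Conj.prems(2) _ i]) auto
      then have "insert (inst a (f i)) q \<in> gval a (f i)"
        using Conj.IH[OF i r Ki[OF i]] subformulas.Conj[OF sub i] by blast
      then show "\<exists>r\<in>conds. q \<subseteq> r \<and> r \<in> gval a (f i)"
        using r by blast
    qed
    then show "p \<in> gval a (Conj I f)"
      unfolding gC using Conj.prems(1) by blast
  next
    assume sub: "Neg (Conj I f) \<in> subformulas \<psi>" and mem: "inst a (Neg (Conj I f)) \<in> p"
    show "p \<in> avoids conds (gval a (Conj I f))"
    proof (rule mem_avoidsI[OF Conj.prems(1)])
      fix q assume q: "q \<in> conds" "p \<subseteq> q" "q \<in> gval a (Conj I f)"
      \<comment> \<open>Some negated component can be added to \<open>q\<close>, although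
        \<open>q\<close> already forces every component.\<close>
      obtain i where i: "i \<in> I" and r: "insert (inst a (Neg (f i))) q \<in> conds"
        using step_Neg_Conj[OF q(1) \<open>\<psi> \<in> T\<close> sub Conj.prems(2)] mem q(2) by blast
      have "insert (inst a (Neg (f i))) q \<in> avoids conds (gval a (f i))"
        using Conj.IH[OF i r Ki[OF i]] subformulas.Neg_Conj[OF sub i] by blast
      moreover have "insert (inst a (Neg (f i))) q \<in> gval a (f i)"
        using q(3) i unfolding gC by (intro gval_upward[OF Conj.hyps(2)[OF i] Ki[OF i] _ r, of q]) auto
      ultimately show False
        by (rule mem_avoidsD)
    qed
  qed
next
  case (Disj I f)
  have K: "a ` (\<Union>i\<in>I. fv (f i)) \<subseteq> K"
    using Disj.prems by simp
  then have Ki: "a ` fv (f i) \<subseteq> K" if "i \<in> I" for i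
    using that by fast
  have gD: "q \<in> gval a (Disj I f) \<longleftrightarrow> q \<in> conds \<and>
      (\<forall>q'\<in>conds. q \<subseteq> q' \<longrightarrow> (\<exists>r\<in>conds. q' \<subseteq> r \<and> (\<exists>i\<in>I. r \<in> gval a (f i))))" for q
    by (rule gval_Disj[OF Disj.hyps(2) K])
  show ?case
  proof (intro conjI impI)
    assume sub: "Disj I f \<in> subformulas \<psi>" and mem: "inst a (Disj I f) \<in> p"
    show "p \<in> gval a (Disj I f)"
      unfolding gD
    proof (intro conjI ballI impI Disj.prems(1))
      fix q assume q: "q \<in> conds" "p \<subseteq> q"
      obtain i where i: "i \<in> I" and r: "insert (inst a (f i)) q \<in> conds"
        using step_Disj[OF q(1) \<open>\<psi> \<in> T\<close> sub Disj.prems(2)] mem q(2) by blast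
      have "insert (inst a (f i)) q \<in> gval a (f i)"
        using Disj.IH[OF i r Ki[OF i]] subformulas.Disj[OF sub i] by blast
      then show "\<exists>r\<in>conds. q \<subseteq> r \<and> (\<exists>i\<in>I. r \<in> gval a (f i))"
        using r i by blast
    qed
  next
    assume sub: "Neg (Disj I f) \<in> subformulas \<psi>" and mem: "inst a (Neg (Disj I f)) \<in> p"
    show "p \<in> avoids conds (gval a (Disj I f))"
    proof (rule mem_avoidsI[OF Disj.prems(1)])
      fix q assume q: "q \<in> conds" "p \<subseteq> q" "q \<in> gval a (Disj I f)"
      \<comment> \<open>The index is found first: only at some \<open>r\<close> above
        \<open>q\<close> is a particular disjunct forced, and then its negation is added to
        \<open>r\<close>.\<close>
      then obtain r i where r: "r \<in> conds" "q \<subseteq> r" and i: "i \<in> I" "r \<in> gval a (f i)"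
        unfolding gD by blast
      have t: "insert (inst a (Neg (f i))) r \<in> conds"
        using mem q(2) r(2) by (intro step_Neg_Disj[OF r(1) \<open>\<psi> \<in> T\<close> sub Disj.prems(2) _ i(1)]) auto
      have "insert (inst a (Neg (f i))) r \<in> avoids conds (gval a (f i))"
        using Disj.IH[OF i(1) t Ki[OF i(1)]] subformulas.Neg_Disj[OF sub i(1)] by blast
      moreover have "insert (inst a (Neg (f i))) r \<in> gval a (f i)"
        by (rule gval_upward[OF Disj.hyps(2)[OF i(1)] Ki[OF i(1)] i(2) t]) auto
      ultimately show False
        by (rule mem_avoidsD)
    qed
  qed
next
  case (All V \<phi>)
  have K: "a ` (fv \<phi> - V) \<subseteq> K"
    using All.prems by simp
  note gA = gval_All[OF All.hyps(2) K]
  show ?case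
  proof (intro conjI impI)
    assume sub: "All V \<phi> \<in> subformulas \<psi>" and mem: "inst a (All V \<phi>) \<in> p"
    show "p \<in> gval a (All V \<phi>)"
      unfolding gA
    proof (intro conjI allI impI All.prems(1))
      fix a' assume "(\<forall>x. x \<notin> V \<longrightarrow> a' x = a x) \<and> a' ` V \<subseteq> K"
      then have a': "\<And>x. x \<notin> V \<Longrightarrow> a' x = a x" "a' ` V \<subseteq> K"
        by simp_all
      have K': "a' ` fv \<phi> \<subseteq> K"
        by (rule reassigned_closed[OF K a'])
      show "p \<in> gval a' \<phi>"
      proof (rule gval_dense[OF All.hyps(2) K' All.prems(1)])
        fix q assume q: "q \<in> conds" "p \<subseteq> q"
        then have r: "insert (inst a' \<phi>) q \<in> conds"
          using mem by (intro step_All[OF q(1) \<open>\<psi> \<in> T\<close> sub All.prems(2) _ a']) auto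
        then have "insert (inst a' \<phi>) q \<in> gval a' \<phi>"
          using All.IH[OF r K'] subformulas.All[OF sub] by blast
        then show "\<exists>r\<in>conds. q \<subseteq> r \<and> r \<in> gval a' \<phi>"
          using r by blast
      qed
    qed
  next
    assume sub: "Neg (All V \<phi>) \<in> subformulas \<psi>" and mem: "inst a (Neg (All V \<phi>)) \<in> p"
    show "p \<in> avoids conds (gval a (All V \<phi>))"
    proof (rule mem_avoidsI[OF All.prems(1)])
      fix q assume q: "q \<in> conds" "p \<subseteq> q" "q \<in> gval a (All V \<phi>)"
      obtain a' where a': "\<And>x. x \<notin> V \<Longrightarrow> a' x = a x" "a' ` V \<subseteq> K"
        and r: "insert (inst a' (Neg \<phi>)) q \<in> conds"
        using step_Neg_All[OF q(1) \<open>\<psi> \<in> T\<close> sub All.prems(2)] mem q(2) by blast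
      have K': "a' ` fv \<phi> \<subseteq> K"
        by (rule reassigned_closed[OF K a'])
      have "insert (inst a' (Neg \<phi>)) q \<in> avoids conds (gval a' \<phi>)"
        using All.IH[OF r K'] subformulas.Neg_All[OF sub] by blast
      moreover have "q \<in> gval a' \<phi>"
        \<comment> \<open>The universal formula forced by \<open>q\<close> is used at the witnesses
          \<open>a'\<close> that came with the added negated instance.\<close>
        using q(3) a' unfolding gA by blast
      then have "insert (inst a' (Neg \<phi>)) q \<in> gval a' \<phi>"
        by (rule gval_upward[OF All.hyps(2) K' _ r]) auto
      ultimately show False
        by (rule mem_avoidsD)
    qed
  qed
next
  case (Ex V \<phi>)
  have K: "a ` (fv \<phi> - V) \<subseteq> K"
    using Ex.prems by simp
  note gE = gval_Ex[OF Ex.hyps(2) K]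
  show ?case
  proof (intro conjI impI)
    assume sub: "Ex V \<phi> \<in> subformulas \<psi>" and mem: "inst a (Ex V \<phi>) \<in> p"
    show "p \<in> gval a (Ex V \<phi>)"
      unfolding gE
    proof (intro conjI ballI impI Ex.prems(1))
      fix q assume q: "q \<in> conds" "p \<subseteq> q"
      obtain a' where a': "\<And>x. x \<notin> V \<Longrightarrow> a' x = a x" "a' ` V \<subseteq> K"
        and r: "insert (inst a' \<phi>) q \<in> conds"
        using step_Ex[OF q(1) \<open>\<psi> \<in> T\<close> sub Ex.prems(2)] mem q(2) by blast
      have K': "a' ` fv \<phi> \<subseteq> K"
        by (rule reassigned_closed[OF K a'])
      have "insert (inst a' \<phi>) q \<in> gval a' \<phi>"
        using Ex.IH[OF r K'] subformulas.Ex[OF sub] by blast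
      then show "\<exists>r\<in>conds. q \<subseteq> r \<and> (\<exists>a'. (\<forall>x. x \<notin> V \<longrightarrow> a' x = a x) \<and> a' ` V \<subseteq> K \<and> r \<in> gval a' \<phi>)"
        using r a' by (intro bexI[OF _ r] conjI exI[of _ a']) auto
    qed
  next
    assume sub: "Neg (Ex V \<phi>) \<in> subformulas \<psi>" and mem: "inst a (Neg (Ex V \<phi>)) \<in> p"
    show "p \<in> avoids conds (gval a (Ex V \<phi>))"
    proof (rule mem_avoidsI[OF Ex.prems(1)])
      fix q assume q: "q \<in> conds" "p \<subseteq> q" "q \<in> gval a (Ex V \<phi>)"
      then have "\<exists>r\<in>conds. q \<subseteq> r \<and> (\<exists>a'. (\<forall>x. x \<notin> V \<longrightarrow> a' x = a x) \<and> a' ` V \<subseteq> K \<and> r \<in> gval a' \<phi>)"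
        unfolding gE by blast
      then obtain r a' where r: "r \<in> conds" "q \<subseteq> r" and a': "\<And>x. x \<notin> V \<Longrightarrow> a' x = a x" "a' ` V \<subseteq> K"
        and rv: "r \<in> gval a' \<phi>"
        by (elim bexE conjE exE) blast
      have K': "a' ` fv \<phi> \<subseteq> K"
        by (rule reassigned_closed[OF K a'])
      have t: "insert (inst a' (Neg \<phi>)) r \<in> conds"
        using mem q(2) r(2) by (intro step_Neg_Ex[OF r(1) \<open>\<psi> \<in> T\<close> sub Ex.prems(2) _ a']) auto
      have "insert (inst a' (Neg \<phi>)) r \<in> avoids conds (gval a' \<phi>)"
        using Ex.IH[OF t K'] subformulas.Neg_Ex[OF sub] by blast
      moreover have "insert (inst a' (Neg \<phi>)) r \<in> gval a' \<phi>"
        by (rule gval_upward[OF Ex.hyps(2) K' rv t]) auto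
      ultimately show False
        by (rule mem_avoidsD)
    qed
  qed
qed

text \<open>A sentence of \<open>T\<close> need not belong to a given condition, but it has value
  \<top> in the models supplied by \<open>cond_model\<close>. The conditions containing an instance
  of it are therefore dense.\<close>

lemma forces_theory:
  assumes "\<psi> \<in> T"
  shows "conds \<subseteq> gval a \<psi>"
proof
  have \<psi>: "\<psi> \<in> formulas L |C|" "fv \<psi> = {}"
    using assms by (simp_all add: T_formulas fv_T)
  then have K: "a ` fv \<psi> \<subseteq> K"
    by simp
  fix p assume p: "p \<in> conds"
  show "p \<in> gval a \<psi>"
  proof (rule gval_dense[OF \<psi>(1) K p])
    fix q assume q: "q \<in> conds"
    obtain J and B :: "('r, 'c, 'v) univ gorder"
      and M :: "('r, 'c, ('r, 'c, 'v) univ, ('r, 'c, 'v) univ) bvm" and \<nu>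
      where J: "finite J" "\<psi> \<in> J" "J \<subseteq> T" "q \<subseteq> (\<Union>\<psi>\<in>J. subsentences L C \<psi>)"
        and sat: "satisfies LC B M \<nu> (q \<union> J)"
      using cond_model[OF q assms] .
    \<comment> \<open>Instance and sentence are compared by value: \<open>inst a \<psi>\<close> can
      differ from \<psi>, because \<open>subst\<close> also acts on the irrelevant members of a
      family, those outside its index set.\<close>
    have "val B M (\<lambda>x. const_val M (a x)) \<psi> = val B M \<nu> \<psi>"
      by (rule val_cong_assignment[OF \<psi>(1)]) (simp add: \<psi>(2))
    also have "\<dots> = \<top>\<^bsub>B\<^esub>"
      using sat J(2) by (simp add: satisfies_def)
    finally have "val B M (\<lambda>x. const_val M (a x)) \<psi> \<noteq> \<bottom>\<^bsub>B\<^esub>"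
      by (rule bv_model_top_nonbot[of B M, rotated]) (use sat in \<open>simp add: satisfies_def\<close>)
    then have "\<exists>a'. (\<forall>x. x \<notin> {} \<longrightarrow> a' x = a x) \<and> a' ` {} \<subseteq> K \<and> insert (inst a' \<psi>) q \<in> conds"
      using infinite_C K by (intro cond_extend[OF q J sat subformulas.self]) (simp_all add: finite_card_of_less)
    then have r: "insert (inst a \<psi>) q \<in> conds"
      by (auto simp: fun_eq_iff[symmetric])
    then have "insert (inst a \<psi>) q \<in> gval a \<psi>"
      using truth[OF \<psi>(1) assms r K] subformulas.self by blast
    with r show "\<exists>r\<in>conds. q \<subseteq> r \<and> r \<in> gval a \<psi>"
      by blast
  qed
qed

lemma consistent_with_theory: "boolean_consistent LC (s0 \<union> T)"
proof -
  obtain c where c: "c \<in> C"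
    using infinite_C by fastforce
  \<comment> \<open>Only sentences are evaluated, so any assignment with values among the points
    will do.\<close>
  let ?\<nu> = "\<lambda>_ :: 'v. emb c"
  have top: "val (regular_opens conds) generic ?\<nu> \<chi> = conds" if \<chi>: "\<chi> \<in> s0 \<union> T" for \<chi>
  proof
    obtain \<phi> a where "val (regular_opens conds) generic ?\<nu> \<chi> = gval a \<phi>" "\<phi> \<in> formulas L |C|" "a ` fv \<phi> \<subseteq> K"
      "conds \<subseteq> gval a \<phi>"
    proof (cases "\<chi> \<in> T")
      case True
      then show ?thesis
        using that[of "\<lambda>_. c" \<chi>] c forces_theory[of \<chi> "\<lambda>_. c"] T_formulas by auto
    next
      case False
      with \<chi> have "\<chi> \<in> s0" by simp
      then obtain \<psi> where "\<psi> \<in> T" "\<chi> \<in> subsentences L C \<psi>"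
        using start(2) by blast
      then obtain a \<phi> where \<phi>: "\<chi> = inst a \<phi>" "\<phi> \<in> subformulas \<psi>" "a ` fv \<phi> \<subseteq> K"
        by (auto simp: subsentences_def)
      have f: "\<phi> \<in> formulas L |C|"
        by (rule subformulas_formulas[OF \<phi>(2) T_formulas[OF \<open>\<psi> \<in> T\<close>]])
      have "conds \<subseteq> gval a \<phi>"
      proof
        fix p assume p: "p \<in> conds"
        \<comment> \<open>All conditions contain \<open>s0\<close>, so the value is the full
          space.\<close>
        then have "inst a \<phi> \<in> p"
          using \<open>\<chi> \<in> s0\<close> \<phi>(1) by (auto simp: conds_def)
        then show "p \<in> gval a \<phi>"
          using truth[OF f \<open>\<psi> \<in> T\<close> p \<phi>(3)] \<phi>(2) by blast
      qed
      moreover have "val (regular_opens conds) generic ?\<nu> \<chi> = gval a \<phi>"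
        by (simp add: \<phi>(1) val_inst)
      ultimately show ?thesis
        using that[of a \<phi>] f \<phi>(3) by blast
    qed
    then show "conds \<subseteq> val (regular_opens conds) generic ?\<nu> \<chi>"
      "val (regular_opens conds) generic ?\<nu> \<chi> \<subseteq> conds"
      using regular_openD(1)[OF gval_closed[of \<phi> a]] by simp_all
  qed
  have "satisfies LC (regular_opens conds) generic ?\<nu> (s0 \<union> T)"
    unfolding satisfies_def regular_opens_top
    using top c generic.bv_model_axioms by auto
  then show ?thesis
    unfolding boolean_consistent_iff_satisfies by blast
qed

end

section \<open>Finite conservativity\<close>

lemma subformulas_Conj_component:
  assumes "\<phi> \<in> subformulas (f i)" "i \<in> I"
  shows "\<phi> \<in> subformulas (Conj I f)"
  using assms(1)
proof induction
  case self
  show ?case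
    by (rule subformulas.Conj[OF subformulas.self assms(2)])
qed (rule subformulas.intros(2-); assumption)+

text \<open>Even when \<open>big_conj s\<close> is a sentence, its instances form a range and not a
  singleton, since \<open>subst\<close> may change the family outside the index set. They are split
  off because only the remaining subsentences come from members of \<open>s\<close>.\<close>

lemma subsentences_big_conj:
  fixes s :: "('r, 'c, 'v) fm set"
  assumes "|s| <o |UNIV :: 'v set|"
  shows "subsentences L C (big_conj s) =
    range (\<lambda>a. inst a (big_conj s)) \<inter> subsentences L C (big_conj s) \<union> (\<Union>\<psi>\<in>s. subsentences L C \<psi>)"
proof -
  obtain I f where f: "big_conj s = Conj I f" "f ` I = s"
    using big_conj_cases[OF assms] .
  have "(\<Union>\<psi>\<in>s. subsentences L C \<psi>) \<subseteq> subsentences L C (big_conj s)"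
  proof (intro UN_least subsetI)
    fix \<psi> \<chi> assume "\<psi> \<in> s" and \<chi>: "\<chi> \<in> subsentences L C \<psi>"
    then obtain i where i: "i \<in> I" "\<psi> = f i"
      using f(2) by blast
    obtain a \<phi> where \<phi>: "\<chi> = inst a \<phi>" "\<phi> \<in> subformulas \<psi>" "\<forall>x\<in>fv \<phi>. a x \<in> constants L \<union> C"
      using \<chi> by (auto simp: subsentences_def)
    have "\<phi> \<in> subformulas (big_conj s)"
      unfolding f(1) using \<phi>(2) i by (intro subformulas_Conj_component[of _ f i]) simp_all
    with \<phi>(1,3) show "\<chi> \<in> subsentences L C (big_conj s)"
      unfolding subsentences_def by blast
  qed
  moreover have "\<chi> \<in> range (\<lambda>a. inst a (big_conj s)) \<union> (\<Union>\<psi>\<in>s. subsentences L C \<psi>)"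
    if "\<chi> \<in> subsentences L C (big_conj s)" for \<chi>
  proof -
    obtain a \<phi> where \<phi>: "\<chi> = inst a \<phi>" "\<phi> \<in> subformulas (Conj I f)" "\<forall>x\<in>fv \<phi>. a x \<in> constants L \<union> C"
      using \<open>\<chi> \<in> subsentences L C (big_conj s)\<close> unfolding subsentences_def f(1) by blast
    from subformulas_Conj[OF \<phi>(2)] show ?thesis
    proof
      assume "\<phi> = Conj I f"
      then have "\<chi> = inst a (big_conj s)"
        by (simp only: \<phi>(1) f(1))
      then show ?thesis
        by (intro UnI1 image_eqI[of _ _ a]) simp_all
    next
      assume "\<exists>i\<in>I. \<phi> \<in> subformulas (f i)"
      then obtain i where "i \<in> I" "\<phi> \<in> subformulas (f i)" ..
      then have "\<chi> \<in> subsentences L C (f i)" "f i \<in> s"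
        using \<phi>(1,3) f(2) unfolding subsentences_def by blast+
      then show ?thesis by blast
    qed
  qed
  ultimately show ?thesis by blast
qed

lemma satisfies_inst_big_conj:
  fixes s :: "('r, 'c, 'v) fm set"
  assumes "|s| <o |UNIV :: 'v set|" "s \<subseteq> sentences L lam" "satisfies (expand L C) B M \<nu> s"
  shows "val B M \<nu> (inst a (big_conj s)) = \<top>\<^bsub>B\<^esub>"
proof -
  obtain I f where f: "big_conj s = Conj I f" "f ` I = s"
    using big_conj_cases[OF assms(1)] .
  interpret bv_model "expand L C" B M
    using assms(3) by (simp add: satisfies_def)
  have "val B M (\<lambda>x. const_val M (a x)) (f i) = \<top>\<^bsub>B\<^esub>" if "i \<in> I" for i
  proof -
    have fi: "f i \<in> formulas L lam" "fv (f i) = {}" "val B M \<nu> (f i) = \<top>\<^bsub>B\<^esub>"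
      using that f(2) assms(2,3) by (auto simp: sentences_def satisfies_def)
    have "val B M (\<lambda>x. const_val M (a x)) (f i) = val B M \<nu> (f i)"
      by (rule val_cong_assignment[OF fi(1)]) (simp add: fi(2))
    then show ?thesis
      using fi(3) by simp
  qed
  then show ?thesis
    unfolding f(1) val_inst val.simps by (subst inf_eq_top_iff) auto
qed

lemma small_subset:
  fixes T :: "('r, 'c, 'v) fm set"
  assumes "s \<subseteq> T" "|T| <o |UNIV :: 'v set|"
  shows "|s| <o |UNIV :: 'v set|"
  using card_of_mono1[OF assms(1)] assms(2) by (rule ordLeq_ordLess_trans)

text \<open>Derivability is \<open>derives_big_conj\<close>, and consistency passes from the larger
  set to the smaller one by monotonicity. One implication remains of the definition, and both
  directions of the theorem work with it.\<close>

lemma conservative_strengthening_big_conj_iff: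
  fixes L :: "('r, 'c) signature" and t :: "('r, 'c, 'v) fm set"
  assumes "s \<subseteq> t" "t \<subseteq> sentences L lam" "|t| <o |UNIV :: 'v set|"
  shows "conservative_strengthening L C (big_conj t) (big_conj s) \<longleftrightarrow>
    (\<forall>p. finite p \<longrightarrow> p \<subseteq> subsentences L C (big_conj s) \<longrightarrow>
      boolean_consistent (expand L C) (p \<union> s) \<longrightarrow> boolean_consistent (expand L C) (p \<union> t))"
proof -
  have s: "|s| <o |UNIV :: 'v set|" "s \<subseteq> sentences L lam"
    using small_subset[OF assms(1,3)] assms(1,2) by simp_all
  have "boolean_consistent (expand L C) (p \<union> s)" if "boolean_consistent (expand L C) (p \<union> t)" for p
    using that by (rule boolean_consistent_mono) (use assms(1) in auto)
  then have "(boolean_consistent (expand L C) (p \<union> s) \<longleftrightarrow> boolean_consistent (expand L C) (p \<union> t)) \<longleftrightarrow>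
      (boolean_consistent (expand L C) (p \<union> s) \<longrightarrow> boolean_consistent (expand L C) (p \<union> t))" for p
    by iprover
  then show ?thesis
    unfolding conservative_strengthening_def boolean_consistent_big_conj[OF s]
      boolean_consistent_big_conj[OF assms(3,2)]
    by (simp only: derives_big_conj[OF assms(3,2,1)] simp_thms imp_conjL)
qed

lemma consistent_extension:
  fixes L :: "('r, 'c) signature" and T :: "('r, 'c, 'v) fm set"
  assumes C: "infinite C" "C \<inter> constants L = {}"
    and T: "T \<subseteq> sentences L |C|" "|T| <o |UNIV :: 'v set|"
    and fc: "finitely_conservative L C T"
    and s: "s \<noteq> {}" "finite s" "s \<subseteq> T"
    and p: "finite p" "p \<subseteq> subsentences L C (big_conj s)" "boolean_consistent (expand L C) (p \<union> s)"
  shows "boolean_consistent (expand L C) (p \<union> T)"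
proof -
  \<comment> \<open>Instances of \<open>big_conj s\<close> itself need not be subsentences of sentences in \<open>T\<close>, but they follow from \<open>s\<close>.\<close>
  define s0 where "s0 = p \<inter> (\<Union>\<psi>\<in>s. subsentences L C \<psi>)"
  have extension: "boolean_consistent (expand L C) (q \<union> J1)"
    if J: "J0 \<noteq> {}" "J0 \<subseteq> J1" "J1 \<subseteq> T" "finite J1"
      and q: "finite q" "q \<subseteq> (\<Union>\<psi>\<in>J0. subsentences L C \<psi>)" "boolean_consistent (expand L C) (q \<union> J0)"
    for J0 J1 q
  proof -
    have "conservative_strengthening L C (big_conj J1) (big_conj J0)"
      using fc J unfolding finitely_conservative_def by simp
    note extension = this[unfolded conservative_strengthening_big_conj_iff[OF J(2) order_trans[OF J(3) T(1)]
          small_subset[OF J(3) T(2)]], rule_format]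
    have "(\<Union>\<psi>\<in>J0. subsentences L C \<psi>) \<subseteq> subsentences L C (big_conj J0)"
      by (subst subsentences_big_conj[OF small_subset[OF order_trans[OF J(2,3)] T(2)]]) (rule Un_upper2)
    with q(2) have "q \<subseteq> subsentences L C (big_conj J0)"
      by (rule order_trans)
    then show ?thesis
      by (rule extension[OF q(1) _ q(3)])
  qed
  have start: "boolean_consistent (expand L C) (s0 \<union> s)"
    by (rule boolean_consistent_mono[OF p(3)]) (auto simp: s0_def)
  interpret forcing L C T s0
  proof (rule forcing.intro)
    show "\<exists>J. finite J \<and> J \<noteq> {} \<and> J \<subseteq> T \<and> s0 \<subseteq> (\<Union>\<psi>\<in>J. subsentences L C \<psi>) \<and>
        boolean_consistent (expand L C) (s0 \<union> J)"
      using s start by (intro exI[of _ s]) (simp add: s0_def)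
    show "finite s0"
      using p(1) by (simp add: s0_def)
  qed (fact C T extension)+
  obtain B :: "('r, 'c, 'v) univ gorder"
    and M :: "('r, 'c, ('r, 'c, 'v) univ, ('r, 'c, 'v) univ) bvm" and \<nu>
    where sat: "satisfies (expand L C) B M \<nu> (s0 \<union> T)"
    using consistent_with_theory unfolding boolean_consistent_iff_satisfies by blast
  \<comment> \<open>The model satisfies \<open>s\<close>, hence also the members of \<open>p\<close>
    that were dropped in passing to \<open>s0\<close>, as they are instances of
    \<open>big_conj s\<close>.\<close>
  have "satisfies (expand L C) B M \<nu> s"
    using sat by (rule satisfies_mono) (rule le_supI2[OF s(3)])
  note inst_top = satisfies_inst_big_conj[OF small_subset[OF s(3) T(2)] order_trans[OF s(3) T(1)] this]
  have "val B M \<nu> \<chi> = \<top>\<^bsub>B\<^esub>" if \<chi>: "\<chi> \<in> p \<union> T" for \<chi>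
  proof (cases "\<chi> \<in> s0 \<union> T")
    case True
    then show ?thesis
      using sat by (simp add: satisfies_def)
  next
    case False
    then have "\<chi> \<in> p" "\<chi> \<notin> (\<Union>\<psi>\<in>s. subsentences L C \<psi>)"
      using \<chi> by (auto simp: s0_def)
    moreover have "\<chi> \<in> subsentences L C (big_conj s)"
      using \<open>\<chi> \<in> p\<close> p(2) by (rule rev_subsetD)
    then have "\<chi> \<in> range (\<lambda>a. inst a (big_conj s)) \<inter> subsentences L C (big_conj s) \<union>
        (\<Union>\<psi>\<in>s. subsentences L C \<psi>)"
      by (subst (asm) subsentences_big_conj[OF small_subset[OF s(3) T(2)]])
    ultimately have "\<chi> \<in> range (\<lambda>a. inst a (big_conj s))"
      by blast
    then show ?thesis
      using inst_top by auto
  qed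
  then have "satisfies (expand L C) B M \<nu> (p \<union> T)"
    using sat by (simp add: satisfies_def)
  then show ?thesis
    unfolding boolean_consistent_iff_satisfies by blast
qed

theorem theorem4p14:
  fixes L :: "('r, 'c) signature" and C :: "'c set" and T :: "('r, 'c, 'v) fm set"
  assumes "infinite (UNIV :: 'v set)"
    and "infinite C" and "C \<inter> constants L = {}"
    and "T \<subseteq> sentences L |C|" and "|T| <o |UNIV :: 'v set|"
    and "\<exists>\<psi>\<in>T. boolean_consistent L {\<psi>}"
  shows "finitely_conservative L C T \<longleftrightarrow>
    (\<forall>s. s \<noteq> {} \<and> finite s \<and> s \<subseteq> T \<longrightarrow>
      conservative_strengthening L C (big_conj T) (big_conj s))"
proof
  assume "finitely_conservative L C T"
  note extension = consistent_extension[OF assms(2-5) this]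
  show "\<forall>s. s \<noteq> {} \<and> finite s \<and> s \<subseteq> T \<longrightarrow> conservative_strengthening L C (big_conj T) (big_conj s)"
  proof (intro allI impI)
    fix s assume s: "s \<noteq> {} \<and> finite s \<and> s \<subseteq> T"
    then have "s \<subseteq> T" by simp
    show "conservative_strengthening L C (big_conj T) (big_conj s)"
      unfolding conservative_strengthening_big_conj_iff[OF \<open>s \<subseteq> T\<close> assms(4,5)]
      by (intro allI impI extension[of s]) (simp_all add: s)
  qed
next
  assume *: "\<forall>s. s \<noteq> {} \<and> finite s \<and> s \<subseteq> T \<longrightarrow> conservative_strengthening L C (big_conj T) (big_conj s)"
  have "conservative_strengthening L C (big_conj J1) (big_conj J0)"
    if J: "J0 \<noteq> {}" "J0 \<subseteq> J1" "J1 \<subseteq> T" "finite J1" for J0 J1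
  proof -
    have J0: "J0 \<subseteq> T" "finite J0"
      using J finite_subset by auto
    then have "conservative_strengthening L C (big_conj T) (big_conj J0)"
      using * J(1) by simp
    note T_extension = this[unfolded conservative_strengthening_big_conj_iff[OF J0(1) assms(4,5)], rule_format]
    \<comment> \<open>\<open>J1\<close> lies between \<open>J0\<close> and \<open>T\<close>: extend
      to \<open>T\<close> by assumption, then restrict to \<open>J1\<close>.\<close>
    have "boolean_consistent (expand L C) (p \<union> J1)"
      if "finite p" "p \<subseteq> subsentences L C (big_conj J0)" "boolean_consistent (expand L C) (p \<union> J0)" for p
      using T_extension[OF that] by (rule boolean_consistent_mono) (use J(3) in blast)
    then show ?thesis
      using conservative_strengthening_big_conj_iff[OF J(2) order_trans[OF J(3) assms(4)] small_subset[OF J(3) assms(5)]]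
      by simp
  qed
  then show "finitely_conservative L C T"
    unfolding finitely_conservative_def using assms(6) by simp
qed

end
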